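(* Let $\mathcal D$ be a distribution over clustering instances with $k$ clusters and at most $n$ points, and let $\mathcal S=\{(\mathcal V^{(i)},\vec Z^{(i)})\}_{i=1}^m$ be an i.i.d. sample from $\mathcal D\times\mathrm{Uniform}([0,1]^k)$. For parameters $\alpha,\beta$ let $L_S(\alpha,\beta)=\frac1m\sum_{i=1}^m\mathtt{clus}_{\alpha,\beta}(\mathcal V^{(i)},\vec Z^{(i)})$ and $L_{\mathcal D}(\alpha,\beta)=\mathbb E[\mathtt{clus}_{\alpha,\beta}(\mathcal V,\vec Z)]$. Then: (1) For any $\epsilon>0$, $\delta>0$ and parameter interval $[\alpha_\ell,\alpha_h]$ with $\alpha_\ell>0$, if $m=O\bigl((H/\epsilon)^2(\min(T,k)\log n+\log k+\log\frac1\delta+\log\log\frac{\alpha_h}{\alpha_\ell})\bigr)$, then with probability at least $1-\delta$, for all $(\alpha,\beta)\in[\alpha_\ell,\alpha_h]\times[1,\infty]$, $|L_S(\alpha,\beta)-L_{\mathcal D}(\alpha,\beta)|<\epsilon$. (2) Suppose the maximum ratio of any two non-zero distances is bounded by $R$ for all clustering instances in the support of $\mathcal D$. Then for any $\epsilon>0$, $\delta>0$ and parameter interval $[0,\alpha_h)$, if $m=O\bigl((H/\epsilon)^2(\min(T,k)\log n+\log k+\log\frac1\delta+\log\log(\alpha_h\log R))\bigr)$, then with probability at least $1-\delta$, for all $(\alpha,\beta)\in[0,\alpha_h]\times[1,\infty]$, $|L_S(\alpha,\beta)-L_{\mathcal D}(\alpha,\beta)|<\epsilon$.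
   Context: A clustering instance $\mathcal V=(V,d,k)$ consists of a finite point set $V$, a metric $d$, and $k$; it comes with a cost function on clusterings (e.g. Hamming distance to a target clustering) taking values in $[0,H]$. The deterministic $(\alpha,\beta)$-Lloyds++ algorithm on input $(\mathcal V,\vec Z)$, $\vec Z=(z_1,\dots,z_k)\in[0,1]^k$: Phase 1: starting from $C=\emptyset$, for $t=1,\dots,k$, order points $v_1,\dots,v_n$ so that $d_i=\min_{c\in C}d(v_i,c)$ is nonincreasing (round 1: equal weights), let $D_i(\alpha)=\sum_{j\le i}d_j^\alpha$, partition $[0,1]$ into intervals $I_{v_i}=[D_{i-1}(\alpha)/D_n(\alpha),D_i(\alpha)/D_n(\alpha))$, and add the point whose interval contains $z_t$ (so for uniform $\vec Z$ this is $d^\alpha$-sampling). Phase 2: run $\beta$-Lloyd's method for at most $T$ iterations: repeatedly take the Voronoi partition $\{C_1,\dots,C_k\}$ induced by the current centers and replace the centers by $\arg\min_{x\in V}\sum_{v\in C_i}d(x,v)^\beta$ (for $\beta=\infty$, minimize the maximum distance), stopping early if centers do not change. $\mathtt{clus}_{\alpha,\beta}(\mathcal V,\vec Z)\in[0,H]$ is the cost of the output clustering.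
   Formalization: Formally n ≥ 2, k ≥ 1 and T ≥ 1 are assumed, and log log in the sample bounds is replaced by 0 where it is negative or undefined (e.g. αh/αl < e, or R = 1); without this the bound can vanish or be negative and the claim fails. *)

theory Defs
  imports "HOL-Probability.Probability" "HOL-Analysis.Abstract_Metric_Spaces"
begin

text \<open>
  The point set of an instance is \<open>{..<npts I}\<close>. The enumeration of the points serves to break ties:
  the least index always wins. Only distances between points of the instance matter.
  The cost function \<open>cl_cost I\<close> is part of the instance, so that it may, for example,
  be the distance to a target clustering that varies with the instance.
\<close>

record clustering_inst =
  npts :: nat
  dst :: "nat \<Rightarrow> nat \<Rightarrow> real"
  ncl :: nat
  cl_cost :: "nat set set \<Rightarrow> real"

definition valid_inst :: "nat \<Rightarrow> nat \<Rightarrow> real \<Rightarrow> clustering_inst \<Rightarrow> bool" where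
  "valid_inst n k H I \<longleftrightarrow>
     0 < npts I \<and> npts I \<le> n \<and> ncl I = k \<and> Metric_space {..<npts I} (dst I) \<and>
     (\<forall>P. partition_on {..<npts I} P \<and> card P \<le> k \<longrightarrow> cl_cost I P \<in> {0..H})"

text \<open>
  The \<open>\<sigma>\<close>-algebra on instances may be any one for which the number of points,
  every distance and every value of the cost function are random variables.
\<close>

definition inst_distribution :: "nat \<Rightarrow> nat \<Rightarrow> real \<Rightarrow> clustering_inst measure \<Rightarrow> bool" where
  "inst_distribution n k H D \<longleftrightarrow>
     prob_space D \<and> (\<forall>I\<in>space D. valid_inst n k H I) \<and>
     npts \<in> D \<rightarrow>\<^sub>M count_space UNIV \<and>
     (\<forall>p q. (\<lambda>I. dst I p q) \<in> borel_measurable D) \<and>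
     (\<forall>P. (\<lambda>I. cl_cost I P) \<in> borel_measurable D)"

subsection \<open>Phase 1: seeding\<close>

text \<open>The value 1 for \<open>C = {}\<close> gives all points equal weight in the first round.\<close>

definition dmin :: "clustering_inst \<Rightarrow> nat set \<Rightarrow> nat \<Rightarrow> real" where
  "dmin I C v = (if C = {} then 1 else Min (dst I v ` C))"

definition seed_order :: "clustering_inst \<Rightarrow> nat set \<Rightarrow> nat list" where
  "seed_order I C = sort_key (\<lambda>v. - dmin I C v) [0..<npts I]"

text \<open>
  Since \<open>0 powr 0 = 0\<close>, a point that is already a center has weight 0 also for \<open>\<alpha> = 0\<close>:
  the seeding is then uniform on the remaining points, the limit for \<open>\<alpha>\<close> tending to 0.
\<close>

definition cum_weight :: "clustering_inst \<Rightarrow> real \<Rightarrow> nat set \<Rightarrow> nat \<Rightarrow> real" where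
  "cum_weight I \<alpha> C i = (\<Sum>j<i. dmin I C (seed_order I C ! j) powr \<alpha>)"

definition seed_interval :: "clustering_inst \<Rightarrow> real \<Rightarrow> nat set \<Rightarrow> nat \<Rightarrow> real set" where
  "seed_interval I \<alpha> C i =
     {cum_weight I \<alpha> C i / cum_weight I \<alpha> C (npts I) ..<
      cum_weight I \<alpha> C (Suc i) / cum_weight I \<alpha> C (npts I)}"

text \<open>
  The last case is only reached if \<open>z\<close> is outside \<open>{0..<1}\<close>, which has probability 0,
  or if all points are centers already.
\<close>

definition seed_pick :: "clustering_inst \<Rightarrow> real \<Rightarrow> nat set \<Rightarrow> real \<Rightarrow> nat" where
  "seed_pick I \<alpha> C z =
     (if \<exists>i<npts I. z \<in> seed_interval I \<alpha> C i
      then seed_order I C ! (THE i. i < npts I \<and> z \<in> seed_interval I \<alpha> C i)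
      else last (seed_order I C))"

primrec seeds :: "clustering_inst \<Rightarrow> real \<Rightarrow> (nat \<Rightarrow> real) \<Rightarrow> nat \<Rightarrow> nat set" where
  "seeds I \<alpha> Z 0 = {}"
| "seeds I \<alpha> Z (Suc t) = insert (seed_pick I \<alpha> (seeds I \<alpha> Z t) (Z t)) (seeds I \<alpha> Z t)"

subsection \<open>Phase 2: Lloyd's method\<close>

definition nearest :: "clustering_inst \<Rightarrow> nat set \<Rightarrow> nat \<Rightarrow> nat" where
  "nearest I C v = (LEAST c. is_arg_min (dst I v) (\<lambda>c. c \<in> C) c)"

definition voronoi :: "clustering_inst \<Rightarrow> nat set \<Rightarrow> nat set set" where
  "voronoi I C = (\<lambda>c. {v \<in> {..<npts I}. nearest I C v = c}) ` C"

definition center_cost :: "clustering_inst \<Rightarrow> ereal \<Rightarrow> nat set \<Rightarrow> nat \<Rightarrow> real" where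
  "center_cost I \<beta> S x =
     (if \<beta> = \<infinity> then Max (dst I x ` S) else (\<Sum>v\<in>S. dst I x v powr real_of_ereal \<beta>))"

definition best_center :: "clustering_inst \<Rightarrow> ereal \<Rightarrow> nat set \<Rightarrow> nat" where
  "best_center I \<beta> S = (LEAST x. is_arg_min (center_cost I \<beta> S) (\<lambda>x. x < npts I) x)"

definition lloyd_step :: "clustering_inst \<Rightarrow> ereal \<Rightarrow> nat set \<Rightarrow> nat set" where
  "lloyd_step I \<beta> C = best_center I \<beta> ` voronoi I C"

primrec lloyd :: "clustering_inst \<Rightarrow> ereal \<Rightarrow> nat \<Rightarrow> nat set \<Rightarrow> nat set" where
  "lloyd I \<beta> 0 C = C"
| "lloyd I \<beta> (Suc t) C =
     (let C' = lloyd_step I \<beta> C in if C' = C then C else lloyd I \<beta> t C')"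

text \<open>\<open>T\<close> is the maximal number of iterations in the second phase.\<close>

definition clus :: "nat \<Rightarrow> real \<Rightarrow> ereal \<Rightarrow> clustering_inst \<Rightarrow> (nat \<Rightarrow> real) \<Rightarrow> real" where
  "clus T \<alpha> \<beta> I Z = cl_cost I (voronoi I (lloyd I \<beta> T (seeds I \<alpha> Z (ncl I))))"

subsection \<open>Samples and losses\<close>

definition unit_cube :: "nat \<Rightarrow> (nat \<Rightarrow> real) measure" where
  "unit_cube k = (\<Pi>\<^sub>M t\<in>{..<k}. uniform_measure lborel {0..1})"

definition sample_measure ::
  "clustering_inst measure \<Rightarrow> nat \<Rightarrow> nat \<Rightarrow> (nat \<Rightarrow> clustering_inst \<times> (nat \<Rightarrow> real)) measure" where
  "sample_measure D k m = (\<Pi>\<^sub>M i\<in>{..<m}. D \<Otimes>\<^sub>M unit_cube k)"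

definition emp_loss ::
  "nat \<Rightarrow> nat \<Rightarrow> (nat \<Rightarrow> clustering_inst \<times> (nat \<Rightarrow> real)) \<Rightarrow> real \<Rightarrow> ereal \<Rightarrow> real" where
  "emp_loss T m S \<alpha> \<beta> = (\<Sum>i<m. clus T \<alpha> \<beta> (fst (S i)) (snd (S i))) / real m"

definition true_loss ::
  "nat \<Rightarrow> nat \<Rightarrow> clustering_inst measure \<Rightarrow> real \<Rightarrow> ereal \<Rightarrow> real" where
  "true_loss T k D \<alpha> \<beta> = (\<integral>(I, Z). clus T \<alpha> \<beta> I Z \<partial>(D \<Otimes>\<^sub>M unit_cube k))"

text \<open>
  With probability at least \<open>1 - \<delta>\<close>, the two losses differ by less than \<open>\<epsilon>\<close> for all
  \<open>\<alpha> \<in> A\<close> and \<open>\<beta> \<in> [1, \<infinity>]\<close>. The event ranges over uncountably many parameters and need not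
  belong to the product \<open>\<sigma>\<close>-algebra, so it is required to contain a measurable event
  of that probability.
\<close>

definition uniformly_close ::
  "nat \<Rightarrow> nat \<Rightarrow> clustering_inst measure \<Rightarrow> nat \<Rightarrow> real set \<Rightarrow> real \<Rightarrow> real \<Rightarrow> bool" where
  "uniformly_close T k D m A \<epsilon> \<delta> \<longleftrightarrow>
     (\<exists>E \<in> sets (sample_measure D k m).
        measure (sample_measure D k m) E \<ge> 1 - \<delta> \<and>
        (\<forall>S\<in>E. \<forall>\<alpha>\<in>A. \<forall>\<beta>\<in>{1..\<infinity>}. \<bar>emp_loss T m S \<alpha> \<beta> - true_loss T k D \<alpha> \<beta>\<bar> < \<epsilon>))"

definition distance_ratio_bounded :: "real \<Rightarrow> clustering_inst \<Rightarrow> bool" where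
  "distance_ratio_bounded R I \<longleftrightarrow>
     (\<forall>p<npts I. \<forall>q<npts I. \<forall>p'<npts I. \<forall>q'<npts I.
        dst I p q \<noteq> 0 \<longrightarrow> dst I p' q' \<noteq> 0 \<longrightarrow> dst I p q / dst I p' q' \<le> R)"

text \<open>
  The iterated logarithm inside the \<open>O\<close>-bounds: \<open>ln (ln x)\<close> for \<open>x \<ge> exp 1\<close>. For smaller \<open>x\<close>
  (short parameter intervals), where \<open>ln (ln x)\<close> is negative or undefined, it is replaced by 0.
\<close>

definition loglog :: "real \<Rightarrow> real" where
  "loglog x = ln (max 1 (ln (max 1 x)))"

end

theory Submission
  imports Defs
begin

text \<open>
  The parameter space is covered by boxes on which, outside an event of probability \<open>p\<close>, the output
  clustering is constant. In the \<open>\<alpha>\<close>-direction the endpoints of the seeding intervals move monotonically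
  and by at most \<open>n (b - a) / a\<close> between \<open>a\<close> and \<open>b\<close> (by at most \<open>n (b - a) ln R\<close> for distance ratios up to
  \<open>R\<close>), and \<open>z\<^sub>t\<close> is independent of the earlier rounds, so a geometric grid in \<open>\<alpha>\<close> works. Once the
  seeds are fixed, Lloyd's method changes only where two sums \<open>\<Sum>\<^sub>v d(x,v) powr \<beta>\<close> cross; exponential
  sums have few zeros, which gives at most \<open>n\<^sup>7\<close> to the power \<open>min T k\<close> breakpoints in \<open>\<beta>\<close>, and the
  \<open>\<beta>\<close>-axis can be cut into proportionally many pieces that each contain a breakpoint with probability
  at most \<open>p\<close>. Such covers for \<open>p = 4\<^sup>-\<^sup>j\<close> feed a chaining argument based on Bernstein's inequality.
  All parameters involved are deterministic, so no measurability question arises for the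
  supremum over the uncountable parameter space.
\<close>

subsection \<open>Chaining\<close>

text \<open>A union bound over a single cover needs cells with exceptional probability of order
  \<open>\<epsilon> / H\<close>; their number would put a logarithm of \<open>H / \<epsilon>\<close>
  into \<open>m\<close>, which is why covers of all scales are prepared. Only the logarithm of their
  common factor \<open>N\<close> matters. The grid in \<alpha> has about
  \<open>ln (\<alpha>h / \<alpha>l)\<close> cells, so it enters as an iterated logarithm; fixed
  powers of \<open>n\<close> and \<open>k\<close> cost only multiples of \<open>ln n\<close> and
  \<open>ln k\<close>; the leading term comes from the breakpoints in \<beta>. For these there are
  two independent counts, one by branching over the \<open>T\<close> steps and one by summing over
  the at most \<open>n ^ k\<close> center sets, and \<open>min T k\<close> is their combination. The
  positions of the breakpoints depend on the distances of the instance in no regular way, so no grid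
  in \<beta> fixed in advance can work. The cells are adapted to the distribution instead, through
  the expected number of breakpoints, and an exponent that is a breakpoint with large probability
  becomes a cell by itself.\<close>

lemma exp_le_one_plus_square:
  fixes x :: real
  assumes "x \<le> 1"
  shows "exp x \<le> 1 + x + x\<^sup>2"
proof (cases "0 \<le> x")
  case True
  then show ?thesis using exp_bound assms by blast
next
  case False
  then have "1 - x \<le> exp (- x)" using exp_ge_add_one_self[of "-x"] by simp
  moreover have "exp x * exp (- x) = 1" by (simp flip: exp_add)
  moreover have "0 < exp x" by simp
  ultimately have a: "exp x * (1 - x) \<le> 1"
    by (metis mult_left_mono less_imp_le)
  \<comment> \<open>The product \<open>(1 + x + x\<^sup>2) * (1 - x)\<close> equals
    \<open>1 - x ^ 3\<close>, so for negative \<open>x\<close> both sides are separated by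
    \<open>1 / (1 - x)\<close>.\<close>
  have "x ^ 3 \<le> 0" using False by (simp add: power_le_zero_eq)
  then have "1 \<le> (1 + x + x\<^sup>2) * (1 - x)"
    by (simp add: algebra_simps power2_eq_square power3_eq_cube)
  then have "exp x * (1 - x) \<le> (1 + x + x\<^sup>2) * (1 - x)" using a by linarith
  then show ?thesis using False mult_right_le_imp_le[of "exp x" "1-x"] by simp
qed

text \<open>Chernoff's method with \<open>exp y \<le> 1 + y + y\<^sup>2\<close>, available because
  \<open>l * X \<omega>\<close> never exceeds 1. Only the raw second moment enters, and
  \<open>l\<close> stays free: chaining uses three regimes, with \<open>v\<close> ranging from
  \<open>H\<^sup>2\<close> down to a multiple of a small probability.\<close>

lemma bernstein_upper:
  fixes X :: "'a \<Rightarrow> real"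
  assumes "prob_space M" and [measurable]: "X \<in> borel_measurable M"
    and bd: "\<And>\<omega>. \<omega> \<in> space M \<Longrightarrow> \<bar>X \<omega>\<bar> \<le> H"
    and v: "(\<integral>\<omega>. (X \<omega>)\<^sup>2 \<partial>M) \<le> v" and l: "0 \<le> l" "l * H \<le> 1"
  shows "measure (\<Pi>\<^sub>M i\<in>{..<m}. M)
      {S \<in> space (\<Pi>\<^sub>M i\<in>{..<m}. M). real m * (\<integral>\<omega>. X \<omega> \<partial>M) + real m * t \<le> (\<Sum>i<m. X (S i))}
    \<le> exp (- (real m * (l * t - l\<^sup>2 * v)))"
proof -
  interpret M: prob_space M by fact
  interpret product_prob_space "\<lambda>_::nat. M" "{..<m}" by unfold_locales
  let ?P = "\<Pi>\<^sub>M i\<in>{..<m}. M"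
  let ?\<mu> = "\<integral>\<omega>. X \<omega> \<partial>M"
  have iX: "integrable M X"
    by (rule M.integrable_const_bound[of _ H]) (use bd in auto)
  have iX2: "integrable M (\<lambda>\<omega>. (X \<omega>)\<^sup>2)"
    by (rule M.integrable_const_bound[of _ "H\<^sup>2"]) (use bd in \<open>auto simp: abs_le_square_iff[symmetric] intro!: order_trans[OF _ abs_ge_self]\<close>)
  have lX: "l * X \<omega> \<le> 1" if "\<omega> \<in> space M" for \<omega>
  proof -
    have "l * X \<omega> \<le> l * H" using bd[OF that] l by (intro mult_left_mono) auto
    then show ?thesis using l by simp
  qed
  have ie: "integrable M (\<lambda>\<omega>. exp (l * X \<omega>))"
    by (rule M.integrable_const_bound[of _ "exp 1"]) (use lX in auto)
  have "(\<integral>\<omega>. exp (l * X \<omega>) \<partial>M) \<le> (\<integral>\<omega>. 1 + l * X \<omega> + l\<^sup>2 * (X \<omega>)\<^sup>2 \<partial>M)"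
    using iX iX2 ie exp_le_one_plus_square lX
    by (intro integral_mono, simp, simp) (metis power_mult_distrib)
  also have "\<dots> = 1 + l * ?\<mu> + l\<^sup>2 * (\<integral>\<omega>. (X \<omega>)\<^sup>2 \<partial>M)"
    using iX iX2 by (simp add: M.prob_space)
  also have "\<dots> \<le> 1 + (l * ?\<mu> + l\<^sup>2 * v)"
    using v by (simp add: mult_left_mono)
  also have "\<dots> \<le> exp (l * ?\<mu> + l\<^sup>2 * v)" by (rule exp_ge_add_one_self)
  finally have mgf: "(\<integral>\<omega>. exp (l * X \<omega>) \<partial>M) \<le> exp (l * ?\<mu> + l\<^sup>2 * v)" .
  have prodeq: "exp (l * (\<Sum>i<m. X (S i))) = (\<Prod>i<m. exp (l * X (S i)))" for S :: "nat \<Rightarrow> 'a"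
    by (simp add: sum_distrib_left exp_sum)
  have int: "integrable ?P (\<lambda>S. exp (l * (\<Sum>i<m. X (S i))))"
    unfolding prodeq by (rule product_integrable_prod) (use ie in auto)
  have "(\<integral>S. exp (l * (\<Sum>i<m. X (S i))) \<partial>?P) = (\<Prod>i<m. (\<integral>\<omega>. exp (l * X \<omega>) \<partial>M))"
    unfolding prodeq by (rule product_integral_prod) (use ie in auto)
  also have "\<dots> \<le> (\<Prod>i<m. exp (l * ?\<mu> + l\<^sup>2 * v))"
    using mgf by (intro prod_mono) (auto intro!: integral_nonneg)
  also have "\<dots> = exp (real m * (l * ?\<mu> + l\<^sup>2 * v))" by (simp add: exp_of_nat_mult)
  finally have E: "(\<integral>S. exp (l * (\<Sum>i<m. X (S i))) \<partial>?P) \<le> exp (real m * (l * ?\<mu> + l\<^sup>2 * v))" .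
  let ?c = "exp (l * (real m * ?\<mu> + real m * t))"
  have "measure ?P {S \<in> space ?P. real m * ?\<mu> + real m * t \<le> (\<Sum>i<m. X (S i))}
      \<le> measure ?P {S \<in> space ?P. exp (l * (\<Sum>i<m. X (S i))) \<ge> ?c}"
    using l by (intro finite_measure_mono) (auto intro: mult_left_mono)
  also have "\<dots> \<le> (\<integral>S. exp (l * (\<Sum>i<m. X (S i))) \<partial>?P) / ?c"
    by (rule integral_Markov_inequality_measure[OF int, where A="{}"]) auto
  also have "\<dots> \<le> exp (real m * (l * ?\<mu> + l\<^sup>2 * v)) / ?c"
    using E by (simp add: divide_right_mono)
  also have "\<dots> = exp (- (real m * (l * t - l\<^sup>2 * v)))"
    by (simp flip: exp_diff add: algebra_simps)
  finally show ?thesis .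
qed

lemma bernstein_two_sided:
  fixes X :: "'a \<Rightarrow> real"
  assumes "prob_space M" and [measurable]: "X \<in> borel_measurable M"
    and bd: "\<And>\<omega>. \<omega> \<in> space M \<Longrightarrow> \<bar>X \<omega>\<bar> \<le> H"
    and v: "(\<integral>\<omega>. (X \<omega>)\<^sup>2 \<partial>M) \<le> v" and l: "0 \<le> l" "l * H \<le> 1"
  shows "measure (\<Pi>\<^sub>M i\<in>{..<m}. M)
      {S \<in> space (\<Pi>\<^sub>M i\<in>{..<m}. M). real m * t \<le> \<bar>(\<Sum>i<m. X (S i)) - real m * (\<integral>\<omega>. X \<omega> \<partial>M)\<bar>}
    \<le> 2 * exp (- (real m * (l * t - l\<^sup>2 * v)))"
proof -
  interpret M: prob_space M by fact
  interpret product_prob_space "\<lambda>_::nat. M" "{..<m}" by unfold_locales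
  let ?P = "\<Pi>\<^sub>M i\<in>{..<m}. M"
  let ?A = "{S \<in> space ?P. real m * (\<integral>\<omega>. X \<omega> \<partial>M) + real m * t \<le> (\<Sum>i<m. X (S i))}"
  let ?B = "{S \<in> space ?P. real m * (\<integral>\<omega>. - X \<omega> \<partial>M) + real m * t \<le> (\<Sum>i<m. - X (S i))}"
  have "measure ?P {S \<in> space ?P. real m * t \<le> \<bar>(\<Sum>i<m. X (S i)) - real m * (\<integral>\<omega>. X \<omega> \<partial>M)\<bar>}
     \<le> measure ?P (?A \<union> ?B)"
    by (intro finite_measure_mono) (auto simp: sum_negf abs_if split: if_splits)
  also have "\<dots> \<le> measure ?P ?A + measure ?P ?B"
    by (rule measure_Un_le) measurable
  also have "\<dots> \<le> exp (- (real m * (l * t - l\<^sup>2 * v))) + exp (- (real m * (l * t - l\<^sup>2 * v)))"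
    using assms by (intro add_mono bernstein_upper) auto
  finally show ?thesis by simp
qed

text \<open>Serves the thresholds \<open>t j\<close> of the chaining argument: their sum over all
  levels stays below \<open>\<epsilon> / 16 * 4\<close>.\<close>

lemma sum_Suc_div_power2: "(\<Sum>j<J. real (Suc j) / 2 ^ j) = 4 - (2 * real J + 4) / 2 ^ J"
proof (induction J)
  case (Suc J)
  have "4 - (2 * real J + 4) / 2 ^ J + real (Suc J) / 2 ^ J = 4 - (2 * real (Suc J) + 4) / 2 ^ Suc J"
    by (simp add: field_simps)
  then show ?case using Suc by (simp only: sum.lessThan_Suc)
qed simp

text \<open>Here \<open>exp (- L)\<close> is at most \<delta>, and \<open>exp 4 \<ge> 16\<close>
  turns the slack of 4 per level into a factor \<open>(1/16) ^ Suc j\<close>. Each union bound of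
  the chaining argument ends here, after the logarithm of the number of cells has been subtracted
  from the exponent.\<close>

lemma exp_tail:
  fixes L \<delta> q :: real
  assumes "1 \<le> \<delta> * exp L" "L + 4 * real (Suc j) \<le> q"
  shows "2 * exp (- q) \<le> \<delta> / 8 * (1/2) ^ j"
proof -
  have "exp (-q) \<le> exp (- L - 4 * real (Suc j))" using assms by simp
  also have "\<dots> = exp (- L) * exp (-4) ^ Suc j"
    by (simp add: exp_diff exp_minus exp_add field_simps flip: exp_of_nat_mult)
  also have "\<dots> \<le> \<delta> * (1/16) ^ Suc j"
  proof (rule mult_mono)
    show "exp (-L) \<le> \<delta>" using assms(1) by (simp add: exp_minus field_simps)
    have "(2::real) ^ 4 \<le> exp 1 ^ 4" using exp_ge_add_one_self[of 1] by (intro power_mono) auto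
    then have "(16::real) \<le> exp 4" by (simp flip: exp_of_nat_mult)
    then show "exp (-4) ^ Suc j \<le> (1/16 :: real) ^ Suc j"
      by (intro power_mono) (auto simp: exp_minus field_simps)
    show "0 \<le> \<delta>" using assms(1) by (smt (verit) exp_gt_zero mult_nonpos_nonneg)
  qed simp
  also have "\<dots> \<le> \<delta> * (1/16 * (1/2) ^ j)"
  proof -
    have "0 \<le> \<delta>" using assms(1) by (smt (verit) exp_gt_zero mult_nonpos_nonneg)
    moreover have "(1/16) ^ Suc j \<le> (1/16 * (1/2) ^ j :: real)"
      using power_mono[of "1/16" "1/2 :: real" j] by simp
    ultimately show ?thesis by (intro mult_left_mono)
  qed
  finally show ?thesis by simp
qed

text \<open>
  Chaining along deterministic covers. A parameter is approximated by representatives of ever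
  smaller cells; consecutive representatives give the same cost except with probability \<open>O(4\<^sup>-\<^sup>j)\<close>, so
  Bernstein's inequality pays for the \<open>N 64\<^sup>j\<close> cells of level \<open>j\<close> without a factor \<open>log (H / \<epsilon>)\<close>.
\<close>
theorem uniform_convergence_of_covers:
  fixes f :: "'p \<Rightarrow> 'a \<Rightarrow> real"
  assumes "prob_space M"
    and meas: "\<And>\<theta>. \<theta> \<in> \<Theta> \<Longrightarrow> f \<theta> \<in> borel_measurable M"
    and bd: "\<And>\<theta> \<omega>. \<theta> \<in> \<Theta> \<Longrightarrow> \<omega> \<in> space M \<Longrightarrow> f \<theta> \<omega> \<in> {0..H}"
    and H: "0 < H" and N: "3 \<le> N" and \<delta>: "0 < \<delta>" "\<delta> \<le> 1" and \<epsilon>: "0 < \<epsilon>" "\<epsilon> \<le> H"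
    and cover: "\<And>j. \<exists>\<U>. finite \<U> \<and> real (card \<U>) \<le> N * 64 ^ j \<and> \<Union>\<U> = \<Theta> \<and>
      (\<forall>U\<in>\<U>. \<exists>E\<in>sets M. measure M E \<le> (1/4) ^ j \<and>
         (\<forall>\<omega>\<in>space M - E. \<forall>\<theta>\<in>U. \<forall>\<theta>'\<in>U. f \<theta> \<omega> = f \<theta>' \<omega>))"
    and m: "32768 * (H / \<epsilon>)\<^sup>2 * (ln N + ln (1 / \<delta>)) \<le> real m"
  shows "\<exists>E\<in>sets (\<Pi>\<^sub>M i\<in>{..<m}. M). measure (\<Pi>\<^sub>M i\<in>{..<m}. M) E \<ge> 1 - \<delta> \<and>
    (\<forall>S\<in>E. \<forall>\<theta>\<in>\<Theta>. \<bar>(\<Sum>i<m. f \<theta> (S i)) / real m - (\<integral>\<omega>. f \<theta> \<omega> \<partial>M)\<bar> < \<epsilon>)"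
proof -
  interpret M: prob_space M by fact
  interpret product_prob_space "\<lambda>_::nat. M" "{..<m}" by unfold_locales
  let ?P = "\<Pi>\<^sub>M i\<in>{..<m}. M"
  define r where "r = \<epsilon> / H"
  have r: "0 < r" "r \<le> 1" and \<epsilon>r: "\<epsilon> = r * H" using H \<epsilon> by (auto simp: r_def)
  define L where "L = ln N + ln (1 / \<delta>)"
  have "exp 1 \<le> N" using N e_less_272 by linarith
  then have "1 \<le> ln N" using N by (subst ln_ge_iff) auto
  moreover have "0 \<le> ln (1 / \<delta>)" using \<delta> by (intro ln_ge_zero) auto
  ultimately have L: "1 \<le> L" by (simp add: L_def)
  have expL: "exp L = N / \<delta>" using N \<delta> by (simp add: L_def exp_add)
  have \<delta>L: "1 \<le> \<delta> * exp L" and NL: "N \<le> exp L"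
    using N \<delta> by (auto simp: expL field_simps mult_left_le)
  have mr: "32768 * L \<le> real m * r\<^sup>2"
    using m r H \<epsilon> unfolding L_def[symmetric] r_def by (simp add: field_simps)
  then have m0: "0 < real m" using L r by (cases "m = 0") auto

  let ?cov = "\<lambda>j \<U>. finite \<U> \<and> real (card \<U>) \<le> N * 64 ^ j \<and> \<Union>\<U> = \<Theta> \<and>
      (\<forall>U\<in>\<U>. \<exists>E\<in>sets M. measure M E \<le> (1/4) ^ j \<and>
         (\<forall>\<omega>\<in>space M - E. \<forall>\<theta>\<in>U. \<forall>\<theta>'\<in>U. f \<theta> \<omega> = f \<theta>' \<omega>))"
  define \<U> where "\<U> j = Eps (?cov j)" for j
  have cov: "?cov j (\<U> j)" for j unfolding \<U>_def by (rule someI_ex[of "?cov j", OF cover])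
  note \<U> = cov[THEN conjunct1] cov[THEN conjunct2, THEN conjunct1]
    cov[THEN conjunct2, THEN conjunct2, THEN conjunct1] cov[THEN conjunct2, THEN conjunct2, THEN conjunct2]
  \<comment> \<open>Empty cells are dropped so that every remaining one owns a representative
    \<open>\<rho> U\<close>.\<close>
  define V where "V j = \<U> j - {{}}" for j
  define \<rho> where "\<rho> U = (SOME \<theta>. \<theta> \<in> U)" for U :: "'p set"
  have \<rho>: "\<rho> U \<in> U" "\<rho> U \<in> \<Theta>" if "U \<in> V j" for U j
  proof -
    show "\<rho> U \<in> U" using that unfolding \<rho>_def V_def by (simp add: some_in_eq)
    then show "\<rho> U \<in> \<Theta>" using that \<U>(3)[of j] unfolding V_def by blast
  qed
  have finV: "finite (V j)" for j using \<U>(1) by (simp add: V_def)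
  \<comment> \<open>Since \<open>64 \<le> exp 6\<close>, a level costs 6 in the exponent.\<close>
  have cardV: "real (card (V j)) \<le> exp (L + 6 * real j)" for j
  proof -
    have "real (card (V j)) \<le> real (card (\<U> j))"
      by (simp add: V_def card_mono \<U>(1))
    also have "\<dots> \<le> N * 64 ^ j" by (rule \<U>)
    also have "\<dots> \<le> exp L * exp 6 ^ j"
    proof (intro mult_mono power_mono NL)
      have "(2::real) ^ 6 \<le> exp 1 ^ 6" using exp_ge_add_one_self[of 1] by (intro power_mono) auto
      then show "(64::real) \<le> exp 6" by (simp flip: exp_of_nat_mult)
    qed auto
    also have "\<dots> = exp (L + 6 * real j)" by (simp add: exp_add mult.commute flip: exp_of_nat_mult)
    finally show ?thesis .
  qed
  let ?bad = "\<lambda>j U E. E \<in> sets M \<and> measure M E \<le> (1/4) ^ j \<and>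
     (\<forall>\<omega>\<in>space M - E. \<forall>\<theta>\<in>U. \<forall>\<theta>'\<in>U. f \<theta> \<omega> = f \<theta>' \<omega>)"
  define E where "E j U = Eps (?bad j U)" for j U
  have E': "?bad j U (E j U)" if "U \<in> V j" for j U
  proof -
    have "U \<in> \<U> j" using that by (simp add: V_def)
    from bspec[OF \<U>(4) this] show ?thesis
      unfolding E_def Bex_def by (rule someI_ex[of "?bad j U"])
  qed
  have E: "E j U \<in> sets M" "measure M (E j U) \<le> (1/4) ^ j" if "U \<in> V j" for j U
    using E'[OF that, THEN conjunct1] E'[OF that, THEN conjunct2, THEN conjunct1] by this+
  have Eeq: "f \<theta> \<omega> = f \<theta>' \<omega>"
    if "U \<in> V j" "\<omega> \<in> space M" "\<omega> \<notin> E j U" "\<theta> \<in> U" "\<theta>' \<in> U" for j U \<omega> \<theta> \<theta>'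
    by (rule E'[OF that(1), THEN conjunct2, THEN conjunct2, rule_format]) (use that in auto)

  \<comment> \<open>The last level is the first with \<open>2 ^ J \<ge> 8 / r\<close>. It makes the
    exceptional events of level \<open>J\<close> as rare as \<open>r\<^sup>2 / 64\<close>, while
    \<open>2 ^ J \<le> 16 / r\<close> keeps the parameters \<open>l\<close> of the links admissible
    and lets the sample size dominate \<open>J\<close>.\<close>
  obtain J :: nat where J: "8 / r \<le> 2 ^ J" "2 ^ J \<le> 16 / r"
  proof -
    define J where "J = (LEAST j. 8 / r \<le> 2 ^ j)"
    have ex: "\<exists>j. 8 / r \<le> (2::real) ^ j"
      using real_arch_pow[of 2 "8 / r"] by (auto intro: less_imp_le)
    have 1: "8 / r \<le> 2 ^ J" unfolding J_def by (rule LeastI_ex[OF ex])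
    have "J \<noteq> 0"
    proof
      assume "J = 0"
      then show False using 1 r by (simp add: field_simps)
    qed
    then obtain j where j: "J = Suc j" using not0_implies_Suc by blast
    then have "\<not> 8 / r \<le> 2 ^ j" unfolding J_def using not_less_Least[of j] by (metis lessI J_def)
    then have "2 ^ J \<le> 16 / r" by (simp add: j)
    with 1 show ?thesis by (rule that)
  qed
  have J4: "(1/4 :: real) ^ J \<le> r\<^sup>2 / 64"
  proof -
    have "(8 / r)\<^sup>2 \<le> (2 ^ J)\<^sup>2" using J(1) r by (intro power_mono) auto
    then have "64 / r\<^sup>2 \<le> 4 ^ J" by (simp add: power_divide power2_eq_square flip: power_mult_distrib)
    then show ?thesis using r by (simp add: field_simps)
  qed

  define dev where "dev X S = (\<Sum>i<m. X (S i)) - real m * (\<integral>\<omega>. X \<omega> \<partial>M)" for X and S :: "nat \<Rightarrow> 'a"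
  \<comment> \<open>Thresholds proportional to \<open>1 / 2 ^ j\<close> would give all links the
    same exponent. The factor \<open>Suc j\<close> makes it grow linearly and outweigh the logarithm
    of the number of links, which is linear in \<open>j\<close> as well.\<close>
  define t where "t j = \<epsilon> / 16 * (real (Suc j) / 2 ^ j)" for j
  define A0 where "A0 U = {S \<in> space ?P. real m * (\<epsilon> / 4) \<le> \<bar>dev (f (\<rho> U)) S\<bar>}" for U
  define A1 where "A1 j p = {S \<in> space ?P. real m * t j \<le> \<bar>dev (\<lambda>\<omega>. f (\<rho> (snd p)) \<omega> - f (\<rho> (fst p)) \<omega>) S\<bar>}" for j p
  \<comment> \<open>Not a deviation of \<open>f\<close>: this controls how many samples fall into
    the exceptional event of the last cell, where only the bound \<open>H\<close> relates
    \<open>f \<theta>\<close> to the representative.\<close>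
  define A2 where "A2 U = {S \<in> space ?P. real m * (r / 8) \<le> \<bar>dev (indicator (E J U)) S\<bar>}" for U
  \<comment> \<open>Only cells with a common parameter are compared; it carries the equality of
    costs from one representative to the other.\<close>
  define link where "link j = {p \<in> V j \<times> V (Suc j). fst p \<inter> snd p \<noteq> {}}" for j
  have finlink: "finite (link j)" for j using finV by (auto simp: link_def)
  have mf[measurable]: "f (\<rho> U) \<in> borel_measurable M" if "U \<in> V j" for U j
    using meas \<rho>(2) that by blast
  have bdf: "\<bar>f (\<rho> U) \<omega>\<bar> \<le> H" if "U \<in> V j" "\<omega> \<in> space M" for U j \<omega>
    using bd[OF \<rho>(2) that(2)] that by auto
  have int: "integrable M (f (\<rho> U))" if "U \<in> V j" for U j
    by (rule M.integrable_const_bound[of _ H]) (use bdf mf that in auto)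

  have mA0[measurable]: "A0 U \<in> sets ?P" if "U \<in> V 0" for U
    using mf[OF that] unfolding A0_def dev_def by measurable
  have mA1: "A1 j p \<in> sets ?P" if "p \<in> link j" for j p
  proof -
    have "fst p \<in> V j" "snd p \<in> V (Suc j)" using that by (auto simp: link_def)
    from this[THEN mf] show ?thesis unfolding A1_def dev_def by measurable
  qed
  have mA2: "A2 U \<in> sets ?P" if "U \<in> V J" for U
    using E(1)[OF that] unfolding A2_def dev_def by measurable

  have p0: "measure ?P (A0 U) \<le> 2 * exp (- (512 * L))" if U: "U \<in> V 0" for U
  proof -
    \<comment> \<open>The optimal \<open>l\<close> is the threshold over twice the second moment,
      here \<open>(\<epsilon> / 4) / (2 * H\<^sup>2)\<close>.\<close>
    have "measure ?P (A0 U) \<le> 2 * exp (- (real m * (\<epsilon> / (8 * H\<^sup>2) * (\<epsilon> / 4) - (\<epsilon> / (8 * H\<^sup>2))\<^sup>2 * H\<^sup>2)))"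
      unfolding A0_def dev_def
    proof (rule bernstein_two_sided)
      show "(\<integral>\<omega>. (f (\<rho> U) \<omega>)\<^sup>2 \<partial>M) \<le> H\<^sup>2"
      proof -
        have "(\<integral>\<omega>. (f (\<rho> U) \<omega>)\<^sup>2 \<partial>M) \<le> (\<integral>\<omega>. H\<^sup>2 \<partial>M)"
          using bdf[OF U] H mf[OF U]
          by (intro integral_mono M.integrable_const_bound[of _ "H\<^sup>2"]) (auto simp: abs_le_square_iff[symmetric])
        then show ?thesis by (simp add: M.prob_space)
      qed
      show "\<epsilon> / (8 * H\<^sup>2) * H \<le> 1" using \<epsilon> H by (simp add: power2_eq_square field_simps)
    qed (use U bdf mf \<epsilon> in \<open>auto intro: M.prob_space_axioms\<close>)
    also have "real m * (\<epsilon> / (8 * H\<^sup>2) * (\<epsilon> / 4) - (\<epsilon> / (8 * H\<^sup>2))\<^sup>2 * H\<^sup>2) = real m * r\<^sup>2 / 64"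
      using H by (simp add: \<epsilon>r power2_eq_square field_simps)
    also have "2 * exp (- (real m * r\<^sup>2 / 64)) \<le> 2 * exp (- (512 * L))" using mr by simp
    finally show ?thesis .
  qed
  have p1: "measure ?P (A1 j p) \<le> 2 * exp (- (16 * real (Suc j) * L))" if p: "p \<in> link j" and j: "j < J" for j p
  proof -
    obtain U U' where pp: "p = (U, U')" by force
    have U: "U \<in> V j" "U' \<in> V (Suc j)" "U \<inter> U' \<noteq> {}" using p by (auto simp: link_def pp)
    then obtain \<theta> where \<theta>: "\<theta> \<in> U" "\<theta> \<in> U'" by blast
    let ?X = "\<lambda>\<omega>. f (\<rho> U') \<omega> - f (\<rho> U) \<omega>"
    \<comment> \<open>Off \<open>F\<close> both representatives agree with the common parameter,
      hence with each other, so the second moment is at most \<open>H\<^sup>2\<close> times the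
      probability of \<open>F\<close>.\<close>
    define F where "F = E j U \<union> E (Suc j) U'"
    \<comment> \<open>The optimum \<open>t j / (2 * v)\<close> without its factor
      \<open>Suc j\<close>, so that \<open>l * H \<le> 1\<close> follows from
      \<open>2 ^ j \<le> 16 / r\<close> alone. The exponent is still linear in
      \<open>j\<close>.\<close>
    define l where "l = 2 ^ j * \<epsilon> / (64 * H\<^sup>2)"
    define v where "v = H\<^sup>2 * (2 * (1/4) ^ j)"
    have mX: "?X \<in> borel_measurable M" using mf[OF U(1)] mf[OF U(2)] by measurable
    have F: "F \<in> sets M" using E(1) U by (auto simp: F_def)
    have bX: "\<bar>?X \<omega>\<bar> \<le> H" if "\<omega> \<in> space M" for \<omega>
      using bd[OF \<rho>(2)[OF U(1)] that] bd[OF \<rho>(2)[OF U(2)] that] by auto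
    have X0: "?X \<omega> = 0" if "\<omega> \<in> space M" "\<omega> \<notin> F" for \<omega>
      using Eeq[OF U(1) that(1) _ \<theta>(1) \<rho>(1)[OF U(1)]] Eeq[OF U(2) that(1) _ \<theta>(2) \<rho>(1)[OF U(2)]] that(2)
      by (auto simp: F_def)
    have "measure ?P (A1 j p) \<le> 2 * exp (- (real m * (l * t j - l\<^sup>2 * v)))"
      unfolding A1_def dev_def pp fst_conv snd_conv
    proof (rule bernstein_two_sided[OF M.prob_space_axioms mX bX])
      have le: "(?X \<omega>)\<^sup>2 \<le> H\<^sup>2 * indicator F \<omega>" if "\<omega> \<in> space M" for \<omega>
        using X0[OF that] bX[OF that] H
        by (cases "\<omega> \<in> F") (auto simp: abs_le_square_iff[symmetric])
      have "(\<integral>\<omega>. (?X \<omega>)\<^sup>2 \<partial>M) \<le> (\<integral>\<omega>. H\<^sup>2 * indicator F \<omega> \<partial>M)"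
        using le F mX bX H
        by (intro integral_mono M.integrable_const_bound[of _ "H\<^sup>2"])
          (auto simp: abs_le_square_iff[symmetric] split: split_indicator)
      also have "\<dots> = H\<^sup>2 * measure M F" using F by simp
      also have "\<dots> \<le> v"
        unfolding v_def
      proof (rule mult_left_mono)
        have "measure M F \<le> measure M (E j U) + measure M (E (Suc j) U')"
          unfolding F_def using E(1) U by (intro measure_Un_le) auto
        also have "\<dots> \<le> (1/4) ^ j + (1/4) ^ Suc j" by (intro add_mono E(2) U)
        also have "\<dots> \<le> 2 * (1/4) ^ j" by simp
        finally show "measure M F \<le> 2 * (1/4) ^ j" .
      qed simp
      finally show "(\<integral>\<omega>. (?X \<omega>)\<^sup>2 \<partial>M) \<le> v" .
      show "0 \<le> l" using \<epsilon> by (simp add: l_def)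
      have "(2::real) ^ j \<le> 2 ^ J" using j by simp
      then have "2 ^ j \<le> 16 / r" using J(2) by linarith
      then have "2 ^ j * r \<le> 64" using r by (simp add: field_simps)
      then show "l * H \<le> 1" using H by (simp add: l_def \<epsilon>r power2_eq_square field_simps)
    qed
    also have "\<dots> \<le> 2 * exp (- (16 * real (Suc j) * L))"
    proof -
      have p4: "(2::real) ^ j * 2 ^ j = 4 ^ j" by (simp flip: power_mult_distrib)
      have "l * t j - l\<^sup>2 * v = r\<^sup>2 * (real (Suc j) / 1024 - 1 / 2048)"
        using H p4 by (simp add: l_def t_def v_def \<epsilon>r power2_eq_square field_simps)
      also have "\<dots> \<ge> r\<^sup>2 * (real (Suc j) / 2048)" by (intro mult_left_mono) auto
      finally have "real m * (r\<^sup>2 * (real (Suc j) / 2048)) \<le> real m * (l * t j - l\<^sup>2 * v)"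
        by (intro mult_left_mono) auto
      moreover have "32768 * L * (real (Suc j) / 2048) \<le> real m * r\<^sup>2 * (real (Suc j) / 2048)"
        using mr by (intro mult_right_mono) auto
      moreover have "32768 * L * (real (Suc j) / 2048) = 16 * real (Suc j) * L"
        "real m * (r\<^sup>2 * (real (Suc j) / 2048)) = real m * r\<^sup>2 * (real (Suc j) / 2048)"
        by simp_all
      ultimately have "16 * real (Suc j) * L \<le> real m * (l * t j - l\<^sup>2 * v)" by linarith
      then show ?thesis by simp
    qed
    finally show ?thesis .
  qed
  have p2: "measure ?P (A2 U) \<le> 2 * exp (- (128 * real (Suc J) * L))" if U: "U \<in> V J" for U
  proof -
    note [measurable] = E(1)[OF U]
    \<comment> \<open>An indicator is bounded by 1, so \<open>l = 1\<close> is admissible. The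
      exponent is then linear in \<open>r\<close> instead of quadratic, enough to pay for the cells
      of level \<open>J\<close>.\<close>
    have "measure ?P (A2 U) \<le> 2 * exp (- (real m * (1 * (r / 8) - 1\<^sup>2 * (r\<^sup>2 / 64))))"
      unfolding A2_def dev_def
    proof (rule bernstein_two_sided)
      have "(\<integral>\<omega>. (indicator (E J U) \<omega>)\<^sup>2 \<partial>M) = measure M (E J U)"
      proof -
        have "(\<lambda>\<omega>. (indicator (E J U) \<omega>)\<^sup>2 :: real) = indicator (E J U)"
          by (auto simp: fun_eq_iff split: split_indicator)
        then show ?thesis by simp
      qed
      then show "(\<integral>\<omega>. (indicator (E J U) \<omega>)\<^sup>2 \<partial>M) \<le> r\<^sup>2 / 64"
        using E(2)[OF U] J4 by linarith
      show "\<bar>indicator (E J U) \<omega>\<bar> \<le> (1::real)" for \<omega> by (simp add: indicator_def)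
    qed (auto intro: M.prob_space_axioms)
    also have "\<dots> \<le> 2 * exp (- (128 * real (Suc J) * L))"
    proof -
      have "r\<^sup>2 \<le> r" using r by (simp add: power2_eq_square mult_left_le)
      then have "r / 16 \<le> 1 * (r / 8) - 1\<^sup>2 * (r\<^sup>2 / 64)" using r by simp
      then have "real m * (r / 16) \<le> real m * (1 * (r / 8) - 1\<^sup>2 * (r\<^sup>2 / 64))"
        by (intro mult_left_mono) auto
      moreover have "128 * real (Suc J) * L \<le> real m * (r / 16)"
      proof -
        have "real (Suc J) \<le> 2 ^ J"
          using less_exp[of J] by (metis Suc_leI of_nat_le_iff of_nat_numeral of_nat_power)
        then have sJ: "real (Suc J) \<le> 16 / r" using J(2) by linarith
        have "128 * real (Suc J) * L \<le> 128 * (16 / r) * L" using sJ L r by (intro mult_mono) auto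
        also have "\<dots> = 32768 * L / (16 * r)" by (simp add: field_simps)
        also have "\<dots> \<le> real m * r\<^sup>2 / (16 * r)" using mr r by (intro divide_right_mono) auto
        also have "\<dots> = real m * (r / 16)" using r by (simp add: power2_eq_square)
        finally show ?thesis .
      qed
      ultimately show ?thesis by simp
    qed
    finally show ?thesis .
  qed

  \<comment> \<open>The three kinds of bad events receive \<open>\<delta> / 8\<close>,
    \<open>\<delta> / 4\<close> and \<open>\<delta> / 8\<close>.\<close>
  let ?B0 = "\<Union>U\<in>V 0. A0 U" and ?B1 = "\<Union>j<J. \<Union>p\<in>link j. A1 j p" and ?B2 = "\<Union>U\<in>V J. A2 U"
  have mB: "?B0 \<in> sets ?P" "?B1 \<in> sets ?P" "?B2 \<in> sets ?P"
    using mA0 mA1 mA2 finV finlink by (auto intro!: sets.finite_UN)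
  have b0: "measure ?P ?B0 \<le> \<delta> / 8"
  proof -
    have "measure ?P ?B0 \<le> (\<Sum>U\<in>V 0. measure ?P (A0 U))"
      using mA0 finV by (intro finite_measure_subadditive_finite) auto
    also have "\<dots> \<le> real (card (V 0)) * (2 * exp (- (512 * L)))"
      using p0 by (intro sum_bounded_above) auto
    also have "\<dots> \<le> exp (L + 6 * real 0) * (2 * exp (- (512 * L)))"
      by (intro mult_right_mono cardV) auto
    also have "\<dots> = 2 * exp (- (511 * L))" by (simp flip: exp_add)
    also have "\<dots> \<le> \<delta> / 8 * (1/2) ^ 0" using L by (intro exp_tail[OF \<delta>L]) auto
    finally show ?thesis by simp
  qed
  have b2: "measure ?P ?B2 \<le> \<delta> / 8"
  proof -
    have "measure ?P ?B2 \<le> (\<Sum>U\<in>V J. measure ?P (A2 U))"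
      using mA2 finV by (intro finite_measure_subadditive_finite) auto
    also have "\<dots> \<le> real (card (V J)) * (2 * exp (- (128 * real (Suc J) * L)))"
      using p2 by (intro sum_bounded_above) auto
    also have "\<dots> \<le> exp (L + 6 * real J) * (2 * exp (- (128 * real (Suc J) * L)))"
      by (intro mult_right_mono cardV) auto
    also have "\<dots> = 2 * exp (- (128 * real (Suc J) * L - (L + 6 * real J)))" by (simp flip: exp_add)
    also have "\<dots> \<le> \<delta> / 8 * (1/2) ^ 0"
    proof (rule exp_tail[OF \<delta>L])
      define y where "y = real (Suc J) * L"
      have "real (Suc J) * 1 \<le> y" unfolding y_def using L by (intro mult_left_mono) auto
      moreover have "1 * L \<le> y" unfolding y_def using L by (intro mult_right_mono) auto
      moreover have "128 * real (Suc J) * L = 128 * y" by (simp add: y_def)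
      ultimately show "L + 4 * real (Suc 0) \<le> 128 * real (Suc J) * L - (L + 6 * real J)"
        using L by simp
    qed
    finally show ?thesis by simp
  qed
  have b1: "measure ?P ?B1 \<le> \<delta> / 4"
  proof -
    have "measure ?P ?B1 \<le> (\<Sum>j<J. measure ?P (\<Union>p\<in>link j. A1 j p))"
      using mA1 finlink by (intro finite_measure_subadditive_finite) (auto intro!: sets.finite_UN)
    also have "\<dots> \<le> (\<Sum>j<J. \<delta> / 8 * (1/2) ^ j)"
    proof (rule sum_mono)
      fix j assume j: "j \<in> {..<J}"
      have "measure ?P (\<Union>p\<in>link j. A1 j p) \<le> (\<Sum>p\<in>link j. measure ?P (A1 j p))"
        using mA1 finlink by (intro finite_measure_subadditive_finite) auto
      also have "\<dots> \<le> real (card (link j)) * (2 * exp (- (16 * real (Suc j) * L)))"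
        using p1 j by (intro sum_bounded_above) auto
      also have "\<dots> \<le> (exp (L + 6 * real j) * exp (L + 6 * real (Suc j))) * (2 * exp (- (16 * real (Suc j) * L)))"
      proof (rule mult_right_mono)
        have "real (card (link j)) \<le> real (card (V j \<times> V (Suc j)))"
          using finV by (intro of_nat_mono card_mono) (auto simp: link_def)
        also have "\<dots> = real (card (V j)) * real (card (V (Suc j)))" by (simp add: card_cartesian_product)
        also have "\<dots> \<le> exp (L + 6 * real j) * exp (L + 6 * real (Suc j))"
          by (intro mult_mono cardV) auto
        finally show "real (card (link j)) \<le> exp (L + 6 * real j) * exp (L + 6 * real (Suc j))" .
      qed simp
      also have "\<dots> = 2 * exp (- (16 * (real (Suc j) * L) - (2 * L + 12 * real j + 6)))"
        by (simp add: algebra_simps flip: exp_add)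
      also have "\<dots> \<le> \<delta> / 8 * (1/2) ^ j"
      proof (rule exp_tail[OF \<delta>L])
        have "real j * 1 \<le> real j * L" using L by (intro mult_left_mono) auto
        then show "L + 4 * real (Suc j) \<le> 16 * (real (Suc j) * L) - (2 * L + 12 * real j + 6)"
          using L by (simp add: algebra_simps)
      qed
      finally show "measure ?P (\<Union>p\<in>link j. A1 j p) \<le> \<delta> / 8 * (1/2) ^ j" .
    qed
    also have "\<dots> = \<delta> / 8 * (\<Sum>j<J. (1/2) ^ j)" by (simp add: sum_distrib_left)
    also have "\<dots> \<le> \<delta> / 8 * 2"
      using \<delta> by (intro mult_left_mono) (auto simp: sum_gp_strict)
    finally show ?thesis by simp
  qed
  let ?Bad = "?B0 \<union> ?B1 \<union> ?B2"
  have "measure ?P ?Bad \<le> measure ?P (?B0 \<union> ?B1) + measure ?P ?B2"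
    using mB by (intro measure_Un_le) auto
  moreover have "measure ?P (?B0 \<union> ?B1) \<le> measure ?P ?B0 + measure ?P ?B1"
    using mB by (intro measure_Un_le) auto
  ultimately have B: "measure ?P ?Bad \<le> \<delta>" using b0 b1 b2 \<delta> by linarith

  show ?thesis
  proof (intro bexI[of _ "space ?P - ?Bad"] conjI ballI)
    show "space ?P - ?Bad \<in> sets ?P" using mB by auto
    show "1 - \<delta> \<le> measure ?P (space ?P - ?Bad)"
      using B prob_compl[of ?Bad] mB by auto
    fix S \<theta> assume S: "S \<in> space ?P - ?Bad" and \<theta>: "\<theta> \<in> \<Theta>"
    have Sm: "S i \<in> space M" if "i < m" for i using S that by (auto simp: space_PiM PiE_iff)
    have "\<forall>j. \<exists>U\<in>V j. \<theta> \<in> U" using \<theta> \<U>(3) unfolding V_def by blast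
    then obtain U where U: "\<And>j. U j \<in> V j" "\<And>j. \<theta> \<in> U j" by metis
    define g where "g j = f (\<rho> (U j))" for j
    have ig: "integrable M (g j)" for j unfolding g_def by (rule int[OF U(1)])
    have d0: "\<bar>dev (g 0) S\<bar> < real m * (\<epsilon> / 4)"
    proof -
      have "S \<notin> A0 (U 0)" using S U(1)[of 0] by blast
      then show ?thesis using S by (auto simp: A0_def g_def)
    qed
    have d1: "\<bar>dev (\<lambda>\<omega>. g (Suc j) \<omega> - g j \<omega>) S\<bar> \<le> real m * t j" if "j < J" for j
    proof -
      have "(U j, U (Suc j)) \<in> link j" using U(1)[of j] U(1)[of "Suc j"] U(2)[of j] U(2)[of "Suc j"] by (auto simp: link_def)
      then have "S \<notin> A1 j (U j, U (Suc j))" using S that by blast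
      then show ?thesis using S by (auto simp: A1_def g_def)
    qed
    \<comment> \<open>Telescoping along the representatives of the cells that contain \<theta>:
      \<open>\<epsilon> / 4\<close> for the start and, in the end, \<open>\<epsilon> / 4\<close> for
      all links together.\<close>
    have tele: "\<bar>dev (g j) S\<bar> < real m * (\<epsilon> / 4) + (\<Sum>i<j. real m * t i)" if "j \<le> J" for j
      using that
    proof (induction j)
      case 0
      then show ?case using d0 by simp
    next
      case (Suc j)
      have "dev (g (Suc j)) S = dev (g j) S + dev (\<lambda>\<omega>. g (Suc j) \<omega> - g j \<omega>) S"
        using ig by (simp add: dev_def sum_subtractf algebra_simps)
      then show ?case using Suc d1[of j] by simp
    qed
    have "(\<Sum>i<J. real m * t i) = real m * (\<epsilon> / 16 * (\<Sum>i<J. real (Suc i) / 2 ^ i))"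
      by (simp add: t_def sum_distrib_left)
    also have "\<dots> \<le> real m * (\<epsilon> / 16 * 4)"
      unfolding sum_Suc_div_power2 using \<epsilon> by (intro mult_left_mono) auto
    finally have dJ: "\<bar>dev (g J) S\<bar> < real m * (\<epsilon> / 2)" using tele[of J] by (simp add: field_simps)
    let ?F = "E J (U J)"
    have F: "?F \<in> sets M" "measure M ?F \<le> r\<^sup>2 / 64" using E U J4 order_trans by blast+
    have "r\<^sup>2 \<le> r" using r by (simp add: power2_eq_square mult_left_le)
    then have F8: "measure M ?F \<le> r / 64" using F by simp
    have "S \<notin> A2 (U J)" using S U(1)[of J] by blast
    then have "dev (indicator ?F) S < real m * (r / 8)" using S by (auto simp: A2_def)
    then have cnt: "(\<Sum>i<m. indicator ?F (S i)) < real m * (r / 8) + real m * measure M ?F"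
      using F by (simp add: dev_def)
    have iF: "integrable M (\<lambda>\<omega>. H * indicator ?F \<omega> :: real)" using F by (simp add: M.emeasure_eq_measure)
    have fg: "\<bar>f \<theta> \<omega> - g J \<omega>\<bar> \<le> H * indicator ?F \<omega>" if "\<omega> \<in> space M" for \<omega>
    proof (cases "\<omega> \<in> ?F")
      case True
      then show ?thesis using bd[OF \<theta> that] bd[OF \<rho>(2)[OF U(1)] that, of J] by (auto simp: g_def)
    next
      case False
      then show ?thesis using Eeq[OF U(1) that _ U(2) \<rho>(1)[OF U(1)]] by (simp add: g_def)
    qed
    have i\<theta>: "integrable M (f \<theta>)"
      by (rule M.integrable_const_bound[of _ H]) (use bd[OF \<theta>] meas[OF \<theta>] in auto)
    have "\<bar>(\<Sum>i<m. f \<theta> (S i)) - (\<Sum>i<m. g J (S i))\<bar> \<le> (\<Sum>i<m. \<bar>f \<theta> (S i) - g J (S i)\<bar>)"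
      unfolding sum_subtractf[symmetric] by (rule sum_abs)
    also have "\<dots> \<le> (\<Sum>i<m. H * indicator ?F (S i))" by (intro sum_mono fg Sm) auto
    also have "\<dots> = H * (\<Sum>i<m. indicator ?F (S i))" by (simp add: sum_distrib_left)
    also have "\<dots> \<le> H * (real m * (r / 8) + real m * (r / 64))"
    proof (rule mult_left_mono)
      have "real m * measure M ?F \<le> real m * (r / 64)" using F8 by (intro mult_left_mono) auto
      then show "(\<Sum>i<m. indicator ?F (S i)) \<le> real m * (r / 8) + real m * (r / 64)"
        using cnt by linarith
    qed (use H in auto)
    finally have e1: "\<bar>(\<Sum>i<m. f \<theta> (S i)) - (\<Sum>i<m. g J (S i))\<bar> \<le> real m * (\<epsilon> * (9/64))"
      by (simp add: \<epsilon>r algebra_simps)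
    have "\<bar>(\<integral>\<omega>. f \<theta> \<omega> \<partial>M) - (\<integral>\<omega>. g J \<omega> \<partial>M)\<bar> = \<bar>\<integral>\<omega>. f \<theta> \<omega> - g J \<omega> \<partial>M\<bar>"
      using i\<theta> ig by simp
    also have "\<dots> \<le> (\<integral>\<omega>. \<bar>f \<theta> \<omega> - g J \<omega>\<bar> \<partial>M)" by (rule integral_abs_bound)
    also have "\<dots> \<le> (\<integral>\<omega>. H * indicator ?F \<omega> \<partial>M)"
      using i\<theta> ig iF fg by (intro integral_mono) auto
    also have "\<dots> = H * measure M ?F" using F by simp
    also have "\<dots> \<le> H * (r / 64)" using F8 H by (intro mult_left_mono) auto
    finally have "real m * \<bar>(\<integral>\<omega>. f \<theta> \<omega> \<partial>M) - (\<integral>\<omega>. g J \<omega> \<partial>M)\<bar> \<le> real m * (\<epsilon> / 64)"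
      by (intro mult_left_mono) (auto simp: \<epsilon>r algebra_simps)
    then have e2: "\<bar>real m * (\<integral>\<omega>. f \<theta> \<omega> \<partial>M) - real m * (\<integral>\<omega>. g J \<omega> \<partial>M)\<bar> \<le> real m * (\<epsilon> / 64)"
      by (simp flip: right_diff_distrib add: abs_mult)
    have "\<bar>(\<Sum>i<m. f \<theta> (S i)) - real m * (\<integral>\<omega>. f \<theta> \<omega> \<partial>M)\<bar> < real m * \<epsilon>"
    proof -
      \<comment> \<open>The shares of the chain, of the empirical error on the last cell and of the
        true error on the last cell.\<close>
      have "real m * (\<epsilon> / 2) + real m * (\<epsilon> * (9/64)) + real m * (\<epsilon> / 64) \<le> real m * \<epsilon>"
        using \<epsilon> by (simp flip: distrib_left)
      then show ?thesis using e1 e2 dJ unfolding dev_def by linarith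
    qed
    then have "\<bar>(\<Sum>i<m. f \<theta> (S i)) - real m * (\<integral>\<omega>. f \<theta> \<omega> \<partial>M)\<bar> / real m < \<epsilon>"
      using m0 by (simp add: field_simps)
    moreover have "(\<Sum>i<m. f \<theta> (S i)) / real m - (\<integral>\<omega>. f \<theta> \<omega> \<partial>M)
        = ((\<Sum>i<m. f \<theta> (S i)) - real m * (\<integral>\<omega>. f \<theta> \<omega> \<partial>M)) / real m"
      using m0 by (simp add: field_simps)
    ultimately show "\<bar>(\<Sum>i<m. f \<theta> (S i)) / real m - (\<integral>\<omega>. f \<theta> \<omega> \<partial>M)\<bar> < \<epsilon>"
      by (simp add: abs_divide)
  qed
qed

subsection \<open>Cells with few random breakpoints\<close>

text \<open>Induction on the largest zero: Rolle's theorem supplies a zero of the derivative between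
  the two largest zeros. The claim that every zero in \<open>F'\<close> lies below some element of
  \<open>F\<close> is carried along, since it separates the new zero from the earlier ones.\<close>

lemma Rolle_card_zeros:
  fixes f f' :: "real \<Rightarrow> real"
  assumes "\<And>x. (f has_real_derivative f' x) (at x)" "finite F" "\<And>x. x \<in> F \<Longrightarrow> f x = 0"
  shows "\<exists>F'. finite F' \<and> card F \<le> Suc (card F') \<and> (\<forall>x\<in>F'. f' x = 0 \<and> (\<exists>y\<in>F. x < y))"
  using assms(2,3)
proof (induction F rule: finite_linorder_max_induct)
  case empty
  then show ?case by (intro exI[of _ "{}"]) auto
next
  case (insert b A)
  show ?case
  proof (cases "A = {}")
    case True
    then show ?thesis by (intro exI[of _ "{}"]) auto
  next
    case False
    obtain F' where F': "finite F'" "card A \<le> Suc (card F')" "\<forall>x\<in>F'. f' x = 0 \<and> (\<exists>y\<in>A. x < y)"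
      using insert by auto
    define a where "a = Max A"
    have a: "a \<in> A" "\<And>y. y \<in> A \<Longrightarrow> y \<le> a" using insert(1) False by (auto simp: a_def)
    have "a < b" using a insert by auto
    moreover have "f a = f b" using insert.prems a by simp
    moreover have "continuous_on {a..b} f"
      using assms(1) by (intro continuous_at_imp_continuous_on ballI) (auto intro: DERIV_isCont)
    ultimately obtain z where z: "a < z" "z < b" "f' z = 0"
      using Rolle[of a b f] assms(1) by (metis DERIV_unique real_differentiable_def)
    have "z \<notin> F'" using F' a z by force
    then show ?thesis using F' z insert
      by (intro exI[of _ "insert z F'"]) (auto intro: a)
  qed
qed

text \<open>Multiplication by \<open>exp (- y * b)\<close> moves no zeros and makes the term of
  \<open>y\<close> constant, so differentiation removes it; by Rolle's theorem at most one zero is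
  lost. The new coefficients \<open>c v * (v - y)\<close> do not all vanish, as the one at
  \<open>y'\<close> survives; if there is no such \<open>y'\<close>, the sum is a single exponential
  without zeros.\<close>

lemma exp_sum_card_zeros:
  fixes c :: "real \<Rightarrow> real"
  assumes "finite Y" "y \<in> Y" "c y \<noteq> 0" "finite F" "\<And>b. b \<in> F \<Longrightarrow> (\<Sum>y\<in>Y. c y * exp (y * b)) = 0"
  shows "card F \<le> card Y"
  using assms
proof (induction "card Y" arbitrary: Y c F y)
  case 0
  then show ?case by auto
next
  case (Suc n)
  show ?case
  proof (cases "\<exists>y'\<in>Y - {y}. c y' \<noteq> 0")
    case False
    then have "(\<Sum>y\<in>Y. c y * exp (y * b)) = c y * exp (y * b)" for b
      using Suc.prems by (subst sum.remove[of _ y]) (auto intro!: sum.neutral)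
    then have "F = {}" using Suc.prems by auto
    then show ?thesis by simp
  next
    case True
    then obtain y' where y': "y' \<in> Y" "y' \<noteq> y" "c y' \<noteq> 0" by auto
    define g where "g b = (\<Sum>v\<in>Y. c v * exp ((v - y) * b))" for b
    define g' where "g' b = (\<Sum>v\<in>Y - {y}. (c v * (v - y)) * exp ((v - y) * b))" for b
    have "g b = exp (- y * b) * (\<Sum>v\<in>Y. c v * exp (v * b))" for b
      unfolding g_def sum_distrib_left by (intro sum.cong) (auto simp: algebra_simps simp flip: exp_add)
    then have g0: "g b = 0" if "b \<in> F" for b using Suc.prems(5)[OF that] by simp
    have "(g has_real_derivative g' b) (at b)" for b
    proof -
      have "(g has_real_derivative (\<Sum>v\<in>Y. (c v * (v - y)) * exp ((v - y) * b))) (at b)"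
        unfolding g_def by (auto intro!: derivative_eq_intros sum.cong)
      also have "(\<Sum>v\<in>Y. (c v * (v - y)) * exp ((v - y) * b)) = g' b"
        unfolding g'_def using Suc.prems by (subst sum.remove[of _ y]) auto
      finally show ?thesis .
    qed
    from Rolle_card_zeros[OF this Suc.prems(4) g0]
    obtain F' where F': "finite F'" "card F \<le> Suc (card F')" "\<And>x. x \<in> F' \<Longrightarrow> g' x = 0" by blast
    have "card F' \<le> card (Y - {y})"
    proof (rule Suc.hyps(1)[where y=y' and c="\<lambda>v. c v * (v - y)"])
      show "n = card (Y - {y})" using Suc by simp
      show "(\<Sum>v\<in>Y - {y}. c v * (v - y) * exp (v * b)) = 0" if "b \<in> F'" for b
      proof -
        have "g' b = exp (- y * b) * (\<Sum>v\<in>Y - {y}. c v * (v - y) * exp (v * b))"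
          unfolding g'_def sum_distrib_left by (intro sum.cong) (auto simp: algebra_simps simp flip: exp_add)
        then show ?thesis using F'(3)[OF that] by simp
      qed
    qed (use Suc.prems y' F' in auto)
    then show ?thesis using F' Suc by simp
  qed
qed

text \<open>A nonzero value at one point excludes that all coefficients vanish, and finiteness
  follows because the bound holds for every finite set of zeros.\<close>

lemma exp_sum_zeros:
  fixes c :: "real \<Rightarrow> real"
  assumes Y: "finite Y" and nz: "(\<Sum>y\<in>Y. c y * exp (y * b0)) \<noteq> 0"
  shows "finite {b. (\<Sum>y\<in>Y. c y * exp (y * b)) = 0}" "card {b. (\<Sum>y\<in>Y. c y * exp (y * b)) = 0} \<le> card Y"
proof -
  have "\<exists>y\<in>Y. c y \<noteq> 0"
  proof (rule ccontr)
    assume "\<not> ?thesis"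
    then have "(\<Sum>y\<in>Y. c y * exp (y * b0)) = 0" by (intro sum.neutral) auto
    then show False using nz by simp
  qed
  then obtain y where y: "y \<in> Y" "c y \<noteq> 0" by blast
  let ?Z = "{b. (\<Sum>y\<in>Y. c y * exp (y * b)) = 0}"
  have le: "card F \<le> card Y" if "finite F" "F \<subseteq> ?Z" for F
    by (rule exp_sum_card_zeros[where c=c and y=y]) (use Y y that in auto)
  show fin: "finite ?Z"
  proof (rule ccontr)
    assume "infinite ?Z"
    then obtain F where "finite F" "card F = Suc (card Y)" "F \<subseteq> ?Z" using infinite_arbitrarily_large by blast
    then show False using le[of F] by simp
  qed
  show "card ?Z \<le> card Y" using le[OF fin] by simp
qed

section \<open>Random finite sets on the line and the cells they rarely meet\<close>

text \<open>Consecutive open intervals to the right of \<open>a\<close>, each starting where the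
  previous one ends and each met by the random set with probability greater than \<open>p\<close>.
  The recursion from the left fits the greedy construction of the cells.\<close>

primrec heavy_chain :: "'a measure \<Rightarrow> ('a \<Rightarrow> real set) \<Rightarrow> real \<Rightarrow> nat \<Rightarrow> real \<Rightarrow> bool" where
  "heavy_chain M B p 0 a = True"
| "heavy_chain M B p (Suc k) a \<longleftrightarrow>
     (\<exists>b>a. measure M {\<omega>\<in>space M. B \<omega> \<inter> {a<..<b} \<noteq> {}} > p \<and> heavy_chain M B p k b)"

text \<open>The intervals of a chain are disjoint, so the number of those that are met is a lower
  bound for the number of points, and its mean is at least \<open>k * p\<close>. This number is
  \<open>g\<close>; it stands in for the cardinality, which need not be measurable.\<close>

lemma heavy_chain_bound:
  assumes "prob_space M" and [measurable]: "\<And>a b. {\<omega>\<in>space M. B \<omega> \<inter> {a<..<b} \<noteq> {}} \<in> sets M"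
    and fin: "\<And>\<omega>. \<omega> \<in> space M \<Longrightarrow> finite (B \<omega>)"
  shows "heavy_chain M B p k a \<Longrightarrow> \<exists>g. g \<in> borel_measurable M \<and> real k * p \<le> (\<integral>\<omega>. g \<omega> \<partial>M) \<and>
    (\<forall>\<omega>\<in>space M. 0 \<le> g \<omega> \<and> g \<omega> \<le> real k) \<and> (\<forall>\<omega>\<in>space M. g \<omega> \<le> real (card (B \<omega> \<inter> {a<..})))"
proof (induction k arbitrary: a)
  case 0
  then show ?case by (intro exI[of _ "\<lambda>_. 0"]) auto
next
  case (Suc k)
  interpret prob_space M by fact
  obtain b where b: "a < b" "measure M {\<omega>\<in>space M. B \<omega> \<inter> {a<..<b} \<noteq> {}} > p" "heavy_chain M B p k b"
    using Suc.prems by auto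
  obtain g where g[measurable]: "g \<in> borel_measurable M" and g': "real k * p \<le> (\<integral>\<omega>. g \<omega> \<partial>M)"
    "\<forall>\<omega>\<in>space M. 0 \<le> g \<omega> \<and> g \<omega> \<le> real k" "\<forall>\<omega>\<in>space M. g \<omega> \<le> real (card (B \<omega> \<inter> {b<..}))"
    using Suc.IH[OF b(3)] by blast
  let ?A = "{\<omega>\<in>space M. B \<omega> \<inter> {a<..<b} \<noteq> {}}"
  have ig: "integrable M g"
    by (rule integrable_const_bound[of _ "real k"]) (use g' in auto)
  show ?case
  proof (intro exI[of _ "\<lambda>\<omega>. indicator ?A \<omega> + g \<omega>"] conjI ballI)
    show "real (Suc k) * p \<le> (\<integral>\<omega>. indicator ?A \<omega> + g \<omega> \<partial>M)"
      using b g' ig by (subst Bochner_Integration.integral_add) (auto simp: algebra_simps emeasure_eq_measure)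
    fix \<omega> assume \<omega>: "\<omega> \<in> space M"
    have f: "finite (B \<omega> \<inter> {a<..})" using fin[OF \<omega>] by simp
    show "indicator ?A \<omega> + g \<omega> \<le> real (card (B \<omega> \<inter> {a<..}))"
    proof (cases "\<omega> \<in> ?A")
      case True
      then obtain x where x: "x \<in> B \<omega>" "a < x" "x < b" by auto
      have "insert x (B \<omega> \<inter> {b<..}) \<subseteq> B \<omega> \<inter> {a<..}" using x b by auto
      from card_mono[OF f this] x have "Suc (card (B \<omega> \<inter> {b<..})) \<le> card (B \<omega> \<inter> {a<..})"
        using fin[OF \<omega>] by (subst (asm) card_insert_disjoint) auto
      then show ?thesis using True g' \<omega> by auto
    next
      case False
      have "card (B \<omega> \<inter> {b<..}) \<le> card (B \<omega> \<inter> {a<..})"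
        using b by (intro card_mono f) auto
      then show ?thesis using False g' \<omega> by fastforce
    qed
  qed (use g' in \<open>auto simp: indicator_def\<close>)
qed

text \<open>
  The cells are found greedily from the left: each maximal open interval that meets the random set
  with probability at most \<open>p\<close> uses up one more member of a longest heavy chain.
\<close>
lemma light_cells:
  fixes B :: "'a \<Rightarrow> real set"
  assumes "prob_space M" and meas: "\<And>a b. {\<omega>\<in>space M. B \<omega> \<inter> {a<..<b} \<noteq> {}} \<in> sets M"
    and p: "0 < p"
  shows "\<not> heavy_chain M B p (Suc k) a \<Longrightarrow> \<exists>\<U>. finite \<U> \<and> card \<U> \<le> 2 * k + 1 \<and> {} \<notin> \<U> \<and> \<Union>\<U> = {a<..} \<and>
     (\<forall>U\<in>\<U>. (\<exists>x. U = {x}) \<or> (is_interval U \<and> {\<omega>\<in>space M. B \<omega> \<inter> U \<noteq> {}} \<in> sets M \<and>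
        measure M {\<omega>\<in>space M. B \<omega> \<inter> U \<noteq> {}} \<le> p))"
proof -
  interpret prob_space M by fact
  let ?E = "\<lambda>U. {\<omega>\<in>space M. B \<omega> \<inter> U \<noteq> {}}"
  \<comment> \<open>Continuity from below. It transfers lightness to rays and to intervals with a
    limit endpoint, written as increasing unions.\<close>
  have Un: "?E (\<Union>i. S i) \<in> sets M \<and> measure M (?E (\<Union>i. S i)) \<le> p"
    if "incseq S" "\<And>i. ?E (S i) \<in> sets M" "\<And>i. measure M (?E (S i)) \<le> p" for S :: "nat \<Rightarrow> real set"
  proof -
    have eq: "?E (\<Union>i. S i) = (\<Union>i. ?E (S i))" by blast
    have "incseq (\<lambda>i. ?E (S i))" using that(1) unfolding incseq_def by blast
    then have "(\<lambda>i. measure M (?E (S i))) \<longlonglongrightarrow> measure M (\<Union>i. ?E (S i))"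
      using that(2) by (intro finite_Lim_measure_incseq) auto
    then have "measure M (\<Union>i. ?E (S i)) \<le> p"
      by (rule LIMSEQ_le_const2) (use that(3) in auto)
    moreover have "(\<Union>i. ?E (S i)) \<in> sets M" using that(2) by (intro sets.countable_UN) auto
    ultimately show ?thesis unfolding eq by blast
  qed
  have ray: "?E {a<..} \<in> sets M \<and> measure M (?E {a<..}) \<le> p"
    if "\<And>b. b > a \<Longrightarrow> measure M (?E {a<..<b}) \<le> p" for a
  proof -
    have "\<exists>i. x < a + real (Suc i)" for x
    proof -
      obtain i where "x - a < real i" using reals_Archimedean2 by blast
      then show ?thesis by (intro exI[of _ i]) auto
    qed
    then have eq: "{a<..} = (\<Union>i. {a<..<a + real (Suc i)})" by auto
    show ?thesis unfolding eq
      by (rule Un) (auto simp: incseq_def intro!: meas that)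
  qed
  have left: "measure M (?E {a<..<s}) \<le> p"
    if "\<And>b. a < b \<Longrightarrow> b < s \<Longrightarrow> measure M (?E {a<..<b}) \<le> p" "a < s" for a s
  proof -
    let ?b = "\<lambda>i. s - (s - a) / real (i + 2)"
    have bnd: "a < ?b i" "?b i < s" for i
    proof -
      have "(s - a) / real (i + 2) \<le> (s - a) / 2" using that(2) by (intro divide_left_mono) auto
      moreover have "0 < (s - a) / real (i + 2)" "(s - a) / 2 < s - a" using that(2) by auto
      ultimately show "a < ?b i" "?b i < s" by linarith+
    qed
    have "\<exists>i. x < ?b i" if "x < s" for x
    proof -
      obtain i where "(s - a) / (s - x) < real i" using reals_Archimedean2 by blast
      then have "(s - a) < real i * (s - x)" using \<open>x < s\<close> by (simp add: pos_divide_less_eq)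
      also have "\<dots> \<le> real (i + 2) * (s - x)" using \<open>x < s\<close> by (intro mult_right_mono) auto
      finally have "(s - a) / real (i + 2) < s - x" by (simp add: pos_divide_less_eq mult.commute)
      then show ?thesis by (intro exI[of _ i]) auto
    qed
    moreover have "x < s" if "x < ?b i" for x i
      using bnd(2)[of i] that by linarith
    ultimately have eq: "{a<..<s} = (\<Union>i. {a<..<?b i})"
      by (intro set_eqI iffI) (simp_all, blast+)
    have mono: "?b i \<le> ?b j" if "i \<le> j" for i j
      using that \<open>a < s\<close> by (auto intro!: divide_left_mono)
    have "incseq (\<lambda>i. {a<..<?b i})"
    proof (rule incseq_SucI)
      fix i show "{a<..<?b i} \<subseteq> {a<..<?b (Suc i)}" using mono[of i "Suc i"] by auto
    qed
    from Un[OF this meas that(1)[OF bnd]] show ?thesis unfolding eq by blast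
  qed
  \<comment> \<open>A heavy interval stays heavy if its left end moves slightly to the right. This
    makes room for one more heavy interval, from \<open>a\<close> to
    \<open>s + \<tau>\<close>.\<close>
  have right: "\<exists>\<tau>>0. s + \<tau> < x \<and> measure M (?E {s + \<tau><..<x}) > p"
    if gt: "measure M (?E {s<..<x}) > p" "s < x" for s x
  proof (rule ccontr)
    assume "\<not> ?thesis"
    then have le: "measure M (?E {s + \<tau><..<x}) \<le> p" if "0 < \<tau>" "s + \<tau> < x" for \<tau>
      using that by force
    let ?b = "\<lambda>i. s + (x - s) / real (i + 2)"
    have bnd: "0 < (x - s) / real (i + 2)" "?b i < x" for i
    proof -
      have "(x - s) / real (i + 2) \<le> (x - s) / 2" using gt(2) by (intro divide_left_mono) auto
      moreover have "(x - s) / 2 < x - s" using gt(2) by auto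
      ultimately show "?b i < x" by linarith
    qed (use gt(2) in auto)
    have "\<exists>i. ?b i < y" if "s < y" for y
    proof -
      obtain i where "(x - s) / (y - s) < real i" using reals_Archimedean2 by blast
      then have "(x - s) < real i * (y - s)" using \<open>s < y\<close> by (simp add: pos_divide_less_eq)
      also have "\<dots> \<le> real (i + 2) * (y - s)" using \<open>s < y\<close> by (intro mult_right_mono) auto
      finally have "(x - s) / real (i + 2) < y - s" by (simp add: pos_divide_less_eq mult.commute)
      then show ?thesis by (intro exI[of _ i]) auto
    qed
    moreover have "s < y" if "?b i < y" for y i
      using bnd(1)[of i] that by linarith
    ultimately have eq: "{s<..<x} = (\<Union>i. {?b i<..<x})"
      by (intro set_eqI iffI) (simp_all, blast+)
    have mono: "?b j \<le> ?b i" if "i \<le> j" for i j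
      using that gt(2) by (auto intro!: divide_left_mono)
    have "incseq (\<lambda>i. {?b i<..<x})"
    proof (rule incseq_SucI)
      fix i show "{?b i<..<x} \<subseteq> {?b (Suc i)<..<x}" using mono[of i "Suc i"] by auto
    qed
    from Un[OF this meas le[OF bnd]] show False using gt(1) unfolding eq by simp
  qed
  have ne: "{} \<noteq> {a<..}" for a :: real using gt_ex[of a] by blast
  show "\<not> heavy_chain M B p (Suc k) a \<Longrightarrow> \<exists>\<U>. finite \<U> \<and> card \<U> \<le> 2 * k + 1 \<and> {} \<notin> \<U> \<and> \<Union>\<U> = {a<..} \<and>
     (\<forall>U\<in>\<U>. (\<exists>x. U = {x}) \<or> (is_interval U \<and> {\<omega>\<in>space M. B \<omega> \<inter> U \<noteq> {}} \<in> sets M \<and>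
        measure M {\<omega>\<in>space M. B \<omega> \<inter> U \<noteq> {}} \<le> p))"
  proof (induction k arbitrary: a)
    case 0
    then have "measure M (?E {a<..<b}) \<le> p" if "b > a" for b using that by force
    from ray[OF this] show ?case
      by (intro exI[of _ "{{a<..}}"]) (auto simp: is_interval_1 ne)
  next
    case (Suc k)
    show ?case
    proof (cases "\<forall>b>a. measure M (?E {a<..<b}) \<le> p")
      case True
      then show ?thesis using ray[of a]
        by (intro exI[of _ "{{a<..}}"]) (auto simp: is_interval_1 ne)
    next
      case False
      \<comment> \<open>The point \<open>s\<close> is critical: the interval from \<open>a\<close>
        to \<open>s\<close> is light, and every longer one is heavy. As \<open>s\<close> itself may
        be hit with large probability, \<open>{s}\<close> becomes a cell of its own, which is why a
        chain member costs two cells.\<close>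
      define H where "H = {b. b > a \<and> measure M (?E {a<..<b}) > p}"
      define s where "s = Inf H"
      have H: "H \<noteq> {}" "bdd_below H" using False by (auto simp: H_def not_le intro!: bdd_belowI[of _ a])
      have as: "a \<le> s" unfolding s_def by (rule cInf_greatest[OF H(1)]) (auto simp: H_def)
      have big: "measure M (?E {a<..<b}) > p" if bs: "b > s" for b
      proof -
        obtain b' where b': "b' \<in> H" "b' < b" using cInf_lessD[OF H(1), of b] bs unfolding s_def by blast
        have "measure M (?E {a<..<b'}) \<le> measure M (?E {a<..<b})"
        proof (intro finite_measure_mono meas)
          have "{a<..<b'} \<subseteq> {a<..<b}" using b' by auto
          then show "?E {a<..<b'} \<subseteq> ?E {a<..<b}" by blast
        qed
        then show ?thesis using b' by (auto simp: H_def)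
      qed
      have step: "heavy_chain M B p (Suc j) s \<Longrightarrow> heavy_chain M B p (Suc (Suc j)) a" for j
      proof -
        assume "heavy_chain M B p (Suc j) s"
        then obtain x where x: "s < x" "measure M (?E {s<..<x}) > p" "heavy_chain M B p j x" by auto
        obtain \<tau> where \<tau>: "0 < \<tau>" "s + \<tau> < x" "measure M (?E {s + \<tau><..<x}) > p"
          using right[OF x(2,1)] by blast
        have "heavy_chain M B p (Suc j) (s + \<tau>)" using \<tau> x by auto
        moreover have "a < s + \<tau>" "measure M (?E {a<..<s + \<tau>}) > p" using as \<tau> big[of "s + \<tau>"] by auto
        ultimately show ?thesis unfolding heavy_chain.simps(2)[of M B p "Suc j" a] by blast
      qed
      have nos: "\<not> heavy_chain M B p (Suc k) s" using step Suc.prems by blast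
      \<comment> \<open>For \<open>s = a\<close>, \<open>step\<close> would prolong chains that
        start at \<open>a\<close> without end.\<close>
      have "s \<noteq> a"
      proof
        assume sa: "s = a"
        have "heavy_chain M B p (Suc j) a" for j
        proof (induction j)
          case 0
          show ?case using big[of "a + 1"] sa by (auto intro!: exI[of _ "a + 1"])
        next
          case (Suc j)
          then show ?case using step[of j] sa by simp
        qed
        then show False using Suc.prems by blast
      qed
      with as have as: "a < s" by simp
      have lo: "measure M (?E {a<..<s}) \<le> p"
      proof (rule left[OF _ as])
        fix b assume b: "a < b" "b < s"
        then have "b \<notin> H" using cInf_lower[OF _ H(2)] unfolding s_def by force
        then show "measure M (?E {a<..<b}) \<le> p" using b by (auto simp: H_def)
      qed
      obtain \<U> where \<U>: "finite \<U>" "card \<U> \<le> 2 * k + 1" "{} \<notin> \<U>" "\<Union>\<U> = {s<..}"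
        "\<forall>U\<in>\<U>. (\<exists>x. U = {x}) \<or> (is_interval U \<and> ?E U \<in> sets M \<and> measure M (?E U) \<le> p)"
        using Suc.IH[OF nos] by blast
      show ?thesis
      proof (intro exI[of _ "insert {a<..<s} (insert {s} \<U>)"] conjI)
        show "card (insert {a<..<s} (insert {s} \<U>)) \<le> 2 * Suc k + 1"
          using \<U>(2) card_insert_le_m1[of "2 * k + 3" "insert {s} \<U>" "{a<..<s}"]
            card_insert_le_m1[of "2 * k + 2" \<U> "{s}"] by simp
        show "\<Union> (insert {a<..<s} (insert {s} \<U>)) = {a<..}" using \<U>(4) as by auto
        show "{} \<notin> insert {a<..<s} (insert {s} \<U>)" using \<U>(3) as dense[of a s] by auto
        show "\<forall>U\<in>insert {a<..<s} (insert {s} \<U>). (\<exists>x. U = {x}) \<or>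
          (is_interval U \<and> ?E U \<in> sets M \<and> measure M (?E U) \<le> p)"
          using \<U>(5) lo meas by (auto simp: is_interval_1)
      qed (use \<U> in auto)
    qed
  qed
qed

text \<open>Comparing expectations, a chain of length \<open>k\<close> forces
  \<open>k * p \<le> N\<close>; hence the greedy cutting stops after at most \<open>N / p\<close>
  rounds of two cells and a final one. Off the event that \<open>B \<omega>\<close> meets an
  interval cell, no breakpoint separates two of its parameters, and on a singleton cell there is
  nothing to compare.\<close>

lemma piecewise_constant_cells:
  fixes B :: "'a \<Rightarrow> real set" and g :: "'a \<Rightarrow> real \<Rightarrow> 'c"
  assumes "prob_space M" and meas: "\<And>a b. {\<omega>\<in>space M. B \<omega> \<inter> {a<..<b} \<noteq> {}} \<in> sets M"
    and fin: "\<And>\<omega>. \<omega> \<in> space M \<Longrightarrow> finite (B \<omega>)"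
    and card: "\<And>\<omega>. \<omega> \<in> space M \<Longrightarrow> real (card (B \<omega>)) \<le> N"
    and const: "\<And>\<omega> b b'. \<omega> \<in> space M \<Longrightarrow> b < b' \<Longrightarrow> B \<omega> \<inter> {b..b'} = {} \<Longrightarrow> g \<omega> b = g \<omega> b'"
    and p: "0 < p"
  shows "\<exists>\<U>. finite \<U> \<and> real (card \<U>) \<le> 2 * N / p + 1 \<and> \<Union>\<U> = {a<..} \<and>
     (\<forall>U\<in>\<U>. \<exists>E\<in>sets M. measure M E \<le> p \<and> (\<forall>\<omega>\<in>space M - E. \<forall>b\<in>U. \<forall>b'\<in>U. g \<omega> b = g \<omega> b'))"
proof -
  interpret prob_space M by fact
  have bound: "real k * p \<le> N" if ch: "heavy_chain M B p k a" for k
  proof -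
    obtain h where h: "h \<in> borel_measurable M" "real k * p \<le> (\<integral>\<omega>. h \<omega> \<partial>M)"
      "\<forall>\<omega>\<in>space M. 0 \<le> h \<omega> \<and> h \<omega> \<le> real k" "\<forall>\<omega>\<in>space M. h \<omega> \<le> real (card (B \<omega> \<inter> {a<..}))"
      using heavy_chain_bound[OF assms(1) meas fin ch] by blast
    have "h \<omega> \<le> N" if \<omega>: "\<omega> \<in> space M" for \<omega>
    proof -
      have "card (B \<omega> \<inter> {a<..}) \<le> card (B \<omega>)" by (intro card_mono fin[OF \<omega>]) auto
      then show ?thesis using h(4) card[OF \<omega>] \<omega> by fastforce
    qed
    moreover have "integrable M h" by (rule integrable_const_bound[of _ "real k"]) (use h in auto)
    ultimately have "(\<integral>\<omega>. h \<omega> \<partial>M) \<le> (\<integral>\<omega>. N \<partial>M)"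
      by (intro integral_mono) auto
    then show ?thesis using h by (simp add: prob_space)
  qed
  obtain \<omega>0 where "\<omega>0 \<in> space M" using not_empty by blast
  then have N0: "0 \<le> N" using card[of \<omega>0] by linarith
  define k where "k = nat \<lfloor>N / p\<rfloor>"
  have "0 \<le> N / p" using N0 p by simp
  then have k: "real k \<le> N / p" "N / p < real (Suc k)" unfolding k_def by linarith+
  have "\<not> heavy_chain M B p (Suc k) a"
    using bound[of "Suc k"] k p by (auto simp: field_simps)
  from light_cells[OF assms(1) meas p this] obtain \<U> where \<U>: "finite \<U> \<and> card \<U> \<le> 2 * k + 1 \<and> {} \<notin> \<U> \<and> \<Union>\<U> = {a<..} \<and>
     (\<forall>U\<in>\<U>. (\<exists>x. U = {x}) \<or> (is_interval U \<and> {\<omega>\<in>space M. B \<omega> \<inter> U \<noteq> {}} \<in> sets M \<and>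
        measure M {\<omega>\<in>space M. B \<omega> \<inter> U \<noteq> {}} \<le> p))" ..
  have cells: "\<exists>E\<in>sets M. measure M E \<le> p \<and> (\<forall>\<omega>\<in>space M - E. \<forall>b\<in>U. \<forall>b'\<in>U. g \<omega> b = g \<omega> b')" if "U \<in> \<U>" for U
    using \<U>[THEN conjunct2, THEN conjunct2, THEN conjunct2, THEN conjunct2, rule_format, OF that]
  proof (elim disjE exE conjE)
    fix x assume "U = {x}"
    then show ?thesis using p by (intro bexI[of _ "{}"]) auto
  next
    assume U: "is_interval U" "{\<omega>\<in>space M. B \<omega> \<inter> U \<noteq> {}} \<in> sets M"
      "measure M {\<omega>\<in>space M. B \<omega> \<inter> U \<noteq> {}} \<le> p"
    show ?thesis
    proof (intro bexI[OF _ U(2)] conjI U(3) ballI)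
      fix \<omega> b b' assume \<omega>: "\<omega> \<in> space M - {\<omega>\<in>space M. B \<omega> \<inter> U \<noteq> {}}" and b: "b \<in> U" "b' \<in> U"
      have sub: "{x..y} \<subseteq> U" if "x \<in> U" "y \<in> U" for x y
        using U(1) that unfolding is_interval_1 by (meson atLeastAtMost_iff subsetI)
      have dis: "B \<omega> \<inter> U = {}" using \<omega> by simp
      have "B \<omega> \<inter> {b..b'} = {}" using dis sub[OF b] by blast
      moreover have "B \<omega> \<inter> {b'..b} = {}" using dis sub[OF b(2,1)] by blast
      moreover have "\<omega> \<in> space M" using \<omega> by simp
      ultimately show "g \<omega> b = g \<omega> b'" using const[of \<omega> b b'] const[of \<omega> b' b]
        by (metis linorder_less_linear)
    qed
  qed
  have "real (card \<U>) \<le> real (2 * k + 1)"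
    using \<U>[THEN conjunct2, THEN conjunct1] by (rule of_nat_mono)
  then have "real (card \<U>) \<le> 2 * N / p + 1" using k by simp
  then show ?thesis
    using \<U>[THEN conjunct1] \<U>[THEN conjunct2, THEN conjunct2, THEN conjunct2, THEN conjunct1]
    by (intro exI[of _ \<U>] conjI ballI cells)
qed

lemma card_range_piecewise_constant:
  fixes f :: "real \<Rightarrow> 'c"
  assumes fin: "finite R" and const: "\<And>b b'. b < b' \<Longrightarrow> R \<inter> {b..b'} = {} \<Longrightarrow> f b = f b'"
  shows "finite (range f)" "card (range f) \<le> 2 * card R + 1"
proof -
  \<comment> \<open>The position of \<open>b\<close> relative to \<open>R\<close>: even in a gap,
    odd at a point of \<open>R\<close>. It takes at most \<open>2 * card R + 1\<close> values and
    determines \<open>f b\<close>.\<close>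
  define code where "code b = card {r\<in>R. r < b} + card {r\<in>R. r \<le> b}" for b :: real
  have eq: "f b = f b'" if "code b = code b'" "b < b'" for b b'
  proof (rule const[OF that(2)])
    have s: "{r\<in>R. r < b} \<subseteq> {r\<in>R. r < b'}" "{r\<in>R. r \<le> b} \<subseteq> {r\<in>R. r \<le> b'}" using that by auto
    have f: "finite {r\<in>R. r < b'}" "finite {r\<in>R. r \<le> b'}" using fin by auto
    have "card {r\<in>R. r < b} \<le> card {r\<in>R. r < b'}" "card {r\<in>R. r \<le> b} \<le> card {r\<in>R. r \<le> b'}"
      using card_mono[OF f(1) s(1)] card_mono[OF f(2) s(2)] by auto
    then have "card {r\<in>R. r < b} = card {r\<in>R. r < b'}" "card {r\<in>R. r \<le> b} = card {r\<in>R. r \<le> b'}"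
      using that(1) by (auto simp: code_def)
    then have e: "{r\<in>R. r < b} = {r\<in>R. r < b'}" "{r\<in>R. r \<le> b} = {r\<in>R. r \<le> b'}"
      using card_subset_eq[OF f(1) s(1)] card_subset_eq[OF f(2) s(2)] by blast+
    show "R \<inter> {b..b'} = {}"
    proof (rule ccontr)
      assume "R \<inter> {b..b'} \<noteq> {}"
      then obtain x where x: "x \<in> R" "b \<le> x" "x \<le> b'" by auto
      then have "x \<in> {r\<in>R. r \<le> b'}" by simp
      then have "x = b" using x unfolding e(2)[symmetric] by simp
      then have "x \<in> {r\<in>R. r < b'}" using x that by simp
      then show False using \<open>x = b\<close> unfolding e(1)[symmetric] by simp
    qed
  qed
  have sub: "range f \<subseteq> (\<lambda>i. f (SOME b. code b = i)) ` {0..2 * card R}"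
  proof safe
    fix b
    have "code (SOME b'. code b' = code b) = code b" by (rule someI[of "\<lambda>b'. code b' = code b"]) simp
    then have "f b = f (SOME b'. code b' = code b)"
      using eq by (metis linorder_cases)
    moreover have "card {r\<in>R. r < b} \<le> card R" "card {r\<in>R. r \<le> b} \<le> card R"
      using fin by (auto intro: card_mono)
    then have "code b \<in> {0..2 * card R}" by (auto simp: code_def)
    ultimately show "f b \<in> (\<lambda>i. f (SOME b. code b = i)) ` {0..2 * card R}" by blast
  qed
  show "finite (range f)" using sub finite_surj by blast
  have "card (range f) \<le> card ((\<lambda>i. f (SOME b. code b = i)) ` {0..2 * card R})"
    by (intro card_mono sub) auto
  also have "\<dots> \<le> card {0..2 * card R}" by (rule card_image_le) simp
  finally show "card (range f) \<le> 2 * card R + 1" by simp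
qed

subsection \<open>Iterating a map that depends on a real parameter\<close>

text \<open>The orbit is run with the very parameter \<open>b\<close> under test, so a breakpoint of
  a state counts only where that state is really visited.\<close>

definition iter_breaks :: "(real \<Rightarrow> 's \<Rightarrow> 's) \<Rightarrow> ('s \<Rightarrow> real set) \<Rightarrow> nat \<Rightarrow> 's \<Rightarrow> real set" where
  "iter_breaks step R T C = {b. \<exists>t<T. b \<in> R ((step b ^^ t) C)}"

text \<open>For Lloyd's method the states are center sets and \<open>b\<close> is the exponent. The
  closed interval in \<open>step_const\<close> allows a breakpoint to carry a value of its own,
  different from those on both sides, as happens with ties.\<close>

locale param_iteration =
  fixes step :: "real \<Rightarrow> 's \<Rightarrow> 's" and R :: "'s \<Rightarrow> real set" and X :: "'s set" and r :: nat
  assumes closed: "C \<in> X \<Longrightarrow> step b C \<in> X"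
    and finite_R: "C \<in> X \<Longrightarrow> finite (R C)"
    and card_R: "C \<in> X \<Longrightarrow> card (R C) \<le> r"
    and step_const: "C \<in> X \<Longrightarrow> b < b' \<Longrightarrow> R C \<inter> {b..b'} = {} \<Longrightarrow> step b C = step b' C"
begin

lemma funpow_closed: "C \<in> X \<Longrightarrow> (step b ^^ t) C \<in> X"
  by (induction t) (auto intro: closed)

lemma step_const_interval:
  assumes "C \<in> X" "is_interval U" "R C \<inter> U = {}" "b \<in> U" "b' \<in> U"
  shows "step b C = step b' C"
proof -
  have "{x..y} \<subseteq> U" if "x \<in> U" "y \<in> U" for x y
    using assms(2) that unfolding is_interval_1 by (meson atLeastAtMost_iff subsetI)
  then have "R C \<inter> {b..b'} = {}" "R C \<inter> {b'..b} = {}" using assms by blast+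
  then show ?thesis using step_const[OF assms(1), of b b'] step_const[OF assms(1), of b' b]
    by (metis linorder_less_linear)
qed

text \<open>As long as no parameter in \<open>U\<close> meets a breakpoint, all orbits coincide with
  that of \<open>m\<close>, by induction on time. A condition on uncountably many parameters thus
  becomes one on the finitely many states of a single orbit, which is the form that measurability
  requires.\<close>

lemma iter_breaks_disjoint_iff:
  assumes C: "C \<in> X" and U: "is_interval U" and m: "m \<in> U"
  shows "iter_breaks step R T C \<inter> U = {} \<longleftrightarrow> (\<forall>t<T. R ((step m ^^ t) C) \<inter> U = {})"
    and "iter_breaks step R T C \<inter> U = {} \<Longrightarrow> b \<in> U \<Longrightarrow> t \<le> T \<Longrightarrow> (step b ^^ t) C = (step m ^^ t) C"
proof -
  have fwd: "\<forall>b\<in>U. (step b ^^ t) C = (step m ^^ t) C"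
    if "iter_breaks step R T C \<inter> U = {}" "t \<le> T" for t
    using that(2)
  proof (induction t)
    case (Suc t)
    let ?D = "(step m ^^ t) C"
    have "R ?D \<inter> U = {}"
    proof (rule ccontr)
      assume "R ?D \<inter> U \<noteq> {}"
      then obtain b where b: "b \<in> R ?D" "b \<in> U" by auto
      then have "b \<in> R ((step b ^^ t) C)" using Suc by simp
      then have "b \<in> iter_breaks step R T C" using Suc.prems by (auto simp: iter_breaks_def Suc_le_eq)
      then show False using that b by auto
    qed
    then have "step b ?D = step m ?D" if "b \<in> U" for b
      using step_const_interval[OF funpow_closed[OF C] U _ that m] by blast
    then show ?case using Suc by simp
  qed simp
  show "iter_breaks step R T C \<inter> U = {} \<Longrightarrow> b \<in> U \<Longrightarrow> t \<le> T \<Longrightarrow> (step b ^^ t) C = (step m ^^ t) C"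
    using fwd by blast
  show "iter_breaks step R T C \<inter> U = {} \<longleftrightarrow> (\<forall>t<T. R ((step m ^^ t) C) \<inter> U = {})"
  proof
    assume *: "iter_breaks step R T C \<inter> U = {}"
    show "\<forall>t<T. R ((step m ^^ t) C) \<inter> U = {}"
    proof (intro allI impI, rule ccontr)
      fix t assume t: "t < T" and "R ((step m ^^ t) C) \<inter> U \<noteq> {}"
      then obtain b where b: "b \<in> R ((step m ^^ t) C)" "b \<in> U" by auto
      then have "b \<in> R ((step b ^^ t) C)" using fwd[OF *, of t] t by simp
      then have "b \<in> iter_breaks step R T C" using t by (auto simp: iter_breaks_def)
      then show False using * b by auto
    qed
  next
    assume *: "\<forall>t<T. R ((step m ^^ t) C) \<inter> U = {}"
    have eq: "t \<le> T \<Longrightarrow> \<forall>b\<in>U. (step b ^^ t) C = (step m ^^ t) C" for t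
    proof (induction t)
      case (Suc t)
      then have "step b ((step m ^^ t) C) = step m ((step m ^^ t) C)" if "b \<in> U" for b
        using * step_const_interval[OF funpow_closed[OF C] U _ that m] by auto
      then show ?case using Suc by simp
    qed simp
    show "iter_breaks step R T C \<inter> U = {}"
    proof (rule ccontr)
      assume "iter_breaks step R T C \<inter> U \<noteq> {}"
      then obtain b t where "b \<in> U" "t < T" "b \<in> R ((step b ^^ t) C)" by (auto simp: iter_breaks_def)
      then show False using eq[of t] * by auto
    qed
  qed
qed

text \<open>The first step reaches at most \<open>2 * r + 1\<close> states, and from each the
  remaining steps are treated recursively. Counting one more than the breakpoints closes the
  recursion: \<open>r + q * (q ^ T - 1) + 1 \<le> q ^ Suc T\<close> for
  \<open>q = 2 * r + 1\<close>.\<close>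

lemma card_iter_breaks_length:
  "C \<in> X \<Longrightarrow> finite (iter_breaks step R T C) \<and> Suc (card (iter_breaks step R T C)) \<le> (2 * r + 1) ^ T"
proof (induction T arbitrary: C)
  case 0
  then show ?case by (simp add: iter_breaks_def)
next
  case (Suc T)
  let ?S = "range (\<lambda>b. step b C)"
  let ?q = "2 * r + 1"
  have fS: "finite ?S" and "card ?S \<le> 2 * card (R C) + 1"
    using card_range_piecewise_constant[of "R C" "\<lambda>b. step b C"] finite_R step_const Suc.prems
    by blast+
  then have cS: "card ?S \<le> ?q" using card_R[OF Suc.prems] by linarith
  have sub: "iter_breaks step R (Suc T) C \<subseteq> R C \<union> (\<Union>D\<in>?S. iter_breaks step R T D)"
  proof
    fix b assume "b \<in> iter_breaks step R (Suc T) C"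
    then obtain t where t: "t < Suc T" "b \<in> R ((step b ^^ t) C)" by (auto simp: iter_breaks_def)
    show "b \<in> R C \<union> (\<Union>D\<in>?S. iter_breaks step R T D)"
    proof (cases t)
      case 0
      then show ?thesis using t by simp
    next
      case (Suc t')
      then have "b \<in> iter_breaks step R T (step b C)"
        using t by (auto simp: iter_breaks_def funpow_Suc_right simp del: funpow.simps)
      then show ?thesis by blast
    qed
  qed
  have IH: "finite (iter_breaks step R T D)" "card (iter_breaks step R T D) \<le> ?q ^ T - 1" if "D \<in> ?S" for D
    using Suc.IH[of D] that closed[OF Suc.prems] by auto
  have fin: "finite (R C \<union> (\<Union>D\<in>?S. iter_breaks step R T D))"
    by (intro finite_UnI finite_UN_I fS IH(1) finite_R[OF Suc.prems])
  have "card (iter_breaks step R (Suc T) C) \<le> card (R C \<union> (\<Union>D\<in>?S. iter_breaks step R T D))"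
    by (rule card_mono[OF fin sub])
  also have "\<dots> \<le> card (R C) + card (\<Union>D\<in>?S. iter_breaks step R T D)" by (rule card_Un_le)
  also have "\<dots> \<le> r + ?q * (?q ^ T - 1)"
  proof (rule add_mono[OF card_R[OF Suc.prems]])
    have "card (\<Union>D\<in>?S. iter_breaks step R T D) \<le> (\<Sum>D\<in>?S. card (iter_breaks step R T D))"
      by (rule card_UN_le[OF fS])
    also have "\<dots> \<le> card ?S * (?q ^ T - 1)" using IH(2) sum_bounded_above[of ?S _ "?q ^ T - 1"] by simp
    also have "\<dots> \<le> ?q * (?q ^ T - 1)" by (intro mult_right_mono cS) simp
    finally show "card (\<Union>D\<in>?S. iter_breaks step R T D) \<le> ?q * (?q ^ T - 1)" .
  qed
  finally have "card (iter_breaks step R (Suc T) C) \<le> r + ?q * (?q ^ T - 1)" .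
  moreover have "?q * (?q ^ T - 1) + ?q = ?q ^ Suc T"
  proof -
    have gen: "q * (q ^ T - 1) + q = q ^ Suc T" if "1 \<le> q" for q :: nat
      using that by (simp add: diff_mult_distrib2)
    show ?thesis by (rule gen) simp
  qed
  ultimately have "Suc (card (iter_breaks step R (Suc T) C)) \<le> ?q ^ Suc T" by linarith
  then show ?case using finite_subset[OF sub fin] by simp
qed

text \<open>Every breakpoint of an orbit is a breakpoint of some state, whatever the number of
  steps. This is the side of \<open>min T k\<close> that does not see \<open>T\<close>.\<close>

lemma card_iter_breaks_states:
  assumes "C \<in> X" "finite X"
  shows "card (iter_breaks step R T C) \<le> card X * r"
proof -
  have "iter_breaks step R T C \<subseteq> (\<Union>D\<in>X. R D)"
    using funpow_closed[OF assms(1)] by (auto simp: iter_breaks_def)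
  then have "card (iter_breaks step R T C) \<le> card (\<Union>D\<in>X. R D)"
    using assms finite_R by (intro card_mono) auto
  also have "\<dots> \<le> (\<Sum>D\<in>X. card (R D))" by (rule card_UN_le[OF assms(2)])
  also have "\<dots> \<le> card X * r" using card_R sum_bounded_above[of X _ r] by simp
  finally show ?thesis .
qed

end

subsection \<open>Lloyd's method as a function of the exponent\<close>

definition cost_diff :: "clustering_inst \<Rightarrow> nat set \<Rightarrow> nat \<Rightarrow> nat \<Rightarrow> real \<Rightarrow> real" where
  "cost_diff I S x x' b = center_cost I (ereal b) S x - center_cost I (ereal b) S x'"

lemma cost_diff_eq: "cost_diff I S x x' b = (\<Sum>v\<in>S. dst I x v powr b) - (\<Sum>v\<in>S. dst I x' v powr b)"
  by (simp add: cost_diff_def center_cost_def)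

lemma continuous_on_cost_diff: "continuous_on A (cost_diff I S x x')"
proof -
  have "continuous_on A (\<lambda>b. d powr b)" for d :: real and A
    by (cases "d = 0") (auto simp: powr_def intro!: continuous_intros)
  then show ?thesis unfolding cost_diff_eq[abs_def] by (intro continuous_on_diff continuous_on_sum)
qed

text \<open>Zero distances contribute nothing, as \<open>0 powr b = 0\<close> for every
  \<open>b\<close>; the others are \<open>exp (ln d * b)\<close>, grouped by equal
  logarithms.\<close>

lemma sum_powr_as_exp_sum:
  fixes d :: "nat \<Rightarrow> real"
  assumes "finite S" "finite Y" "\<And>v. v \<in> S \<Longrightarrow> 0 \<le> d v" "\<And>v. v \<in> S \<Longrightarrow> d v \<noteq> 0 \<Longrightarrow> ln (d v) \<in> Y"
  shows "(\<Sum>v\<in>S. d v powr b) = (\<Sum>y\<in>Y. real (card {v\<in>S. d v \<noteq> 0 \<and> ln (d v) = y}) * exp (y * b))"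
proof -
  let ?S = "{v\<in>S. d v \<noteq> 0}"
  have "(\<Sum>v\<in>S. d v powr b) = (\<Sum>v\<in>?S. exp (ln (d v) * b))"
    using assms(1) by (intro sum.mono_neutral_cong_right) (auto simp: powr_def mult.commute)
  also have "\<dots> = (\<Sum>y\<in>Y. \<Sum>v\<in>{v\<in>?S. ln (d v) = y}. exp (ln (d v) * b))"
    using assms by (intro sum.group[symmetric]) auto
  also have "\<dots> = (\<Sum>y\<in>Y. real (card {v\<in>S. d v \<noteq> 0 \<and> ln (d v) = y}) * exp (y * b))"
    by (intro sum.cong) (auto simp: conj_assoc)
  finally show ?thesis .
qed

lemma cost_diff_zeros:
  assumes S: "finite S" and nn: "\<And>p q. 0 \<le> dst I p q" and nz: "cost_diff I S x x' b0 \<noteq> 0"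
  shows "finite {b. cost_diff I S x x' b = 0}" "card {b. cost_diff I S x x' b = 0} \<le> 2 * card S"
proof -
  define Y where "Y = (\<lambda>v. ln (dst I x v)) ` S \<union> (\<lambda>v. ln (dst I x' v)) ` S"
  have Y: "finite Y" "card Y \<le> 2 * card S"
  proof -
    show "finite Y" using S by (simp add: Y_def)
    have "card Y \<le> card ((\<lambda>v. ln (dst I x v)) ` S) + card ((\<lambda>v. ln (dst I x' v)) ` S)"
      unfolding Y_def by (rule card_Un_le)
    also have "\<dots> \<le> card S + card S" by (intro add_mono card_image_le S)
    finally show "card Y \<le> 2 * card S" by simp
  qed
  define c where "c y = real (card {v\<in>S. dst I x v \<noteq> 0 \<and> ln (dst I x v) = y})
    - real (card {v\<in>S. dst I x' v \<noteq> 0 \<and> ln (dst I x' v) = y})" for y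
  have eq: "cost_diff I S x x' b = (\<Sum>y\<in>Y. c y * exp (y * b))" for b
  proof -
    have "(\<Sum>v\<in>S. dst I x v powr b) = (\<Sum>y\<in>Y. real (card {v\<in>S. dst I x v \<noteq> 0 \<and> ln (dst I x v) = y}) * exp (y * b))"
      by (rule sum_powr_as_exp_sum[OF S Y(1) nn]) (auto simp: Y_def)
    moreover have "(\<Sum>v\<in>S. dst I x' v powr b) = (\<Sum>y\<in>Y. real (card {v\<in>S. dst I x' v \<noteq> 0 \<and> ln (dst I x' v) = y}) * exp (y * b))"
      by (rule sum_powr_as_exp_sum[OF S Y(1) nn]) (auto simp: Y_def)
    ultimately show ?thesis
      by (simp add: cost_diff_eq c_def left_diff_distrib sum_subtractf)
  qed
  show "finite {b. cost_diff I S x x' b = 0}" "card {b. cost_diff I S x x' b = 0} \<le> 2 * card S"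
    using exp_sum_zeros[OF Y(1), of c b0] nz Y(2) unfolding eq by auto
qed

text \<open>Pairs with the same cost for all exponents are left out: they would contribute the whole
  line, and their order never changes.\<close>

definition breaks :: "clustering_inst \<Rightarrow> nat set \<Rightarrow> real set" where
  "breaks I S = (\<Union>x<npts I. \<Union>x'<npts I.
     {b. cost_diff I S x x' b = 0 \<and> (\<exists>b0. cost_diff I S x x' b0 \<noteq> 0)})"

lemma breaks_finite_card:
  assumes S: "S \<subseteq> {..<npts I}" and nn: "\<And>p q. 0 \<le> dst I p q"
  shows "finite (breaks I S)" "card (breaks I S) \<le> 2 * npts I ^ 3"
proof -
  let ?n = "npts I"
  let ?Z = "\<lambda>x x'. {b. cost_diff I S x x' b = 0 \<and> (\<exists>b0. cost_diff I S x x' b0 \<noteq> 0)}"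
  have fS: "finite S" by (rule finite_subset[OF S]) simp
  have cS: "card S \<le> ?n" using card_mono[OF _ S] by simp
  have Z: "finite (?Z x x') \<and> card (?Z x x') \<le> 2 * ?n" for x x'
  proof (cases "\<exists>b0. cost_diff I S x x' b0 \<noteq> 0")
    case True
    then obtain b0 where "cost_diff I S x x' b0 \<noteq> 0" by blast
    moreover have "?Z x x' = {b. cost_diff I S x x' b = 0}" using True by blast
    ultimately show ?thesis using cost_diff_zeros[OF fS nn, of x x' b0] cS by simp
  next
    case False
    then have Z0: "?Z x x' = {}" by blast
    show ?thesis unfolding Z0 by simp
  qed
  show "finite (breaks I S)" unfolding breaks_def using Z by auto
  have "card (breaks I S) \<le> (\<Sum>x<?n. card (\<Union>x'<?n. ?Z x x'))"
    unfolding breaks_def by (rule card_UN_le) simp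
  also have "\<dots> \<le> (\<Sum>x<?n. \<Sum>x'<?n. card (?Z x x'))"
    by (intro sum_mono card_UN_le) simp
  also have "\<dots> \<le> (\<Sum>x<?n. \<Sum>x'<?n. 2 * ?n)" using Z by (intro sum_mono) auto
  also have "\<dots> = 2 * ?n ^ 3" by (simp add: power3_eq_cube)
  finally show "card (breaks I S) \<le> 2 * ?n ^ 3" .
qed

text \<open>By the intermediate value theorem a strict comparison of two costs changes only across a
  zero of their difference. Strict comparisons determine the set of minimizers, hence also its least
  element, so ties are covered too.\<close>

lemma best_center_const:
  assumes "b < b'" "breaks I S \<inter> {b..b'} = {}"
  shows "best_center I (ereal b) S = best_center I (ereal b') S"
proof -
  have lt: "center_cost I (ereal b') S x < center_cost I (ereal b') S x'"
    if x: "x < npts I" "x' < npts I" and less: "center_cost I (ereal b) S x < center_cost I (ereal b) S x'"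
      and bb: "{min b b'..max b b'} \<inter> breaks I S = {}" for x x' b b'
  proof (rule ccontr)
    assume "\<not> ?thesis"
    then have ge: "cost_diff I S x x' b' \<ge> 0" and neg: "cost_diff I S x x' b < 0"
      using less by (auto simp: cost_diff_def)
    have "\<exists>z. min b b' \<le> z \<and> z \<le> max b b' \<and> cost_diff I S x x' z = 0"
    proof (cases "b \<le> b'")
      case True
      then show ?thesis
        using IVT'[of "cost_diff I S x x'" b 0 b'] continuous_on_cost_diff ge neg by auto
    next
      case False
      then show ?thesis
        using IVT2'[of "cost_diff I S x x'" b 0 b'] continuous_on_cost_diff ge neg by auto
    qed
    then obtain z where z: "z \<in> {min b b'..max b b'}" "cost_diff I S x x' z = 0" by auto
    have "\<exists>b0. cost_diff I S x x' b0 \<noteq> 0" using neg by (intro exI[of _ b]) simp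
    then have "z \<in> breaks I S" using z x unfolding breaks_def by blast
    then show False using bb z by auto
  qed
  have "center_cost I (ereal b) S x < center_cost I (ereal b) S x' \<longleftrightarrow>
      center_cost I (ereal b') S x < center_cost I (ereal b') S x'"
    if "x < npts I" "x' < npts I" for x x'
    using lt[OF that, of b b'] lt[OF that, of b' b] assms by (auto simp: min_def max_def)
  then have "is_arg_min (center_cost I (ereal b) S) (\<lambda>x. x < npts I) x \<longleftrightarrow>
      is_arg_min (center_cost I (ereal b') S) (\<lambda>x. x < npts I) x" for x
    unfolding is_arg_min_def by blast
  then show ?thesis unfolding best_center_def by presburger
qed

section \<open>Center sets as the states of Lloyd's method\<close>

definition step_breaks :: "clustering_inst \<Rightarrow> nat set \<Rightarrow> real set" where
  "step_breaks I C = (\<Union>S\<in>voronoi I C. breaks I S)"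

text \<open>At most \<open>k\<close> rather than exactly \<open>k\<close> centers: seeds may
  coincide, and two cells may share their best center.\<close>

definition center_sets :: "clustering_inst \<Rightarrow> nat \<Rightarrow> nat set set" where
  "center_sets I k = {C. C \<noteq> {} \<and> C \<subseteq> {..<npts I} \<and> card C \<le> k}"

lemma Least_arg_min:
  fixes f :: "nat \<Rightarrow> real"
  assumes "finite {x. P x}" "\<exists>x. P x"
  shows "P (LEAST x. is_arg_min f P x)" "is_arg_min f P (LEAST x. is_arg_min f P x)"
proof -
  have "\<exists>x. is_arg_min f P x"
    using ex_is_arg_min_if_finite[of "{x. P x}" f] assms by (auto simp: is_arg_min_def)
  then show 1: "is_arg_min f P (LEAST x. is_arg_min f P x)" by (rule LeastI_ex)
  then show "P (LEAST x. is_arg_min f P x)" by (simp add: is_arg_min_def)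
qed

lemma center_sets_finite: "C \<in> center_sets I k \<Longrightarrow> finite C"
  by (auto simp: center_sets_def intro: finite_subset)

lemma nearest_in: "C \<in> center_sets I k \<Longrightarrow> nearest I C v \<in> C"
  using Least_arg_min(1)[of "\<lambda>c. c \<in> C" "dst I v"] center_sets_finite[of C I k]
  unfolding nearest_def by (auto simp: center_sets_def)

lemma best_center_less: "0 < npts I \<Longrightarrow> best_center I b S < npts I"
  using Least_arg_min(1)[of "\<lambda>x. x < npts I" "center_cost I b S"] unfolding best_center_def by auto

lemma card_voronoi: "C \<in> center_sets I k \<Longrightarrow> card (voronoi I C) \<le> card C"
  unfolding voronoi_def by (intro card_image_le center_sets_finite)

lemma lloyd_step_center_sets:
  assumes C: "C \<in> center_sets I k" and n: "0 < npts I"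
  shows "lloyd_step I b C \<in> center_sets I k"
proof -
  have "finite (voronoi I C)" using center_sets_finite[OF C] by (simp add: voronoi_def)
  then have "card (lloyd_step I b C) \<le> card (voronoi I C)"
    unfolding lloyd_step_def by (rule card_image_le)
  also have "\<dots> \<le> k" using card_voronoi[OF C] C by (simp add: center_sets_def)
  finally show ?thesis using C best_center_less[OF n]
    by (auto simp: center_sets_def lloyd_step_def voronoi_def)
qed

text \<open>A center is at distance zero from itself and from no other center, so it lies in its own
  cell and no cell is empty. This is what brings the values of \<open>cl_cost\<close> into
  \<open>{0..H}\<close>.\<close>

lemma partition_on_voronoi:
  assumes C: "C \<in> center_sets I k" and I: "Metric_space {..<npts I} (dst I)"
  shows "partition_on {..<npts I} (voronoi I C)"
proof -
  interpret Metric_space "{..<npts I}" "dst I" by fact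
  have own: "nearest I C c = c" if c: "c \<in> C" for c
  proof (rule ccontr)
    let ?d = "nearest I C c"
    have fin: "finite {c. c \<in> C}" using center_sets_finite[OF C] by simp
    assume ne: "?d \<noteq> c"
    have d: "?d \<in> C" by (rule nearest_in[OF C])
    have "is_arg_min (dst I c) (\<lambda>c. c \<in> C) ?d"
      using Least_arg_min(2)[of "\<lambda>c. c \<in> C" "dst I c"] fin c unfolding nearest_def by auto
    then have "\<not> dst I c c < dst I c ?d" using c by (auto simp: is_arg_min_def)
    moreover have cd: "c < npts I" "?d < npts I" using C c d by (auto simp: center_sets_def)
    then have "dst I c c = 0" "dst I c ?d \<noteq> 0" using ne by auto
    ultimately show False using nonneg[of c ?d] by simp
  qed
  show ?thesis
  proof (rule partition_onI)
    show "\<Union> (voronoi I C) = {..<npts I}"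
      using nearest_in[OF C] by (auto simp: voronoi_def)
    show "disjnt p q" if "p \<in> voronoi I C" "q \<in> voronoi I C" "p \<noteq> q" for p q
      using that by (auto simp: voronoi_def disjnt_def)
    show "{} \<notin> voronoi I C"
    proof
      assume "{} \<in> voronoi I C"
      then obtain c where c: "c \<in> C" "{v \<in> {..<npts I}. nearest I C v = c} = {}" by (auto simp: voronoi_def)
      moreover have "c < npts I" using c C by (auto simp: center_sets_def)
      ultimately show False using own[OF c(1)] by auto
    qed
  qed
qed

text \<open>A nonempty set of at most \<open>k\<close> points is the image of a function on
  \<open>{..<k}\<close>, padded by repeating one of its elements.\<close>

lemma card_center_sets:
  assumes "1 \<le> k"
  shows "finite (center_sets I k)" "card (center_sets I k) \<le> npts I ^ k"
proof -
  let ?F = "{..<k} \<rightarrow>\<^sub>E {..<npts I}"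
  have sub: "center_sets I k \<subseteq> (\<lambda>f. f ` {..<k}) ` ?F"
  proof
    fix C assume C: "C \<in> center_sets I k"
    then obtain c where c: "c \<in> C" by (auto simp: center_sets_def)
    obtain g where g: "bij_betw g {..<card C} C"
      using ex_bij_betw_nat_finite[OF center_sets_finite[OF C]] by (auto simp: atLeast0LessThan)
    define f where "f i = (if i < card C then g i else if i < k then c else undefined)" for i
    have k: "card C \<le> k" using C by (simp add: center_sets_def)
    have gC: "g ` {..<card C} = C" using g by (simp add: bij_betw_def)
    have "f ` {..<k} = C"
    proof
      show "f ` {..<k} \<subseteq> C" using gC c by (auto simp: f_def)
      show "C \<subseteq> f ` {..<k}"
      proof
        fix x assume "x \<in> C"
        then obtain i where "i < card C" "x = g i" using gC by blast
        then show "x \<in> f ` {..<k}" using k by (auto simp: f_def intro!: image_eqI[of _ _ i])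
      qed
    qed
    moreover have "f \<in> ?F"
    proof
      fix i assume "i \<in> {..<k}"
      then have "f i \<in> C" using \<open>f ` {..<k} = C\<close> by blast
      then show "f i \<in> {..<npts I}" using C by (auto simp: center_sets_def)
    next
      fix i assume "i \<notin> {..<k}"
      then show "f i = undefined" using k by (simp add: f_def)
    qed
    ultimately show "C \<in> (\<lambda>f. f ` {..<k}) ` ?F" by blast
  qed
  have F: "finite ?F" by (intro finite_PiE) auto
  show "finite (center_sets I k)" using finite_surj[OF F sub] .
  have "card (center_sets I k) \<le> card ((\<lambda>f. f ` {..<k}) ` ?F)" using F by (intro card_mono sub) auto
  also have "\<dots> \<le> card ?F" by (rule card_image_le[OF F])
  also have "\<dots> = npts I ^ k" by (simp add: card_PiE)
  finally show "card (center_sets I k) \<le> npts I ^ k" .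
qed

text \<open>A fixed point stays fixed under further steps, so early stopping is invisible in the
  result.\<close>

lemma lloyd_eq_funpow: "lloyd I \<beta> T C = (lloyd_step I \<beta> ^^ T) C"
proof (induction T arbitrary: C)
  case (Suc T)
  have "(lloyd_step I \<beta> ^^ t) C = C" if "lloyd_step I \<beta> C = C" for t
    using that by (induction t) auto
  then show ?case using Suc by (auto simp: Let_def funpow_Suc_right simp del: funpow.simps)
qed simp

text \<open>At most \<open>npts I\<close> Voronoi cells with at most \<open>2 * npts I ^ 3\<close>
  breakpoints each: pairs of candidate centers times twice the cell size for the zeros of an
  exponential sum.\<close>

lemma lloyd_param_iteration:
  assumes n: "0 < npts I" and I: "Metric_space {..<npts I} (dst I)"
  shows "param_iteration (\<lambda>b. lloyd_step I (ereal b)) (step_breaks I) (center_sets I k) (2 * npts I ^ 4)"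
proof
  interpret Metric_space "{..<npts I}" "dst I" by fact
  fix C assume C: "C \<in> center_sets I k"
  show "lloyd_step I (ereal b) C \<in> center_sets I k" for b by (rule lloyd_step_center_sets[OF C n])
  have fV: "finite (voronoi I C)" using center_sets_finite[OF C] by (simp add: voronoi_def)
  have V: "S \<subseteq> {..<npts I}" if "S \<in> voronoi I C" for S using that by (auto simp: voronoi_def)
  show "finite (step_breaks I C)"
    unfolding step_breaks_def using fV breaks_finite_card(1)[OF V nonneg] by auto
  have "card (step_breaks I C) \<le> (\<Sum>S\<in>voronoi I C. card (breaks I S))"
    unfolding step_breaks_def by (rule card_UN_le[OF fV])
  also have "\<dots> \<le> card (voronoi I C) * (2 * npts I ^ 3)"
    using sum_bounded_above[of "voronoi I C" "\<lambda>S. card (breaks I S)" "2 * npts I ^ 3"]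
      breaks_finite_card(2)[OF V nonneg] by simp
  also have "\<dots> \<le> npts I * (2 * npts I ^ 3)"
  proof (rule mult_right_mono)
    have "card C \<le> card {..<npts I}" using C by (intro card_mono) (auto simp: center_sets_def)
    then show "card (voronoi I C) \<le> npts I" using card_voronoi[OF C] by simp
  qed simp
  also have "\<dots> = 2 * npts I ^ 4" by (simp add: eval_nat_numeral algebra_simps)
  finally show "card (step_breaks I C) \<le> 2 * npts I ^ 4" .
  show "lloyd_step I (ereal b) C = lloyd_step I (ereal b') C"
    if "b < b'" "step_breaks I C \<inter> {b..b'} = {}" for b b'
    unfolding lloyd_step_def using that
    by (intro image_cong best_center_const) (auto simp: step_breaks_def)
qed

definition lloyd_breaks :: "clustering_inst \<Rightarrow> nat \<Rightarrow> nat set \<Rightarrow> real set" where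
  "lloyd_breaks I = iter_breaks (\<lambda>b. lloyd_step I (ereal b)) (step_breaks I)"

text \<open>For \<open>n \<ge> 2\<close> powers of \<open>n\<close> absorb the constants: the
  branching factor \<open>4 * npts I ^ 4 + 1\<close> is at most \<open>n ^ 7\<close>, and
  \<open>2 * npts I ^ 4\<close> is at most \<open>n ^ 6\<close>, so that the count over center sets
  is at most \<open>n ^ k * n ^ 6\<close>.\<close>

lemma card_lloyd_breaks:
  assumes n: "0 < npts I" "npts I \<le> n" "2 \<le> n" and I: "Metric_space {..<npts I} (dst I)"
    and C: "C \<in> center_sets I k" and k: "1 \<le> k"
  shows "finite (lloyd_breaks I T C)" "card (lloyd_breaks I T C) \<le> n ^ (7 * min T k)"
proof -
  interpret param_iteration "\<lambda>b. lloyd_step I (ereal b)" "step_breaks I" "center_sets I k" "2 * npts I ^ 4"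
    by (rule lloyd_param_iteration[OF n(1) I])
  show "finite (lloyd_breaks I T C)" using card_iter_breaks_length[OF C] by (simp add: lloyd_breaks_def)
  have n4: "npts I ^ 4 \<le> n ^ 4" using n by (intro power_mono) auto
  have "2 ^ 3 \<le> n ^ 3" using n by (intro power_mono) auto
  then have "8 * n ^ 4 \<le> n ^ 3 * n ^ 4" by (intro mult_right_mono) auto
  then have n7: "8 * n ^ 4 \<le> n ^ 7" by (simp flip: power_add)
  have "1 \<le> n ^ 4" using n by simp
  then have q: "2 * (2 * npts I ^ 4) + 1 \<le> n ^ 7" and r: "2 * npts I ^ 4 \<le> n ^ 6"
  proof -
    show "2 * (2 * npts I ^ 4) + 1 \<le> n ^ 7" using n4 n7 \<open>1 \<le> n ^ 4\<close> by linarith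
    have "2 ^ 2 \<le> n ^ 2" using n by (intro power_mono) auto
    then have "4 * n ^ 4 \<le> n ^ 2 * n ^ 4" by (intro mult_right_mono) auto
    then have "4 * n ^ 4 \<le> n ^ 6" by (simp flip: power_add)
    then show "2 * npts I ^ 4 \<le> n ^ 6" using n4 by linarith
  qed
  have "card (lloyd_breaks I T C) \<le> (2 * (2 * npts I ^ 4) + 1) ^ T"
    using card_iter_breaks_length[OF C, of T] by (simp add: lloyd_breaks_def)
  also have "\<dots> \<le> (n ^ 7) ^ T" by (intro power_mono q) simp
  finally have cT: "card (lloyd_breaks I T C) \<le> n ^ (7 * T)" by (simp add: power_mult)
  have "card (lloyd_breaks I T C) \<le> card (center_sets I k) * (2 * npts I ^ 4)"
    using card_iter_breaks_states[OF C card_center_sets(1)[OF k]] by (simp add: lloyd_breaks_def)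
  also have "\<dots> \<le> npts I ^ k * n ^ 6" by (intro mult_mono card_center_sets(2)[OF k] r) auto
  also have "\<dots> \<le> n ^ k * n ^ (6 * k)"
    using n k by (intro mult_mono power_mono power_increasing) auto
  also have "\<dots> = n ^ (7 * k)" by (simp flip: power_add)
  finally have ck: "card (lloyd_breaks I T C) \<le> n ^ (7 * k)" .
  show "card (lloyd_breaks I T C) \<le> n ^ (7 * min T k)"
    using cT ck by (simp add: min_def)
qed

subsection \<open>Measurability\<close>

text \<open>On a compact subinterval a continuous function without zeros is bounded away from 0, and
  by continuity this can be tested at rational points. The right-hand side is a countable
  combination of conditions on single values and so defines a measurable event.\<close>

lemma Rats_dense_nonzero_iff:
  fixes f :: "real \<Rightarrow> real"
  assumes f: "continuous_on UNIV f"
  shows "(\<forall>x\<in>{a<..<b}. f x \<noteq> 0) \<longleftrightarrow>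
    (\<forall>p q :: rat. a < of_rat p \<longrightarrow> of_rat q < b \<longrightarrow> (\<exists>N::nat. \<forall>s::rat.
       of_rat p \<le> (of_rat s :: real) \<longrightarrow> of_rat s \<le> (of_rat q :: real) \<longrightarrow> 1 / real (Suc N) \<le> \<bar>f (of_rat s)\<bar>))"
    (is "?L \<longleftrightarrow> ?R")
proof
  assume L: ?L
  show ?R
  proof (intro allI impI)
    fix p q :: rat assume pq: "a < of_rat p" "of_rat q < b"
    let ?K = "{of_rat p..of_rat q :: real}"
    show "\<exists>N::nat. \<forall>s::rat. of_rat p \<le> (of_rat s :: real) \<longrightarrow> of_rat s \<le> (of_rat q :: real) \<longrightarrow>
       1 / real (Suc N) \<le> \<bar>f (of_rat s)\<bar>"
    proof (cases "?K = {}")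
      case True
      then show ?thesis by auto
    next
      case False
      have "continuous_on ?K (\<lambda>x. \<bar>f x\<bar>)"
        using continuous_on_subset[OF f subset_UNIV] by (intro continuous_intros)
      then obtain z where z: "z \<in> ?K" "\<And>x. x \<in> ?K \<Longrightarrow> \<bar>f z\<bar> \<le> \<bar>f x\<bar>"
        using continuous_attains_inf[OF compact_Icc False] by blast
      have "f z \<noteq> 0" using L z pq by auto
      then obtain N :: nat where "inverse (real (Suc N)) < \<bar>f z\<bar>"
        using reals_Archimedean[of "\<bar>f z\<bar>"] by auto
      then have "1 / real (Suc N) \<le> \<bar>f x\<bar>" if "x \<in> ?K" for x
        using z(2)[OF that] by (simp add: inverse_eq_divide)
      then show ?thesis by (intro exI[of _ N]) auto
    qed
  qed
next
  assume R: ?R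
  show ?L
  proof (intro ballI notI)
    fix x assume x: "x \<in> {a<..<b}" and 0: "f x = 0"
    obtain p where p: "a < of_rat p" "of_rat p < x" using x of_rat_dense[of a x] by auto
    obtain q where q: "x < of_rat q" "of_rat q < b" using x of_rat_dense[of x b] by auto
    obtain N where N: "\<And>s::rat. of_rat p \<le> (of_rat s :: real) \<Longrightarrow> of_rat s \<le> (of_rat q :: real) \<Longrightarrow>
       1 / real (Suc N) \<le> \<bar>f (of_rat s)\<bar>" using R p(1) q(2) by blast
    obtain d where d: "0 < d" "\<And>y. dist y x < d \<Longrightarrow> dist (f y) (f x) < 1 / real (Suc N)"
      using f[unfolded continuous_on_iff, rule_format, of x "1 / real (Suc N)"] by auto
    obtain s where s: "max (of_rat p) (x - d) < of_rat s" "of_rat s < x"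
      using of_rat_dense[of "max (of_rat p) (x - d)" x] p d by auto
    have "\<bar>f (of_rat s)\<bar> < 1 / real (Suc N)" using d(2)[of "of_rat s"] s by (simp add: 0 dist_real_def)
    moreover have "1 / real (Suc N) \<le> \<bar>f (of_rat s)\<bar>" using s q by (intro N) auto
    ultimately show False by simp
  qed
qed

lemma Rats_dense_zero_iff:
  fixes f :: "real \<Rightarrow> real"
  assumes f: "continuous_on UNIV f"
  shows "(\<forall>x. f x = 0) \<longleftrightarrow> (\<forall>q::rat. f (of_rat q) = 0)"
proof
  assume "\<forall>q::rat. f (of_rat q) = 0"
  then have rat: "f y = 0" if "y \<in> \<rat>" for y using that by (auto elim: Rats_cases)
  have "f x = 0" for x
    by (rule continuous_constant_on_closure[of \<rat> f 0 x]) (use f rat in \<open>simp_all add: Rats_closure_real\<close>)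
  then show "\<forall>x. f x = 0" ..
qed simp

lemma breaks_disjoint_iff:
  "breaks I S \<inter> {a<..<b} = {} \<longleftrightarrow> (\<forall>x x'. x < npts I \<longrightarrow> x' < npts I \<longrightarrow>
     (\<forall>q::rat. cost_diff I S x x' (of_rat q) = 0) \<or>
     (\<forall>p q :: rat. a < of_rat p \<longrightarrow> of_rat q < b \<longrightarrow> (\<exists>N::nat. \<forall>s::rat.
       of_rat p \<le> (of_rat s :: real) \<longrightarrow> of_rat s \<le> (of_rat q :: real) \<longrightarrow>
       1 / real (Suc N) \<le> \<bar>cost_diff I S x x' (of_rat s)\<bar>)))"
proof -
  have "breaks I S \<inter> {a<..<b} = {} \<longleftrightarrow> (\<forall>x x'. x < npts I \<longrightarrow> x' < npts I \<longrightarrow>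
     (\<forall>b0. cost_diff I S x x' b0 = 0) \<or> (\<forall>z\<in>{a<..<b}. cost_diff I S x x' z \<noteq> 0))"
    unfolding breaks_def by blast
  then show ?thesis
    unfolding Rats_dense_nonzero_iff[OF continuous_on_cost_diff] Rats_dense_zero_iff[OF continuous_on_cost_diff] .
qed

text \<open>The type \<open>nat set set\<close> is uncountable, so a random partition cannot be
  treated by running through all its values. Lists of labels are countable in number and determine
  the Voronoi partition.\<close>

definition cells_of_labels :: "nat set \<Rightarrow> nat list \<Rightarrow> nat set set" where
  "cells_of_labels C xs = (\<lambda>c. {v \<in> {..<length xs}. xs ! v = c}) ` C"

lemma voronoi_eq_cells: "voronoi I C = cells_of_labels C (map (nearest I C) [0..<npts I])"
  unfolding voronoi_def cells_of_labels_def by (intro image_cong refl) auto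

lemma measurable_map_list:
  fixes f :: "'b \<Rightarrow> 'w \<Rightarrow> 'c::countable"
  assumes "\<And>v. v \<in> set L \<Longrightarrow> f v \<in> M \<rightarrow>\<^sub>M count_space UNIV"
  shows "(\<lambda>\<omega>. map (\<lambda>v. f v \<omega>) L) \<in> M \<rightarrow>\<^sub>M count_space UNIV"
  using assms
proof (induction L)
  case (Cons v L)
  have "(\<lambda>\<omega>. x # map (\<lambda>v. f v \<omega>) L) \<in> M \<rightarrow>\<^sub>M count_space UNIV" for x
    using Cons by (intro measurable_compose[where f="\<lambda>\<omega>. map (\<lambda>v. f v \<omega>) L" and g="\<lambda>l. x # l" and N="count_space UNIV"]) auto
  then show ?case
    using measurable_compose_countable[where f="\<lambda>x \<omega>. x # map (\<lambda>v. f v \<omega>) L" and g="f v"] Cons.prems by simp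
qed simp

lemma measurable_insort_key:
  fixes f :: "nat \<Rightarrow> 'w \<Rightarrow> real"
  assumes [measurable]: "\<And>v. f v \<in> borel_measurable M"
  shows "(\<lambda>\<omega>. insort_key (\<lambda>v. f v \<omega>) x L) \<in> M \<rightarrow>\<^sub>M count_space UNIV"
proof (induction L)
  case (Cons y L)
  have "(\<lambda>\<omega>. y # insort_key (\<lambda>v. f v \<omega>) x L) \<in> M \<rightarrow>\<^sub>M count_space UNIV"
    by (rule measurable_compose[OF Cons, where g="\<lambda>l. y # l"]) simp
  then show ?case by simp
qed simp

lemma measurable_sort_key:
  fixes f :: "nat \<Rightarrow> 'w \<Rightarrow> real"
  assumes "\<And>v. f v \<in> borel_measurable M"
  shows "(\<lambda>\<omega>. sort_key (\<lambda>v. f v \<omega>) L) \<in> M \<rightarrow>\<^sub>M count_space UNIV"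
proof (induction L)
  case (Cons y L)
  show ?case
    using measurable_compose_countable[where f="\<lambda>l \<omega>. insort_key (\<lambda>v. f v \<omega>) y l",
        OF measurable_insort_key[OF assms] Cons]
    by (simp add: sort_key_def)
qed (simp add: sort_key_def)

text \<open>There are only countably many finite sets of naturals; a random finite set can therefore
  be substituted value by value into a measurable family.\<close>

abbreviation finite_subsets :: "nat set measure" where
  "finite_subsets \<equiv> count_space {C. finite C}"

lemma measurable_compose_finite_subsets:
  assumes "\<And>C. finite C \<Longrightarrow> (\<lambda>\<omega>. f C \<omega>) \<in> M \<rightarrow>\<^sub>M N" and "C \<in> M \<rightarrow>\<^sub>M finite_subsets"
  shows "(\<lambda>\<omega>. f (C \<omega>) \<omega>) \<in> M \<rightarrow>\<^sub>M N"
  by (rule measurable_compose_countable'[where f=f and g=C, OF _ assms(2)])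
    (use assms(1) countable_Collect_finite in auto)

text \<open>The instance is a function \<open>J\<close> on an abstract space because it will be the
  first component of a pair whose second component is the vector of thresholds; random centers then
  live on the same space.\<close>

locale random_inst =
  fixes M :: "'w measure" and J :: "'w \<Rightarrow> clustering_inst"
  assumes npts_measurable[measurable]: "(\<lambda>\<omega>. npts (J \<omega>)) \<in> M \<rightarrow>\<^sub>M count_space UNIV"
    and dst_measurable[measurable]: "(\<lambda>\<omega>. dst (J \<omega>) p q) \<in> borel_measurable M"
begin

lemma nearest_measurable: "(\<lambda>\<omega>. nearest (J \<omega>) C v) \<in> M \<rightarrow>\<^sub>M count_space UNIV"
  unfolding nearest_def is_arg_min_def by measurable

lemma labels_measurable: "(\<lambda>\<omega>. map (nearest (J \<omega>) C) [0..<npts (J \<omega>)]) \<in> M \<rightarrow>\<^sub>M count_space UNIV"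
proof -
  have "(\<lambda>\<omega>. map (\<lambda>v. nearest (J \<omega>) C v) [0..<N]) \<in> M \<rightarrow>\<^sub>M count_space UNIV" for N
    by (rule measurable_map_list) (rule nearest_measurable)
  from measurable_compose_countable[where f="\<lambda>N \<omega>. map (\<lambda>v. nearest (J \<omega>) C v) [0..<N]", OF this npts_measurable]
  show ?thesis .
qed

lemma measurable_compose_voronoi:
  assumes "\<And>xs. (\<lambda>\<omega>. f (cells_of_labels C xs) \<omega>) \<in> M \<rightarrow>\<^sub>M N"
  shows "(\<lambda>\<omega>. f (voronoi (J \<omega>) C) \<omega>) \<in> M \<rightarrow>\<^sub>M N"
  unfolding voronoi_eq_cells
  by (rule measurable_compose_countable[where f="\<lambda>xs \<omega>. f (cells_of_labels C xs) \<omega>", OF assms labels_measurable])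

lemma center_cost_measurable:
  assumes "finite S"
  shows "(\<lambda>\<omega>. center_cost (J \<omega>) \<beta> S x) \<in> borel_measurable M"
proof (cases "\<beta> = \<infinity>")
  case True
  then show ?thesis using borel_measurable_Max[OF assms, of "\<lambda>v \<omega>. dst (J \<omega>) x v" M]
    by (simp add: center_cost_def)
next
  case False
  then show ?thesis by (simp add: center_cost_def)
qed

lemma best_center_measurable:
  assumes "finite S"
  shows "(\<lambda>\<omega>. best_center (J \<omega>) \<beta> S) \<in> M \<rightarrow>\<^sub>M count_space UNIV"
proof -
  note [measurable] = center_cost_measurable[OF assms]
  show ?thesis unfolding best_center_def is_arg_min_def by measurable
qed

lemma lloyd_step_measurable:
  assumes "finite C"
  shows "(\<lambda>\<omega>. lloyd_step (J \<omega>) \<beta> C) \<in> M \<rightarrow>\<^sub>M finite_subsets"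
proof -
  have "(\<lambda>\<omega>. best_center (J \<omega>) \<beta> ` cells_of_labels C xs) \<in> M \<rightarrow>\<^sub>M count_space UNIV" for xs
  proof -
    have fin: "finite (cells_of_labels C xs)" using assms by (simp add: cells_of_labels_def)
    then obtain L where L: "set L = cells_of_labels C xs" using finite_list by blast
    have fS: "finite S" if "S \<in> set L" for S using that by (auto simp: L cells_of_labels_def)
    have "(\<lambda>\<omega>. map (\<lambda>S. best_center (J \<omega>) \<beta> S) L) \<in> M \<rightarrow>\<^sub>M count_space UNIV"
      by (rule measurable_map_list) (rule best_center_measurable[OF fS])
    from measurable_compose[OF this, of set "count_space UNIV"] show ?thesis by (simp add: L)
  qed
  then have meas: "(\<lambda>\<omega>. lloyd_step (J \<omega>) \<beta> C) \<in> M \<rightarrow>\<^sub>M count_space UNIV"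
    unfolding lloyd_step_def
    by (rule measurable_compose_voronoi[where f="\<lambda>V \<omega>. best_center (J \<omega>) \<beta> ` V"])
  have "finite (lloyd_step (J \<omega>) \<beta> C)" for \<omega>
    using assms by (simp add: lloyd_step_def voronoi_def)
  then show ?thesis by (intro measurable_count_space_extend[OF subset_UNIV _ meas] Pi_I) simp
qed

lemma lloyd_iter_measurable:
  assumes "C \<in> M \<rightarrow>\<^sub>M finite_subsets"
  shows "(\<lambda>\<omega>. (lloyd_step (J \<omega>) \<beta> ^^ t) (C \<omega>)) \<in> M \<rightarrow>\<^sub>M finite_subsets"
proof (induction t)
  case 0
  then show ?case using assms by simp
next
  case (Suc t)
  show ?case
    using measurable_compose_finite_subsets[where f="\<lambda>C \<omega>. lloyd_step (J \<omega>) \<beta> C", OF lloyd_step_measurable Suc]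
    by simp
qed

lemma breaks_measurable:
  assumes "finite S"
  shows "Measurable.pred M (\<lambda>\<omega>. breaks (J \<omega>) S \<inter> {a<..<b} = {})"
proof -
  have [measurable]: "(\<lambda>\<omega>. cost_diff (J \<omega>) S x x' z) \<in> borel_measurable M" for x x' z
    unfolding cost_diff_def by (intro borel_measurable_diff center_cost_measurable assms)
  show ?thesis unfolding breaks_disjoint_iff by measurable
qed

lemma step_breaks_measurable:
  assumes "finite C"
  shows "Measurable.pred M (\<lambda>\<omega>. step_breaks (J \<omega>) C \<inter> {a<..<b} = {})"
proof -
  have "Measurable.pred M (\<lambda>\<omega>. \<forall>S\<in>cells_of_labels C xs. breaks (J \<omega>) S \<inter> {a<..<b} = {})" for xs
    by (rule pred_intros_finite) (auto simp: cells_of_labels_def assms intro!: breaks_measurable)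
  then have "Measurable.pred M (\<lambda>\<omega>. \<forall>S\<in>voronoi (J \<omega>) C. breaks (J \<omega>) S \<inter> {a<..<b} = {})"
    by (rule measurable_compose_voronoi[where f="\<lambda>V \<omega>. \<forall>S\<in>V. breaks (J \<omega>) S \<inter> {a<..<b} = {}"])
  moreover have "step_breaks I C \<inter> {a<..<b} = {} \<longleftrightarrow> (\<forall>S\<in>voronoi I C. breaks I S \<inter> {a<..<b} = {})" for I
    unfolding step_breaks_def by blast
  ultimately show ?thesis by simp
qed

lemma lloyd_breaks_measurable:
  assumes C: "C \<in> M \<rightarrow>\<^sub>M finite_subsets"
    and valid: "\<And>\<omega>. \<omega> \<in> space M \<Longrightarrow> 0 < npts (J \<omega>) \<and> Metric_space {..<npts (J \<omega>)} (dst (J \<omega>)) \<and>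
      C \<omega> \<in> center_sets (J \<omega>) k"
  shows "{\<omega>\<in>space M. lloyd_breaks (J \<omega>) T (C \<omega>) \<inter> {a<..<b} \<noteq> {}} \<in> sets M"
proof (cases "a < b")
  case True
  \<comment> \<open>The midpoint is the reference parameter that reduces the event to one
    orbit.\<close>
  define m where "m = (a + b) / 2"
  have m: "m \<in> {a<..<b}" using True by (auto simp: m_def)
  have iff: "lloyd_breaks (J \<omega>) T (C \<omega>) \<inter> {a<..<b} = {} \<longleftrightarrow>
     (\<forall>t<T. step_breaks (J \<omega>) ((lloyd_step (J \<omega>) (ereal m) ^^ t) (C \<omega>)) \<inter> {a<..<b} = {})"
    if "\<omega> \<in> space M" for \<omega>
  proof -
    interpret param_iteration "\<lambda>b. lloyd_step (J \<omega>) (ereal b)" "step_breaks (J \<omega>)" "center_sets (J \<omega>) k"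
      "2 * npts (J \<omega>) ^ 4"
      by (rule lloyd_param_iteration) (use valid[OF that] in auto)
    show ?thesis unfolding lloyd_breaks_def
      by (rule iter_breaks_disjoint_iff(1)[OF _ _ m]) (use valid[OF that] in \<open>auto simp: is_interval_1\<close>)
  qed
  have eq: "{\<omega>\<in>space M. lloyd_breaks (J \<omega>) T (C \<omega>) \<inter> {a<..<b} \<noteq> {}} = {\<omega>\<in>space M.
     \<not> (\<forall>t\<in>{..<T}. step_breaks (J \<omega>) ((lloyd_step (J \<omega>) (ereal m) ^^ t) (C \<omega>)) \<inter> {a<..<b} = {})}"
    by (intro Collect_cong conj_cong refl) (simp add: iff Ball_def)
  have [measurable]: "Measurable.pred M (\<lambda>\<omega>. step_breaks (J \<omega>) ((lloyd_step (J \<omega>) (ereal m) ^^ t) (C \<omega>)) \<inter> {a<..<b} = {})" for t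
    using measurable_compose_finite_subsets[where f="\<lambda>C \<omega>. step_breaks (J \<omega>) C \<inter> {a<..<b} = {}",
        OF step_breaks_measurable lloyd_iter_measurable[OF C]] .
  show ?thesis unfolding eq by measurable
next
  case False
  then have "{a<..<b} = {}" by simp
  then show ?thesis by simp
qed

lemma cost_measurable:
  assumes C: "C \<in> M \<rightarrow>\<^sub>M finite_subsets" and cost: "\<And>P. (\<lambda>\<omega>. cl_cost (J \<omega>) P) \<in> borel_measurable M"
  shows "(\<lambda>\<omega>. cl_cost (J \<omega>) (voronoi (J \<omega>) (C \<omega>))) \<in> borel_measurable M"
proof -
  have "(\<lambda>\<omega>. cl_cost (J \<omega>) (voronoi (J \<omega>) C)) \<in> borel_measurable M" for C
    by (rule measurable_compose_voronoi[where f="\<lambda>V \<omega>. cl_cost (J \<omega>) V", OF cost])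
  then show ?thesis
    by (rule measurable_compose_finite_subsets[where f="\<lambda>C \<omega>. cl_cost (J \<omega>) (voronoi (J \<omega>) C)", OF _ C])
qed

lemma dmin_measurable: "finite C \<Longrightarrow> (\<lambda>\<omega>. dmin (J \<omega>) C v) \<in> borel_measurable M"
  using borel_measurable_Min[of C "\<lambda>c \<omega>. dst (J \<omega>) v c" M] by (auto simp: dmin_def)

lemma seed_order_measurable:
  assumes "finite C"
  shows "(\<lambda>\<omega>. seed_order (J \<omega>) C) \<in> M \<rightarrow>\<^sub>M count_space UNIV"
proof -
  have "(\<lambda>\<omega>. sort_key (\<lambda>v. - dmin (J \<omega>) C v) [0..<N]) \<in> M \<rightarrow>\<^sub>M count_space UNIV" for N
    by (rule measurable_sort_key) (intro borel_measurable_uminus dmin_measurable assms)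
  from measurable_compose_countable[where f="\<lambda>N \<omega>. sort_key (\<lambda>v. - dmin (J \<omega>) C v) [0..<N]", OF this npts_measurable]
  show ?thesis unfolding seed_order_def .
qed

lemma cum_weight_measurable:
  assumes "finite C"
  shows "(\<lambda>\<omega>. cum_weight (J \<omega>) \<alpha> C i) \<in> borel_measurable M"
proof -
  note [measurable] = dmin_measurable[OF assms]
  have "(\<lambda>\<omega>. \<Sum>j<i. dmin (J \<omega>) C (L ! j) powr \<alpha>) \<in> borel_measurable M" for L
    by measurable
  from measurable_compose_countable[where f="\<lambda>L \<omega>. \<Sum>j<i. dmin (J \<omega>) C (L ! j) powr \<alpha>", OF this seed_order_measurable[OF assms]]
  show ?thesis unfolding cum_weight_def .
qed

lemma total_weight_measurable:
  assumes "finite C"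
  shows "(\<lambda>\<omega>. cum_weight (J \<omega>) \<alpha> C (npts (J \<omega>))) \<in> borel_measurable M"
  by (rule measurable_compose_countable[where f="\<lambda>i \<omega>. cum_weight (J \<omega>) \<alpha> C i",
      OF cum_weight_measurable[OF assms] npts_measurable])

end

lemma cum_weight_mono: "i \<le> j \<Longrightarrow> cum_weight I \<alpha> C i \<le> cum_weight I \<alpha> C j"
  unfolding cum_weight_def by (intro sum_mono2) auto

lemma cum_weight_nonneg: "0 \<le> cum_weight I \<alpha> C i"
  unfolding cum_weight_def by (intro sum_nonneg) auto

lemma seed_interval_unique:
  assumes "z \<in> seed_interval I \<alpha> C i" "z \<in> seed_interval I \<alpha> C j"
  shows "i = j"
proof -
  have "\<not> i < j" if "z \<in> seed_interval I \<alpha> C i" "z \<in> seed_interval I \<alpha> C j" for i j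
  proof
    assume "i < j"
    then have "cum_weight I \<alpha> C (Suc i) / cum_weight I \<alpha> C (npts I) \<le> cum_weight I \<alpha> C j / cum_weight I \<alpha> C (npts I)"
      by (intro divide_right_mono cum_weight_mono cum_weight_nonneg) auto
    then show False using that by (auto simp: seed_interval_def)
  qed
  from this[of i j] this[of j i] show ?thesis using assms by (auto intro: linorder_cases)
qed

lemma (in random_inst) seed_pick_measurable:
  assumes C: "finite C" and [measurable]: "z \<in> borel_measurable M"
  shows "(\<lambda>\<omega>. seed_pick (J \<omega>) \<alpha> C (z \<omega>)) \<in> M \<rightarrow>\<^sub>M count_space UNIV"
proof -
  note [measurable] = cum_weight_measurable[OF C] total_weight_measurable[OF C] seed_order_measurable[OF C]
  have P[measurable]: "Measurable.pred M (\<lambda>\<omega>. i < npts (J \<omega>) \<and> z \<omega> \<in> seed_interval (J \<omega>) \<alpha> C i)" for i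
    unfolding seed_interval_def atLeastLessThan_iff by measurable
  have "(\<lambda>\<omega>. THE i. i < npts (J \<omega>) \<and> z \<omega> \<in> seed_interval (J \<omega>) \<alpha> C i) \<in> M \<rightarrow>\<^sub>M count_space UNIV"
    by (rule measurable_THE[where I=UNIV]) (use P seed_interval_unique in auto)
  then have nth: "(\<lambda>\<omega>. L ! (THE i. i < npts (J \<omega>) \<and> z \<omega> \<in> seed_interval (J \<omega>) \<alpha> C i)) \<in> M \<rightarrow>\<^sub>M count_space UNIV"
    for L :: "nat list"
    by (rule measurable_compose[where g="\<lambda>i. L ! i"]) simp
  have "(\<lambda>\<omega>. if \<exists>i. i < npts (J \<omega>) \<and> z \<omega> \<in> seed_interval (J \<omega>) \<alpha> C i
     then L ! (THE i. i < npts (J \<omega>) \<and> z \<omega> \<in> seed_interval (J \<omega>) \<alpha> C i) else last L) \<in> M \<rightarrow>\<^sub>M count_space UNIV"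
    for L :: "nat list"
    by (intro measurable_If nth measurable_const) (simp_all add: pred_intros_countable P)
  from measurable_compose_countable[where f="\<lambda>L \<omega>. if \<exists>i. i < npts (J \<omega>) \<and> z \<omega> \<in> seed_interval (J \<omega>) \<alpha> C i
     then L ! (THE i. i < npts (J \<omega>) \<and> z \<omega> \<in> seed_interval (J \<omega>) \<alpha> C i) else last L", OF this seed_order_measurable[OF C]]
  show ?thesis unfolding seed_pick_def .
qed

lemma (in random_inst) seeds_measurable:
  assumes "\<And>s. s < t \<Longrightarrow> (\<lambda>\<omega>. Z \<omega> s) \<in> borel_measurable M"
  shows "(\<lambda>\<omega>. seeds (J \<omega>) \<alpha> (Z \<omega>) t) \<in> M \<rightarrow>\<^sub>M finite_subsets"
  using assms
proof (induction t)
  case (Suc t)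
  have 1: "(\<lambda>\<omega>. insert (seed_pick (J \<omega>) \<alpha> C (Z \<omega> t)) C) \<in> M \<rightarrow>\<^sub>M finite_subsets" if "finite C" for C
  proof -
    have "(\<lambda>\<omega>. seed_pick (J \<omega>) \<alpha> C (Z \<omega> t)) \<in> M \<rightarrow>\<^sub>M count_space UNIV"
      using Suc.prems by (intro seed_pick_measurable that) auto
    then show ?thesis by (rule measurable_compose[where g="\<lambda>c. insert c C"]) (simp add: that)
  qed
  have 2: "(\<lambda>\<omega>. seeds (J \<omega>) \<alpha> (Z \<omega>) t) \<in> M \<rightarrow>\<^sub>M finite_subsets" using Suc by auto
  show ?case
    using measurable_compose_finite_subsets[where f="\<lambda>C \<omega>. insert (seed_pick (J \<omega>) \<alpha> C (Z \<omega> t)) C", OF 1 2] by simp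
qed simp

subsection \<open>Seeding as a function of the exponent\<close>

lemma length_seed_order: "length (seed_order I C) = npts I"
  by (simp add: seed_order_def)

lemma set_seed_order: "set (seed_order I C) = {..<npts I}"
  by (auto simp: seed_order_def)

lemma seed_pick_less:
  assumes "0 < npts I"
  shows "seed_pick I \<alpha> C z < npts I"
proof (cases "\<exists>i<npts I. z \<in> seed_interval I \<alpha> C i")
  case True
  then have "\<exists>!i. i < npts I \<and> z \<in> seed_interval I \<alpha> C i" using seed_interval_unique by blast
  from theI'[OF this] have "(THE i. i < npts I \<and> z \<in> seed_interval I \<alpha> C i) < length (seed_order I C)"
    by (simp add: length_seed_order)
  then have "seed_pick I \<alpha> C z \<in> set (seed_order I C)" using True by (simp add: seed_pick_def)
  then show ?thesis by (simp add: set_seed_order)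
next
  case False
  have "seed_order I C \<noteq> []" using assms length_seed_order[of I C] by auto
  then have "last (seed_order I C) \<in> set (seed_order I C)" by (rule last_in_set)
  moreover have "seed_pick I \<alpha> C z = last (seed_order I C)"
    unfolding seed_pick_def using False by (rule if_not_P)
  ultimately show ?thesis by (simp add: set_seed_order)
qed

lemma finite_seeds: "finite (seeds I \<alpha> Z t)"
  by (induction t) auto

lemma seeds_subset: "0 < npts I \<Longrightarrow> seeds I \<alpha> Z t \<subseteq> {..<npts I}"
  by (induction t) (auto intro: seed_pick_less)

lemma card_seeds: "card (seeds I \<alpha> Z t) \<le> t"
proof (induction t)
  case (Suc t)
  then show ?case
    using card_insert_le_m1[of "Suc t" "seeds I \<alpha> Z t" "seed_pick I \<alpha> (seeds I \<alpha> Z t) (Z t)"] by simp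
qed simp

lemma seeds_center_sets:
  assumes "0 < npts I" "1 \<le> k"
  shows "seeds I \<alpha> Z k \<in> center_sets I k"
proof -
  obtain t where "k = Suc t" using assms by (cases k) auto
  then have "seeds I \<alpha> Z k \<noteq> {}" by simp
  then show ?thesis using seeds_subset[OF assms(1)] card_seeds by (simp add: center_sets_def)
qed

lemma seeds_cong: "(\<And>s. s < t \<Longrightarrow> Z s = Z' s) \<Longrightarrow> seeds I \<alpha> Z t = seeds I \<alpha> Z' t"
  by (induction t) auto

text \<open>
  Since the weights are sorted, raising the exponent shifts weight to the front.
\<close>
lemma weight_ratio_mono:
  fixes d :: "nat \<Rightarrow> real"
  assumes nn: "\<And>j. j < n \<Longrightarrow> 0 \<le> d j" and anti: "\<And>j l. j \<le> l \<Longrightarrow> l < n \<Longrightarrow> d l \<le> d j"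
    and ab: "a \<le> b" and i: "i \<le> n"
  shows "(\<Sum>j<i. d j powr a) / (\<Sum>j<n. d j powr a) \<le> (\<Sum>j<i. d j powr b) / (\<Sum>j<n. d j powr b)"
proof -
  define A where "A c = (\<Sum>j<i. d j powr c)" for c
  define B where "B c = (\<Sum>l\<in>{i..<n}. d l powr c)" for c
  have T: "(\<Sum>j<n. d j powr c) = A c + B c" for c
  proof -
    have "{..<n} = {..<i} \<union> {i..<n}" using i by auto
    then show ?thesis unfolding A_def B_def by (simp add: sum.union_disjoint ivl_disj_int)
  qed
  have A0: "0 \<le> A c" and B0: "0 \<le> B c" for c by (auto simp: A_def B_def intro: sum_nonneg)
  \<comment> \<open>Since \<open>d powr c'\<close> vanishes only for \<open>d = 0\<close>, a zero
    total for one exponent kills the head for every exponent; the left quotient is then 0.\<close>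
  have zero: "A c = 0" if "A c' + B c' = 0" for c c'
  proof -
    have "A c' = 0" using that A0[of c'] B0[of c'] by linarith
    then have "\<forall>j<i. d j powr c' = 0" unfolding A_def by (subst (asm) sum_nonneg_eq_0_iff) auto
    then show ?thesis by (simp add: A_def)
  qed
  \<comment> \<open>For positive weights the ratio \<open>d j / d l \<ge> 1\<close> of an earlier to
    a later one has powers that grow with the exponent. Summed over head and tail this is the
    cross-multiplied inequality.\<close>
  have trm: "d j powr a * d l powr b \<le> d j powr b * d l powr a" if "j < i" "l \<in> {i..<n}" for j l
  proof (cases "d l = 0")
    case False
    then have l: "0 < d l" "d l \<le> d j" using nn[of l] anti[of j l] that by auto
    have "d l powr (b - a) \<le> d j powr (b - a)" using l ab by (intro powr_mono2) auto
    then have "(d j powr a * d l powr a) * d l powr (b - a) \<le> (d j powr a * d l powr a) * d j powr (b - a)"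
      by (intro mult_left_mono) auto
    moreover have "d l powr b = d l powr a * d l powr (b - a)" "d j powr b = d j powr a * d j powr (b - a)"
      using l by (simp_all flip: powr_add)
    ultimately show ?thesis by (simp add: ac_simps)
  qed auto
  have "A a * B b = (\<Sum>j<i. \<Sum>l\<in>{i..<n}. d j powr a * d l powr b)"
    unfolding A_def B_def by (simp add: sum_product)
  also have "\<dots> \<le> (\<Sum>j<i. \<Sum>l\<in>{i..<n}. d j powr b * d l powr a)"
    using trm by (intro sum_mono) auto
  also have "\<dots> = A b * B a" unfolding A_def B_def by (simp add: sum_product)
  finally have cross: "A a * (A b + B b) \<le> A b * (A a + B a)" by (simp add: algebra_simps)
  show ?thesis
  proof (cases "A a + B a = 0 \<or> A b + B b = 0")
    case True
    then have "A a = 0" using zero[of a a] zero[of b a] by auto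
    then show ?thesis using A0 B0 by (simp add: T flip: A_def)
  next
    case False
    then have "0 < A a + B a" "0 < A b + B b" using A0[of a] B0[of a] A0[of b] B0[of b] by auto
    then have "A a / (A a + B a) \<le> A b / (A b + B b)"
      using cross by (simp add: pos_divide_le_eq pos_le_divide_eq mult.commute)
    then show ?thesis by (simp add: T flip: A_def)
  qed
qed

text \<open>Division by the largest weight \<open>d 0\<close> leaves the ratios unchanged and makes
  all weights at most 1 and every total at least 1. Sums then decrease in the exponent, so the ratio
  grows by no more than the total shrinks, and that is a sum of \<open>n\<close> variations of at
  most \<open>s\<close>.\<close>

lemma weight_ratio_diff:
  fixes d :: "nat \<Rightarrow> real"
  assumes nn: "\<And>j. j < n \<Longrightarrow> 0 \<le> d j" and anti: "\<And>j l. j \<le> l \<Longrightarrow> l < n \<Longrightarrow> d l \<le> d j"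
    and ab: "a \<le> b" and i: "i \<le> n" and s: "0 \<le> s"
    and diff: "\<And>j l. j < n \<Longrightarrow> l < n \<Longrightarrow> 0 < d j \<Longrightarrow> d j \<le> d l \<Longrightarrow> (d j / d l) powr a - (d j / d l) powr b \<le> s"
  shows "(\<Sum>j<i. d j powr b) / (\<Sum>j<n. d j powr b) - (\<Sum>j<i. d j powr a) / (\<Sum>j<n. d j powr a) \<le> real n * s"
proof (cases "n = 0 \<or> d 0 = 0")
  case True
  have "(\<Sum>j<n. d j powr c) = 0" for c
  proof (rule sum.neutral, safe)
    fix j assume "j < n"
    then have "d j = 0" using True nn[of j] anti[of 0 j] by auto
    then show "d j powr c = 0" by simp
  qed
  then show ?thesis using s by simp
next
  case False
  then have n: "0 < n" and D: "0 < d 0" using nn[of 0] by auto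
  define u where "u j = d j / d 0" for j
  define U where "U i c = (\<Sum>j<i. u j powr c)" for i c
  have u: "0 \<le> u j" "u j \<le> 1" if "j < n" for j
    using nn[OF that] anti[of 0 j] that D by (auto simp: u_def divide_le_eq)
  have dU: "(\<Sum>j<i'. d j powr c) = d 0 powr c * U i' c" if "i' \<le> n" for i' c
    unfolding U_def sum_distrib_left
  proof (rule sum.cong)
    fix j assume "j \<in> {..<i'}"
    then have "0 \<le> u j" using u that by auto
    moreover have "d j = d 0 * u j" using D by (simp add: u_def)
    ultimately show "d j powr c = d 0 powr c * u j powr c" using D by (metis less_imp_le powr_mult)
  qed simp
  have ratio: "(\<Sum>j<i. d j powr c) / (\<Sum>j<n. d j powr c) = U i c / U n c" for c
    using dU[OF i] dU[of n] D by simp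
  have U1: "1 \<le> U n c" for c
  proof -
    have "u 0 powr c \<le> (\<Sum>j<n. u j powr c)" using n by (intro member_le_sum) auto
    then show ?thesis using D by (simp add: U_def u_def)
  qed
  have le: "u j powr b \<le> u j powr a" if "j < n" for j
    using u[OF that] ab by (intro powr_mono') auto
  have Ule: "U i' b \<le> U i' a" if "i' \<le> n" for i' unfolding U_def using le that by (intro sum_mono) auto
  have U0: "0 \<le> U i a" unfolding U_def by (intro sum_nonneg) auto
  have Uin: "U i a \<le> U n a" unfolding U_def using i by (intro sum_mono2) auto
  have "U i b / U n b \<le> U i a / U n b" using Ule[OF i] U1[of b] by (intro divide_right_mono) auto
  then have "U i b / U n b - U i a / U n a \<le> U i a / U n b - U i a / U n a" by simp
  also have "\<dots> = (U i a / U n a) * ((U n a - U n b) / U n b)"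
    using U1[of a] U1[of b] by (simp add: field_simps)
  also have "\<dots> \<le> 1 * (U n a - U n b)"
  proof (rule mult_mono)
    show "U i a / U n a \<le> 1" using Uin U1[of a] by (simp add: divide_le_eq)
    have "(U n a - U n b) / U n b \<le> (U n a - U n b) / 1"
      using U1[of b] Ule[of n] by (intro divide_left_mono) auto
    then show "(U n a - U n b) / U n b \<le> U n a - U n b" by simp
    show "0 \<le> (U n a - U n b) / U n b" using U1[of b] Ule[of n] by simp
  qed simp
  also have "\<dots> = (\<Sum>j<n. u j powr a - u j powr b)" by (simp add: U_def sum_subtractf)
  also have "\<dots> \<le> (\<Sum>j<n. s)"
  proof (rule sum_mono)
    fix j assume j: "j \<in> {..<n}"
    show "u j powr a - u j powr b \<le> s"
    proof (cases "d j = 0")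
      case True
      then show ?thesis using s by (simp add: u_def)
    next
      case False
      then show ?thesis using diff[of j 0] nn[of j] anti[of 0 j] j n by (auto simp: u_def)
    qed
  qed
  finally show ?thesis unfolding ratio by simp
qed

section \<open>Endpoints of the seeding intervals\<close>

definition weight_ratio :: "clustering_inst \<Rightarrow> real \<Rightarrow> nat set \<Rightarrow> nat \<Rightarrow> real" where
  "weight_ratio I \<alpha> C i = cum_weight I \<alpha> C i / cum_weight I \<alpha> C (npts I)"

lemma dmin_nonneg:
  assumes "finite C" "\<And>p q. 0 \<le> dst I p q"
  shows "0 \<le> dmin I C v"
  using assms by (auto simp: dmin_def)

lemma seed_order_antimono:
  assumes "j \<le> l" "l < npts I"
  shows "dmin I C (seed_order I C ! l) \<le> dmin I C (seed_order I C ! j)"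
proof -
  have "sorted (map (\<lambda>v. - dmin I C v) (seed_order I C))" unfolding seed_order_def by (rule sorted_sort_key)
  from sorted_nth_mono[OF this assms(1)] assms show ?thesis by (simp add: length_seed_order)
qed

lemma weight_ratio_mono_exponent:
  assumes "finite C" "\<And>p q. 0 \<le> dst I p q" "a \<le> b" "i \<le> npts I"
  shows "weight_ratio I a C i \<le> weight_ratio I b C i"
  unfolding weight_ratio_def cum_weight_def
  using assms by (intro weight_ratio_mono dmin_nonneg seed_order_antimono)

text \<open>Quantified over all pairs of distances rather than over the weights of a round, so that
  it can be checked for an instance before any center is drawn. Only ratios up to 1 occur.\<close>

definition power_variation_le :: "clustering_inst \<Rightarrow> real \<Rightarrow> real \<Rightarrow> real \<Rightarrow> bool" where
  "power_variation_le I a b s \<longleftrightarrow>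
     (\<forall>p<npts I. \<forall>q<npts I. \<forall>p'<npts I. \<forall>q'<npts I. 0 < dst I p q \<longrightarrow> dst I p q \<le> dst I p' q' \<longrightarrow>
        (dst I p q / dst I p' q') powr a - (dst I p q / dst I p' q') powr b \<le> s)"

lemma weight_ratio_diff_exponent:
  assumes C: "C \<subseteq> {..<npts I}" and nn: "\<And>p q. 0 \<le> dst I p q" and ab: "a \<le> b" and i: "i \<le> npts I"
    and s: "0 \<le> s" and var: "power_variation_le I a b s"
  shows "weight_ratio I b C i - weight_ratio I a C i \<le> real (npts I) * s"
  unfolding weight_ratio_def cum_weight_def
proof (rule weight_ratio_diff)
  have fC: "finite C" using C finite_subset by blast
  fix j assume j: "j < npts I"
  show "0 \<le> dmin I C (seed_order I C ! j)" by (rule dmin_nonneg[OF fC nn])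
  have so: "seed_order I C ! l < npts I" if "l < npts I" for l
    using nth_mem[of l "seed_order I C"] that by (simp add: set_seed_order length_seed_order)
  fix l assume l: "l < npts I" and pos: "0 < dmin I C (seed_order I C ! j)"
    and le: "dmin I C (seed_order I C ! j) \<le> dmin I C (seed_order I C ! l)"
  let ?x = "dmin I C (seed_order I C ! j) / dmin I C (seed_order I C ! l)"
  show "?x powr a - ?x powr b \<le> s"
  \<comment> \<open>In the first round all weights are 1 and nothing varies. Later each weight is
    the distance to an actual center, so \<open>var\<close> applies to it.\<close>
  proof (cases "C = {}")
    case True
    then show ?thesis using s by (simp add: dmin_def)
  next
    case False
    have dm: "\<exists>c\<in>C. dmin I C v = dst I v c" for v
    proof -
      have "Min (dst I v ` C) \<in> dst I v ` C" using fC False by (intro Min_in) auto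
      then show ?thesis using False by (auto simp: dmin_def)
    qed
    obtain c where c: "c \<in> C" "dmin I C (seed_order I C ! j) = dst I (seed_order I C ! j) c" using dm by blast
    obtain c' where c': "c' \<in> C" "dmin I C (seed_order I C ! l) = dst I (seed_order I C ! l) c'" using dm by blast
    have "c < npts I" "c' < npts I" using C c c' by auto
    then show ?thesis using var so[OF j] so[OF l] pos le unfolding c c' power_variation_le_def by blast
  qed
qed (use seed_order_antimono ab i s in auto)

text \<open>Every endpoint increases with the exponent, so for \<alpha> it lies between its
  positions for \<open>a\<close> and \<open>b\<close>. If \<open>z\<close> avoids all these ranges,
  it is on the same side of every endpoint for \<alpha> as for \<open>a\<close>. The half-open range
  in \<open>sep\<close> matches the half-open seeding intervals.\<close>

lemma seed_pick_const:
  assumes C: "finite C" and nn: "\<And>p q. 0 \<le> dst I p q" and \<alpha>: "\<alpha> \<in> {a..b}"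
    and sep: "\<And>i. i \<le> npts I \<Longrightarrow> \<not> (weight_ratio I a C i \<le> z \<and> z < weight_ratio I b C i)"
  shows "seed_pick I \<alpha> C z = seed_pick I a C z"
proof -
  have iff: "weight_ratio I \<alpha> C i \<le> z \<longleftrightarrow> weight_ratio I a C i \<le> z" if "i \<le> npts I" for i
    using sep[OF that] weight_ratio_mono_exponent[OF C nn _ that, of a \<alpha>]
      weight_ratio_mono_exponent[OF C nn _ that, of \<alpha> b] \<alpha> by auto
  have *: "(i < npts I \<and> z \<in> seed_interval I \<alpha> C i) \<longleftrightarrow> (i < npts I \<and> z \<in> seed_interval I a C i)" for i
    using iff[of i] iff[of "Suc i"]
    by (auto simp: seed_interval_def not_le[symmetric] simp flip: weight_ratio_def)
  show ?thesis unfolding seed_pick_def by (simp only: *)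
qed

section \<open>Probability that the seeds change with the exponent\<close>

lemma emeasure_uniform_unit_interval_le:
  "emeasure (uniform_measure lborel {0..1::real}) {x..<y} \<le> ennreal (y - x)"
proof -
  have "emeasure (uniform_measure lborel {0..1::real}) {x..<y} = emeasure lborel ({0..1} \<inter> {x..<y})"
    by (subst emeasure_uniform_measure) (auto simp: divide_ennreal_def)
  also have "\<dots> \<le> emeasure lborel {x..<y}" by (intro emeasure_mono) auto
  also have "\<dots> \<le> ennreal (y - x)" by (cases "x \<le> y") auto
  finally show ?thesis .
qed

lemma prob_space_uniform_unit_interval: "prob_space (uniform_measure lborel {0..1::real})"
  by (rule prob_space_uniform_measure) auto

lemma prob_space_unit_cube: "prob_space (unit_cube k)"
  unfolding unit_cube_def by (intro prob_space_PiM prob_space_uniform_unit_interval)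

definition pick_changes :: "clustering_inst \<Rightarrow> real \<Rightarrow> real \<Rightarrow> nat set \<Rightarrow> real \<Rightarrow> bool" where
  "pick_changes I a b C z \<longleftrightarrow> (\<exists>i. i \<le> npts I \<and> weight_ratio I a C i \<le> z \<and> z < weight_ratio I b C i)"

text \<open>
  The centers of round \<open>t\<close> depend only on \<open>z\<^sub>0, \<dots>, z\<^sub>t\<^sub>-\<^sub>1\<close>, so \<open>z\<^sub>t\<close> is integrated out first.
\<close>
lemma emeasure_pick_changes_le:
  assumes t: "t < k" and n: "0 < npts I" "npts I \<le> n" and nn: "\<And>p q. 0 \<le> dst I p q"
    and ab: "a \<le> b" and s: "0 \<le> s" and var: "power_variation_le I a b s"
    and A: "A = {Z \<in> space (unit_cube k). pick_changes I a b (seeds I a Z t) (Z t)}" "A \<in> sets (unit_cube k)"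
  shows "emeasure (unit_cube k) A \<le> ennreal (real (n + 1) * (real n * s))"
proof -
  let ?u = "uniform_measure lborel {0..1::real}"
  interpret u: prob_space ?u by (rule prob_space_uniform_unit_interval)
  interpret product_sigma_finite "\<lambda>_::nat. ?u" by unfold_locales
  let ?c = "ennreal (real (n + 1) * (real n * s))"
  have k: "{..<k} = insert t ({..<k} - {t})" using t by auto
  have "emeasure (unit_cube k) A = (\<integral>\<^sup>+Z. indicator A Z \<partial>unit_cube k)" using A(2) by simp
  also have "\<dots> = (\<integral>\<^sup>+x. (\<integral>\<^sup>+y. indicator A (x(t := y)) \<partial>?u) \<partial>(\<Pi>\<^sub>M i\<in>{..<k} - {t}. ?u))"
    unfolding unit_cube_def
    by (subst k, rule product_nn_integral_insert) (use A(2) k in \<open>auto simp: unit_cube_def\<close>)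
  also have "\<dots> \<le> (\<integral>\<^sup>+x. ?c \<partial>(\<Pi>\<^sub>M i\<in>{..<k} - {t}. ?u))"
  proof (rule nn_integral_mono)
    fix x :: "nat \<Rightarrow> real"
    let ?C = "seeds I a x t"
    let ?B = "\<lambda>i. {weight_ratio I a ?C i..<weight_ratio I b ?C i}"
    have C: "?C \<subseteq> {..<npts I}" by (rule seeds_subset[OF n(1)])
    have "(\<integral>\<^sup>+y. indicator A (x(t := y)) \<partial>?u) \<le> (\<integral>\<^sup>+y. indicator (\<Union>i\<in>{..npts I}. ?B i) y \<partial>?u)"
    proof (rule nn_integral_mono)
      fix y :: real
      have "seeds I a (x(t := y)) t = ?C" by (rule seeds_cong) simp
      then show "indicator A (x(t := y)) \<le> (indicator (\<Union>i\<in>{..npts I}. ?B i) y :: ennreal)"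
        by (auto simp: A(1) pick_changes_def indicator_def)
    qed
    also have "\<dots> = emeasure ?u (\<Union>i\<in>{..npts I}. ?B i)" by (intro nn_integral_indicator) auto
    also have "\<dots> \<le> (\<Sum>i\<in>{..npts I}. emeasure ?u (?B i))" by (intro emeasure_subadditive_finite) auto
    also have "\<dots> \<le> (\<Sum>i\<in>{..npts I}. ennreal (real (npts I) * s))"
    proof (rule sum_mono)
      fix i assume "i \<in> {..npts I}"
      then have "weight_ratio I b ?C i - weight_ratio I a ?C i \<le> real (npts I) * s"
        using weight_ratio_diff_exponent[OF C nn ab _ s var] by simp
      then show "emeasure ?u (?B i) \<le> ennreal (real (npts I) * s)"
        using emeasure_uniform_unit_interval_le order_trans ennreal_leI by blast
    qed
    also have "\<dots> = ennreal (real (npts I + 1) * (real (npts I) * s))"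
      using s by (simp add: ennreal_mult' flip: ennreal_of_nat_eq_real_of_nat)
    also have "\<dots> \<le> ?c" using n s by (intro ennreal_leI mult_mono) auto
    finally show "(\<integral>\<^sup>+y. indicator A (x(t := y)) \<partial>?u) \<le> ?c" .
  qed
  also have "\<dots> = ?c"
  proof -
    interpret P: prob_space "\<Pi>\<^sub>M i\<in>{..<k} - {t}. ?u"
      by (intro prob_space_PiM prob_space_uniform_unit_interval)
    show ?thesis by (simp add: P.emeasure_space_1)
  qed
  finally show ?thesis .
qed

lemma inst_distribution_random_inst:
  assumes "inst_distribution n k H D"
  shows "random_inst (D \<Otimes>\<^sub>M unit_cube k') fst"
  using assms unfolding inst_distribution_def
  by unfold_locales (auto intro: measurable_compose[OF measurable_fst])

lemma unit_cube_component_measurable: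
  assumes "t < k"
  shows "(\<lambda>\<omega>. snd \<omega> t) \<in> borel_measurable (D \<Otimes>\<^sub>M unit_cube k)"
proof -
  let ?u = "uniform_measure lborel {0..1::real}"
  have "(\<lambda>Z. Z t) \<in> unit_cube k \<rightarrow>\<^sub>M ?u"
    unfolding unit_cube_def by (rule measurable_component_singleton) (use assms in simp)
  moreover have "unit_cube k \<rightarrow>\<^sub>M ?u = borel_measurable (unit_cube k)"
    by (rule measurable_cong_sets) simp_all
  ultimately have "(\<lambda>Z. Z t) \<in> borel_measurable (unit_cube k)" by simp
  then show ?thesis by (rule measurable_compose[OF measurable_snd])
qed

text \<open>The event collects, over all rounds, the thresholds that fall between two positions of
  an endpoint, always for the centers drawn with exponent \<open>a\<close>. Off it, induction on the
  rounds shows that every exponent in the strip follows these same centers, so a sum over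
  \<open>k\<close> rounds suffices instead of one over center sets.\<close>

lemma seeds_const_event:
  assumes D: "inst_distribution n k H D" and ab: "a \<le> b" and s: "0 \<le> s"
    and var: "AE I in D. power_variation_le I a b s"
  shows "\<exists>E\<in>sets (D \<Otimes>\<^sub>M unit_cube k). measure (D \<Otimes>\<^sub>M unit_cube k) E \<le> real k * (real (n + 1) * (real n * s)) \<and>
    (\<forall>\<omega>\<in>space (D \<Otimes>\<^sub>M unit_cube k) - E. \<forall>\<alpha>\<in>{a..b}. seeds (fst \<omega>) \<alpha> (snd \<omega>) k = seeds (fst \<omega>) a (snd \<omega>) k)"
proof -
  let ?M = "D \<Otimes>\<^sub>M unit_cube k"
  interpret D: prob_space D using D by (simp add: inst_distribution_def)
  interpret U: prob_space "unit_cube k" by (rule prob_space_unit_cube)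
  interpret pair_prob_space D "unit_cube k" ..
  interpret random_inst ?M fst by (rule inst_distribution_random_inst[OF D])
  have valid: "0 < npts I \<and> npts I \<le> n \<and> (\<forall>p q. 0 \<le> dst I p q)" if "I \<in> space D" for I
    using D that by (auto simp: inst_distribution_def valid_inst_def Metric_space_def)
  let ?c = "real (n + 1) * (real n * s)"
  define A where "A t = {\<omega>\<in>space ?M. pick_changes (fst \<omega>) a b (seeds (fst \<omega>) a (snd \<omega>) t) (snd \<omega> t)}" for t
  have A: "A t \<in> sets ?M" if t: "t < k" for t
  proof -
    have [measurable]: "(\<lambda>\<omega>. snd \<omega> t) \<in> borel_measurable ?M" by (rule unit_cube_component_measurable[OF t])
    have "Measurable.pred ?M (\<lambda>\<omega>. pick_changes (fst \<omega>) a b C (snd \<omega> t))" if "finite C" for C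
    proof -
      note [measurable] = cum_weight_measurable[OF that] total_weight_measurable[OF that]
      show ?thesis unfolding pick_changes_def weight_ratio_def by measurable
    qed
    then have "Measurable.pred ?M (\<lambda>\<omega>. pick_changes (fst \<omega>) a b (seeds (fst \<omega>) a (snd \<omega>) t) (snd \<omega> t))"
      by (rule measurable_compose_finite_subsets[where f="\<lambda>C \<omega>. pick_changes (fst \<omega>) a b C (snd \<omega> t)"])
        (use t in \<open>auto intro!: seeds_measurable unit_cube_component_measurable\<close>)
    then show ?thesis unfolding A_def by measurable
  qed
  have pA: "measure ?M (A t) \<le> ?c" if t: "t < k" for t
  proof -
    have "emeasure ?M (A t) = (\<integral>\<^sup>+I. emeasure (unit_cube k) (Pair I -` A t) \<partial>D)"
      by (rule U.emeasure_pair_measure_alt[OF A[OF t]])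
    also have "\<dots> \<le> (\<integral>\<^sup>+I. ennreal ?c \<partial>D)"
    proof (rule nn_integral_mono_AE)
      show "AE I in D. emeasure (unit_cube k) (Pair I -` A t) \<le> ennreal ?c"
        using var AE_space
      proof eventually_elim
        case (elim I)
        show ?case
        proof (rule emeasure_pick_changes_le[OF t _ _ _ ab s elim(1)])
          show "Pair I -` A t = {Z \<in> space (unit_cube k). pick_changes I a b (seeds I a Z t) (Z t)}"
            using elim(2) by (auto simp: A_def space_pair_measure)
          show "Pair I -` A t \<in> sets (unit_cube k)" by (rule sets_Pair1[OF A[OF t]])
        qed (use valid[OF elim(2)] in auto)
      qed
    qed
    also have "\<dots> = ennreal ?c" by (simp add: D.emeasure_space_1)
    finally show ?thesis using s by (simp add: emeasure_eq_measure)
  qed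
  let ?E = "\<Union>t<k. A t"
  show ?thesis
  proof (intro bexI[of _ ?E] conjI ballI)
    show "?E \<in> sets ?M" using A by auto
    have "measure ?M ?E \<le> (\<Sum>t<k. measure ?M (A t))"
      using A by (intro finite_measure_subadditive_finite) auto
    also have "\<dots> \<le> (\<Sum>t<k. ?c)" using pA by (intro sum_mono) auto
    finally show "measure ?M ?E \<le> real k * ?c" by simp
    fix \<omega> \<alpha> assume \<omega>: "\<omega> \<in> space ?M - ?E" and \<alpha>: "\<alpha> \<in> {a..b}"
    have I: "fst \<omega> \<in> space D" using \<omega> by (auto simp: space_pair_measure)
    have "t \<le> k \<Longrightarrow> seeds (fst \<omega>) \<alpha> (snd \<omega>) t = seeds (fst \<omega>) a (snd \<omega>) t" for t
    proof (induction t)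
      case (Suc t)
      let ?C = "seeds (fst \<omega>) a (snd \<omega>) t"
      have "\<not> pick_changes (fst \<omega>) a b ?C (snd \<omega> t)" using \<omega> Suc.prems by (auto simp: A_def)
      then have "seed_pick (fst \<omega>) \<alpha> ?C (snd \<omega> t) = seed_pick (fst \<omega>) a ?C (snd \<omega> t)"
        using valid[OF I] \<alpha> by (intro seed_pick_const finite_seeds) (auto simp: pick_changes_def)
      then show ?case using Suc by simp
    qed simp
    then show "seeds (fst \<omega>) \<alpha> (snd \<omega>) k = seeds (fst \<omega>) a (snd \<omega>) k" by simp
  qed
qed

subsection \<open>Covers of the parameter space\<close>

lemma powr_diff_le:
  fixes u :: real
  assumes "0 < u" "u \<le> 1" "a \<le> b"
  shows "u powr a - u powr b \<le> u powr a * ((b - a) * (- ln u))"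
proof -
  have "1 - exp ((b - a) * ln u) \<le> - ((b - a) * ln u)"
    using exp_ge_add_one_self[of "(b - a) * ln u"] by linarith
  then have "u powr a * (1 - exp ((b - a) * ln u)) \<le> u powr a * ((b - a) * (- ln u))"
    by (intro mult_left_mono) auto
  moreover have "u powr b = u powr a * exp ((b - a) * ln u)"
    using assms by (simp add: powr_def algebra_simps flip: exp_add)
  ultimately show ?thesis by (simp add: algebra_simps)
qed

text \<open>From \<open>y \<le> exp y\<close> at \<open>y = - a * ln u\<close> one gets
  \<open>u powr a * (- ln u) \<le> 1 / a\<close>, uniformly in \<open>u\<close>: tiny ratios are
  harmless as long as the exponent is away from 0. The relative width \<open>(b - a) / a\<close> is
  the reason for a geometric grid.\<close>

lemma power_variation_geometric:
  assumes "0 < a" "a \<le> b"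
  shows "power_variation_le I a b ((b - a) / a)"
proof -
  have "u powr a - u powr b \<le> (b - a) / a" if u: "0 < u" "u \<le> 1" for u :: real
  proof -
    have "a * (- ln u) \<le> exp (a * (- ln u))"
      using exp_ge_add_one_self[of "a * (- ln u)"] by linarith
    then have "u powr a * (a * (- ln u)) \<le> u powr a * exp (a * (- ln u))"
      by (intro mult_left_mono) auto
    also have "\<dots> = 1" using u by (simp add: powr_def flip: exp_add)
    finally have "u powr a * (- ln u) \<le> 1 / a" using assms by (simp add: field_simps)
    then have "(b - a) * (u powr a * (- ln u)) \<le> (b - a) * (1 / a)"
      using assms by (intro mult_left_mono) auto
    then show ?thesis using powr_diff_le[OF u assms(2)] by (simp add: ac_simps)
  qed
  then show ?thesis unfolding power_variation_le_def by (auto simp: divide_le_eq)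
qed

text \<open>For a ratio \<open>u\<close> of two distances \<open>- ln u\<close> is at most
  \<open>ln R\<close>, a bound that survives at exponent 0. If \<open>R < 1\<close> there are no
  nonzero distances, because the ratio of one to itself is 1; the value 0 of \<Lambda> covers this
  case.\<close>

lemma power_variation_ratio:
  assumes R: "distance_ratio_bounded R I" and ab: "0 \<le> a" "a \<le> b"
    and \<Lambda>: "\<Lambda> = (if 1 \<le> R then ln R else 0)"
  shows "power_variation_le I a b ((b - a) * \<Lambda>)"
  unfolding power_variation_le_def
proof (intro allI impI)
  fix p q p' q' assume pq: "p < npts I" "q < npts I" "p' < npts I" "q' < npts I"
    and d: "0 < dst I p q" "dst I p q \<le> dst I p' q'"
  let ?u = "dst I p q / dst I p' q'"
  have R1: "dst I p q / dst I p q \<le> R" "dst I p' q' / dst I p q \<le> R"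
    using R[unfolded distance_ratio_bounded_def, rule_format, of p q p q]
      R[unfolded distance_ratio_bounded_def, rule_format, of p' q' p q] pq d by linarith+
  then have 1: "1 \<le> R" using d by simp
  have u: "0 < ?u" "?u \<le> 1" using d by auto
  have "- ln ?u = ln (dst I p' q' / dst I p q)" using d by (simp add: ln_div)
  also have "\<dots> \<le> ln R" using d R1 by (intro ln_mono) auto
  finally have l: "- ln ?u \<le> \<Lambda>" using 1 by (simp add: \<Lambda>)
  have l0: "0 \<le> - ln ?u" using u by (simp add: ln_le_zero_iff del: ln_div)
  have "?u powr a \<le> 1" using u ab by (intro powr_le1) auto
  then have "?u powr a * ((b - a) * (- ln ?u)) \<le> 1 * ((b - a) * \<Lambda>)"
    using u l l0 ab by (intro mult_mono mult_left_mono mult_nonneg_nonneg) auto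
  then show "?u powr a - ?u powr b \<le> (b - a) * \<Lambda>" using powr_diff_le[OF u ab(2)] by linarith
qed

text \<open>Cells between consecutive points \<open>x * (1 + s) ^ i\<close>, truncated at
  \<open>y\<close>. Their number is governed by \<open>ln (y / x) / ln (1 + s)\<close>, and
  \<open>ln (1 + s) \<ge> s / 2\<close> for \<open>s \<le> 1\<close>.\<close>

lemma geometric_grid:
  fixes x y s :: real
  assumes x: "0 < x" "x \<le> y" and s: "0 < s" "s \<le> 1"
  shows "\<exists>\<A>. finite \<A> \<and> real (card \<A>) \<le> 1 + 2 * ln (y / x) / s \<and>
    (\<Union>(a, b)\<in>\<A>. {a..b}) = {x..y} \<and> (\<forall>(a, b)\<in>\<A>. 0 < a \<and> a \<le> b \<and> (b - a) / a \<le> s)"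
proof -
  define M where "M z = nat \<lfloor>ln (z / x) / ln (1 + s)\<rfloor>" for z
  define cell where "cell i = (x * (1 + s) ^ i, min y (x * (1 + s) ^ Suc i))" for i :: nat
  define \<A> where "\<A> = cell ` {i\<in>{..M y}. x * (1 + s) ^ i \<le> y}"
  have l: "s / 2 \<le> ln (1 + s)"
  proof -
    have "ln (1 / (1 + s)) \<le> 1 / (1 + s) - 1" using s by (intro ln_le_minus_one) auto
    also have "\<dots> = - (s / (1 + s))" using s by (simp add: field_simps)
    finally have "s / (1 + s) \<le> ln (1 + s)" using s by (simp add: ln_div)
    moreover have "s / 2 \<le> s / (1 + s)" using s by (intro divide_left_mono) auto
    ultimately show ?thesis by linarith
  qed
  then have l0: "0 < ln (1 + s)" using s by linarith
  have M: "x * (1 + s) ^ M z \<le> z" "z \<le> x * (1 + s) ^ Suc (M z)" "M z \<le> M y" if z: "z \<in> {x..y}" for z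
  proof -
    have z0: "0 < z" using x z by auto
    have nn: "0 \<le> ln (z / x) / ln (1 + s)" using z x l0 by auto
    have pw: "ln (x * (1 + s) ^ i) = ln x + real i * ln (1 + s)" for i
      using x s by (simp add: ln_mult ln_realpow)
    have "real (M z) \<le> ln (z / x) / ln (1 + s)" using nn unfolding M_def by linarith
    then have "real (M z) * ln (1 + s) \<le> ln (z / x)" using l0 by (simp add: pos_le_divide_eq)
    then have "ln (x * (1 + s) ^ M z) \<le> ln z" unfolding pw using x z0 by (simp add: ln_div)
    then show "x * (1 + s) ^ M z \<le> z" using x s z0 by (subst (asm) ln_le_cancel_iff) auto
    have "ln (z / x) / ln (1 + s) \<le> real (Suc (M z))" using nn unfolding M_def by linarith
    then have "ln (z / x) \<le> real (Suc (M z)) * ln (1 + s)" using l0 by (simp add: pos_divide_le_eq)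
    then have "ln z \<le> ln (x * (1 + s) ^ Suc (M z))" unfolding pw using x z0 by (simp add: ln_div)
    then show "z \<le> x * (1 + s) ^ Suc (M z)" using x s z0 by (subst (asm) ln_le_cancel_iff) auto
    have "ln (z / x) \<le> ln (y / x)" using z x z0 by (auto simp: divide_right_mono)
    then show "M z \<le> M y" unfolding M_def using l0 by (intro nat_mono floor_mono divide_right_mono) auto
  qed
  show ?thesis
  proof (intro exI[of _ \<A>] conjI)
    show "finite \<A>" by (simp add: \<A>_def)
    have "card \<A> \<le> card {i\<in>{..M y}. x * (1 + s) ^ i \<le> y}" unfolding \<A>_def by (rule card_image_le) simp
    also have "\<dots> \<le> card {..M y}" by (intro card_mono) auto
    finally have "real (card \<A>) \<le> 1 + real (M y)" by simp
    also have "real (M y) \<le> ln (y / x) / ln (1 + s)"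
    proof -
      have "0 \<le> ln (y / x) / ln (1 + s)" using x l0 by auto
      then show ?thesis unfolding M_def by linarith
    qed
    also have "ln (y / x) / ln (1 + s) \<le> ln (y / x) / (s / 2)"
      using x s l l0 by (intro divide_left_mono) auto
    finally show "real (card \<A>) \<le> 1 + 2 * ln (y / x) / s" by (simp add: mult.commute)
    have c: "x \<le> x * (1 + s) ^ i" for i using x s by (simp add: mult_le_cancel_left1)
    show "(\<Union>(a, b)\<in>\<A>. {a..b}) = {x..y}"
    proof
      show "(\<Union>(a, b)\<in>\<A>. {a..b}) \<subseteq> {x..y}"
        by (auto simp: \<A>_def cell_def intro: order_trans[OF c])
      show "{x..y} \<subseteq> (\<Union>(a, b)\<in>\<A>. {a..b})"
      proof
        fix z assume z: "z \<in> {x..y}"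
        have "cell (M z) \<in> \<A>" unfolding \<A>_def using M[OF z] z by (intro imageI) auto
        moreover have "z \<in> {fst (cell (M z))..snd (cell (M z))}" using M[OF z] z by (auto simp: cell_def)
        ultimately show "z \<in> (\<Union>(a, b)\<in>\<A>. {a..b})" by (auto simp: case_prod_beta)
      qed
    qed
    have "0 < fst (cell i) \<and> fst (cell i) \<le> snd (cell i) \<and> (snd (cell i) - fst (cell i)) / fst (cell i) \<le> s"
      if "x * (1 + s) ^ i \<le> y" for i
    proof -
      define w where "w = x * (1 + s) ^ i"
      have w: "0 < w" using x s by (simp add: w_def)
      have cl: "fst (cell i) = w" "snd (cell i) = min y (w * (1 + s))" by (simp_all add: cell_def w_def ac_simps)
      have "w \<le> w * (1 + s)" using w s by simp
      moreover have "min y (w * (1 + s)) - w \<le> w * s" by (simp add: algebra_simps min_def)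
      then have "(min y (w * (1 + s)) - w) / w \<le> s" using w by (simp add: pos_divide_le_eq mult.commute)
      ultimately show ?thesis using w that unfolding cl by (simp flip: w_def)
    qed
    then show "\<forall>(a, b)\<in>\<A>. 0 < a \<and> a \<le> b \<and> (b - a) / a \<le> s" by (auto simp: \<A>_def case_prod_beta)
  qed
qed

section \<open>From grids of exponents to uniform closeness of the losses\<close>

lemma
  assumes D: "inst_distribution n k H D" and k: "1 \<le> k"
  shows clus_measurable: "(\<lambda>\<omega>. clus T \<alpha> \<beta> (fst \<omega>) (snd \<omega>)) \<in> borel_measurable (D \<Otimes>\<^sub>M unit_cube k)"
    and clus_bounds: "\<omega> \<in> space (D \<Otimes>\<^sub>M unit_cube k) \<Longrightarrow> clus T \<alpha> \<beta> (fst \<omega>) (snd \<omega>) \<in> {0..H}"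
proof -
  let ?M = "D \<Otimes>\<^sub>M unit_cube k"
  have valid: "valid_inst n k H (fst \<omega>)" if "\<omega> \<in> space ?M" for \<omega>
    using D that by (auto simp: inst_distribution_def space_pair_measure)
  interpret random_inst ?M fst by (rule inst_distribution_random_inst[OF D])
  let ?C = "\<lambda>\<omega>. (lloyd_step (fst \<omega>) \<beta> ^^ T) (seeds (fst \<omega>) \<alpha> (snd \<omega>) k)"
  have "?C \<in> ?M \<rightarrow>\<^sub>M finite_subsets"
    by (intro lloyd_iter_measurable seeds_measurable unit_cube_component_measurable)
  then have "(\<lambda>\<omega>. cl_cost (fst \<omega>) (voronoi (fst \<omega>) (?C \<omega>))) \<in> borel_measurable ?M"
    using D by (intro cost_measurable measurable_compose[OF measurable_fst]) (auto simp: inst_distribution_def)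
  moreover have eq: "clus T \<alpha> \<beta> (fst \<omega>) (snd \<omega>) = cl_cost (fst \<omega>) (voronoi (fst \<omega>) (?C \<omega>))" if "\<omega> \<in> space ?M" for \<omega>
    using valid[OF that] by (simp add: clus_def lloyd_eq_funpow valid_inst_def)
  ultimately show "(\<lambda>\<omega>. clus T \<alpha> \<beta> (fst \<omega>) (snd \<omega>)) \<in> borel_measurable ?M"
    by (subst measurable_cong) auto
  assume \<omega>: "\<omega> \<in> space ?M"
  have C: "?C \<omega> \<in> center_sets (fst \<omega>) k"
  proof (induction T)
    case 0
    then show ?case using valid[OF \<omega>] k by (auto simp: valid_inst_def intro: seeds_center_sets)
  next
    case (Suc T)
    then show ?case using valid[OF \<omega>] lloyd_step_center_sets[OF Suc] by (auto simp: valid_inst_def)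
  qed
  have "partition_on {..<npts (fst \<omega>)} (voronoi (fst \<omega>) (?C \<omega>))"
    using valid[OF \<omega>] by (intro partition_on_voronoi[OF C]) (simp add: valid_inst_def)
  moreover have "card (voronoi (fst \<omega>) (?C \<omega>)) \<le> k"
    using card_voronoi[OF C] C by (simp add: center_sets_def)
  ultimately show "clus T \<alpha> \<beta> (fst \<omega>) (snd \<omega>) \<in> {0..H}"
    unfolding eq[OF \<omega>] using valid[OF \<omega>] by (simp add: valid_inst_def)
qed

text \<open>Off \<open>E\<close> the seeds do not depend on \<alpha> within the strip. Only \<beta>
  is left, and its axis is cut for the random center set seeded with exponent \<open>a\<close>. Of
  \<open>2 * p\<close>, one half is for the seeds and one for the breakpoints.\<close>

lemma strip_cover:
  assumes D: "inst_distribution n k H D" and n: "2 \<le> n" and k: "1 \<le> k" and p: "0 < p"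
    and E: "E \<in> sets (D \<Otimes>\<^sub>M unit_cube k)" "measure (D \<Otimes>\<^sub>M unit_cube k) E \<le> p"
      "\<And>\<omega> \<alpha>. \<omega> \<in> space (D \<Otimes>\<^sub>M unit_cube k) - E \<Longrightarrow> \<alpha> \<in> {a..b} \<Longrightarrow>
         seeds (fst \<omega>) \<alpha> (snd \<omega>) k = seeds (fst \<omega>) a (snd \<omega>) k"
  shows "\<exists>\<U>. finite \<U> \<and> real (card \<U>) \<le> 2 * real (n ^ (7 * min T k)) / p + 2 \<and> \<Union>\<U> = {a..b} \<times> {1..\<infinity>} \<and>
    (\<forall>U\<in>\<U>. \<exists>F\<in>sets (D \<Otimes>\<^sub>M unit_cube k). measure (D \<Otimes>\<^sub>M unit_cube k) F \<le> 2 * p \<and>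
      (\<forall>\<omega>\<in>space (D \<Otimes>\<^sub>M unit_cube k) - F. \<forall>\<theta>\<in>U. \<forall>\<theta>'\<in>U.
         clus T (fst \<theta>) (snd \<theta>) (fst \<omega>) (snd \<omega>) = clus T (fst \<theta>') (snd \<theta>') (fst \<omega>) (snd \<omega>)))"
proof -
  let ?M = "D \<Otimes>\<^sub>M unit_cube k"
  interpret D: prob_space D using D by (simp add: inst_distribution_def)
  interpret U: prob_space "unit_cube k" by (rule prob_space_unit_cube)
  interpret pair_prob_space D "unit_cube k" ..
  interpret random_inst ?M fst by (rule inst_distribution_random_inst[OF D])
  have valid: "valid_inst n k H (fst \<omega>)" if "\<omega> \<in> space ?M" for \<omega>
    using D that by (auto simp: inst_distribution_def space_pair_measure)
  define C where "C \<omega> = seeds (fst \<omega>) a (snd \<omega>) k" for \<omega> :: "clustering_inst \<times> (nat \<Rightarrow> real)"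
  define B where "B \<omega> = lloyd_breaks (fst \<omega>) T (C \<omega>)" for \<omega>
  define g where "g \<omega> b = lloyd (fst \<omega>) (ereal b) T (C \<omega>)" for \<omega> b
  have Cm: "C \<in> ?M \<rightarrow>\<^sub>M finite_subsets"
    unfolding C_def by (intro seeds_measurable unit_cube_component_measurable)
  have v: "0 < npts (fst \<omega>)" "npts (fst \<omega>) \<le> n" "Metric_space {..<npts (fst \<omega>)} (dst (fst \<omega>))"
    "C \<omega> \<in> center_sets (fst \<omega>) k" if "\<omega> \<in> space ?M" for \<omega>
    using valid[OF that] k by (auto simp: valid_inst_def C_def intro: seeds_center_sets)
  have "\<exists>\<V>. finite \<V> \<and> real (card \<V>) \<le> 2 * real (n ^ (7 * min T k)) / p + 1 \<and> \<Union>\<V> = {0<..} \<and>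
     (\<forall>V\<in>\<V>. \<exists>F\<in>sets ?M. measure ?M F \<le> p \<and> (\<forall>\<omega>\<in>space ?M - F. \<forall>b\<in>V. \<forall>b'\<in>V. g \<omega> b = g \<omega> b'))"
  proof (rule piecewise_constant_cells[where B=B])
    show "prob_space ?M" by unfold_locales
    show "{\<omega>\<in>space ?M. B \<omega> \<inter> {a<..<b} \<noteq> {}} \<in> sets ?M" for a b
      unfolding B_def by (rule lloyd_breaks_measurable[OF Cm, where k=k]) (use v in blast)
    fix \<omega> assume \<omega>: "\<omega> \<in> space ?M"
    show "finite (B \<omega>)" "real (card (B \<omega>)) \<le> real (n ^ (7 * min T k))"
      unfolding B_def using card_lloyd_breaks[OF v(1,2)[OF \<omega>] n v(3,4)[OF \<omega>] k]
      by (auto simp del: of_nat_power intro!: of_nat_mono)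
    interpret param_iteration "\<lambda>b. lloyd_step (fst \<omega>) (ereal b)" "step_breaks (fst \<omega>)"
      "center_sets (fst \<omega>) k" "2 * npts (fst \<omega>) ^ 4"
      by (rule lloyd_param_iteration[OF v(1,3)[OF \<omega>]])
    fix b b' :: real assume b: "b < b'" "B \<omega> \<inter> {b..b'} = {}"
    have "(lloyd_step (fst \<omega>) (ereal b') ^^ T) (C \<omega>) = (lloyd_step (fst \<omega>) (ereal b) ^^ T) (C \<omega>)"
      by (rule iter_breaks_disjoint_iff(2)[where U="{b..b'}" and T=T, OF v(4)[OF \<omega>]])
        (use b in \<open>auto simp: B_def lloyd_breaks_def is_interval_1\<close>)
    then show "g \<omega> b = g \<omega> b'" by (simp add: g_def lloyd_eq_funpow)
  qed (rule p)
  then obtain \<V> where \<V>: "finite \<V> \<and> real (card \<V>) \<le> 2 * real (n ^ (7 * min T k)) / p + 1 \<and> \<Union>\<V> = {0<..} \<and>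
     (\<forall>V\<in>\<V>. \<exists>F\<in>sets ?M. measure ?M F \<le> p \<and> (\<forall>\<omega>\<in>space ?M - F. \<forall>b\<in>V. \<forall>b'\<in>V. g \<omega> b = g \<omega> b'))" ..
  have clus: "clus T \<alpha> \<beta> (fst \<omega>) (snd \<omega>) = cl_cost (fst \<omega>) (voronoi (fst \<omega>) (lloyd (fst \<omega>) \<beta> T (C \<omega>)))"
    if "\<omega> \<in> space ?M - E" "\<alpha> \<in> {a..b}" for \<omega> \<alpha> \<beta>
    using valid[of \<omega>] E(3)[OF that] that by (simp add: clus_def C_def valid_inst_def)
  define cell where "cell V = {a..b} \<times> (ereal ` V \<inter> {1..\<infinity>})" for V
  \<comment> \<open>Breakpoints concern finite exponents only; the value \<infinity> of \<beta> gets
    a cell of its own, which adds one to the count.\<close>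
  define top where "top = {a..b} \<times> {\<infinity>::ereal}"
  show ?thesis
  proof (intro exI[of _ "insert top (cell ` \<V>)"] conjI ballI)
    show "finite (insert top (cell ` \<V>))" using \<V> by simp
    have "card (insert top (cell ` \<V>)) \<le> Suc (card (cell ` \<V>))" by (rule card_insert_le_m1) auto
    also have "\<dots> \<le> Suc (card \<V>)" using \<V> by (simp add: card_image_le)
    finally have "real (card (insert top (cell ` \<V>))) \<le> real (Suc (card \<V>))" by (rule of_nat_mono)
    also have "\<dots> \<le> 2 * real (n ^ (7 * min T k)) / p + 2"
      using \<V>[THEN conjunct2, THEN conjunct1] by simp
    finally show "real (card (insert top (cell ` \<V>))) \<le> 2 * real (n ^ (7 * min T k)) / p + 2" .
    show "\<Union> (insert top (cell ` \<V>)) = {a..b} \<times> {1..\<infinity>}"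
    proof (intro equalityI subsetI)
      fix \<theta> assume \<theta>: "\<theta> \<in> {a..b} \<times> {1..\<infinity>::ereal}"
      obtain \<alpha> \<beta> where \<theta>': "\<theta> = (\<alpha>, \<beta>)" "\<alpha> \<in> {a..b}" "1 \<le> \<beta>" using \<theta> by auto
      show "\<theta> \<in> \<Union> (insert top (cell ` \<V>))"
      proof (cases \<beta>)
        case (real r)
        then have "1 \<le> r" using \<theta>' by (simp flip: one_ereal_def)
        then have "r \<in> \<Union>\<V>" using \<V> by simp
        then obtain V where V: "V \<in> \<V>" "r \<in> V" by blast
        then have "\<theta> \<in> cell V" using \<theta>' real by (auto simp: cell_def)
        then show ?thesis using V by blast
      next
        case PInf
        then show ?thesis using \<theta>' by (auto simp: top_def)
      next
        case MInf
        then show ?thesis using \<theta>' by simp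
      qed
    qed (auto simp: cell_def top_def)
    fix U assume "U \<in> insert top (cell ` \<V>)"
    then consider "U = top" | V where "V \<in> \<V>" "U = cell V" by blast
    then show "\<exists>F\<in>sets ?M. measure ?M F \<le> 2 * p \<and>
      (\<forall>\<omega>\<in>space ?M - F. \<forall>\<theta>\<in>U. \<forall>\<theta>'\<in>U.
         clus T (fst \<theta>) (snd \<theta>) (fst \<omega>) (snd \<omega>) = clus T (fst \<theta>') (snd \<theta>') (fst \<omega>) (snd \<omega>))"
    proof cases
      case 1
      show ?thesis
      proof (intro bexI[OF _ E(1)] conjI ballI)
        show "measure ?M E \<le> 2 * p" using E(2) p by linarith
        fix \<omega> \<theta> \<theta>' assume *: "\<omega> \<in> space ?M - E" "\<theta> \<in> U" "\<theta>' \<in> U"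
        then have "fst \<theta> \<in> {a..b}" "fst \<theta>' \<in> {a..b}" "snd \<theta> = \<infinity>" "snd \<theta>' = \<infinity>" by (auto simp: 1 top_def)
        then show "clus T (fst \<theta>) (snd \<theta>) (fst \<omega>) (snd \<omega>) = clus T (fst \<theta>') (snd \<theta>') (fst \<omega>) (snd \<omega>)"
          by (simp only: clus[OF *(1)])
      qed
    next
      case 2
      obtain F where F: "F \<in> sets ?M" "measure ?M F \<le> p"
        and eq: "\<forall>\<omega>\<in>space ?M - F. \<forall>b\<in>V. \<forall>b'\<in>V. g \<omega> b = g \<omega> b'"
        using \<V>[THEN conjunct2, THEN conjunct2, THEN conjunct2, rule_format, OF 2(1)] by blast
      have EF: "E \<union> F \<in> sets ?M" using E(1) F(1) by simp
      show ?thesis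
      proof (intro bexI[OF _ EF] conjI ballI)
        have "measure ?M (E \<union> F) \<le> measure ?M E + measure ?M F" using E(1) F(1) by (rule measure_Un_le)
        then show "measure ?M (E \<union> F) \<le> 2 * p" using E(2) F(2) by linarith
        fix \<omega> \<theta> \<theta>' assume *: "\<omega> \<in> space ?M - (E \<union> F)" "\<theta> \<in> U" "\<theta>' \<in> U"
        then obtain r r' where r: "fst \<theta> \<in> {a..b}" "fst \<theta>' \<in> {a..b}" "snd \<theta> = ereal r" "snd \<theta>' = ereal r'"
          "r \<in> V" "r' \<in> V" by (auto simp: 2(2) cell_def)
        have \<omega>: "\<omega> \<in> space ?M - E" "\<omega> \<in> space ?M - F" using *(1) by auto
        have "g \<omega> r = g \<omega> r'" using eq \<omega>(2) r(5,6) by blast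
        then show "clus T (fst \<theta>) (snd \<theta>) (fst \<omega>) (snd \<omega>) = clus T (fst \<theta>') (snd \<theta>') (fst \<omega>) (snd \<omega>)"
          unfolding clus[OF \<omega>(1) r(1)] clus[OF \<omega>(1) r(2)] r(3,4) g_def by simp
      qed
    qed
  qed
qed

lemma uniformly_close_of_covers:
  assumes D: "inst_distribution n k H D" and k: "1 \<le> k" and N: "3 \<le> N" and \<delta>: "0 < \<delta>" and \<epsilon>: "0 < \<epsilon>"
    and cover: "\<And>j. \<exists>\<U>. finite \<U> \<and> real (card \<U>) \<le> N * 64 ^ j \<and> \<Union>\<U> = A \<times> {1..\<infinity>} \<and>
      (\<forall>U\<in>\<U>. \<exists>F\<in>sets (D \<Otimes>\<^sub>M unit_cube k). measure (D \<Otimes>\<^sub>M unit_cube k) F \<le> (1/4) ^ j \<and>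
      (\<forall>\<omega>\<in>space (D \<Otimes>\<^sub>M unit_cube k) - F. \<forall>\<theta>\<in>U. \<forall>\<theta>'\<in>U.
         clus T (fst \<theta>) (snd \<theta>) (fst \<omega>) (snd \<omega>) = clus T (fst \<theta>') (snd \<theta>') (fst \<omega>) (snd \<omega>)))"
    and m: "\<delta> \<le> 1 \<Longrightarrow> 32768 * (H / \<epsilon>)\<^sup>2 * (ln N + ln (1 / \<delta>)) \<le> real m"
  shows "uniformly_close T k D m A \<epsilon> \<delta>"
proof -
  let ?M = "D \<Otimes>\<^sub>M unit_cube k"
  interpret D: prob_space D using D by (simp add: inst_distribution_def)
  interpret U: prob_space "unit_cube k" by (rule prob_space_unit_cube)
  interpret pair_prob_space D "unit_cube k" ..
  have bounds: "clus T \<alpha> \<beta> (fst \<omega>) (snd \<omega>) \<in> {0..H}" if "\<omega> \<in> space ?M" for \<omega> \<alpha> \<beta>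
    by (rule clus_bounds[OF D k that])
  have true: "true_loss T k D \<alpha> \<beta> = (\<integral>\<omega>. clus T \<alpha> \<beta> (fst \<omega>) (snd \<omega>) \<partial>?M)" for \<alpha> \<beta>
    by (simp add: true_loss_def case_prod_beta')
  \<comment> \<open>The chaining theorem wants \<open>\<delta> \<le> 1\<close> and
    \<open>\<epsilon> \<le> H\<close>. For \<open>\<delta> > 1\<close> the empty event qualifies;
    for \<open>\<epsilon> > H\<close> both losses lie in \<open>{0..H}\<close>, also when
    \<open>m = 0\<close>.\<close>
  consider "1 < \<delta>" | "\<delta> \<le> 1" "H < \<epsilon>" | "\<delta> \<le> 1" "\<epsilon> \<le> H" by linarith
  then show ?thesis
  proof cases
    case 1
    then show ?thesis unfolding uniformly_close_def by (intro bexI[of _ "{}"]) auto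
  next
    case 2
    interpret PS: prob_space "sample_measure D k m"
      unfolding sample_measure_def by (intro prob_space_PiM) unfold_locales
    obtain \<omega>0 where "\<omega>0 \<in> space ?M" using not_empty by blast
    from bounds[OF this, of 0 0] have H: "0 \<le> H" by auto
    show ?thesis unfolding uniformly_close_def
    proof (intro bexI[of _ "space (sample_measure D k m)"] conjI ballI)
      show "1 - \<delta> \<le> measure (sample_measure D k m) (space (sample_measure D k m))"
        using \<delta> by (simp add: PS.prob_space)
      fix S \<alpha> \<beta> assume S: "S \<in> space (sample_measure D k m)"
      have Si: "S i \<in> space ?M" if "i < m" for i
        using S that by (auto simp: sample_measure_def space_PiM PiE_iff)
      have "0 \<le> emp_loss T m S \<alpha> \<beta>"
        unfolding emp_loss_def using bounds[OF Si] by (intro divide_nonneg_nonneg sum_nonneg) auto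
      moreover have "emp_loss T m S \<alpha> \<beta> \<le> H"
      proof (cases "m = 0")
        case True
        then show ?thesis using H by (simp add: emp_loss_def)
      next
        case False
        have "(\<Sum>i<m. clus T \<alpha> \<beta> (fst (S i)) (snd (S i))) \<le> (\<Sum>i<m. H)"
          using bounds[OF Si] by (intro sum_mono) auto
        then show ?thesis using False by (simp add: emp_loss_def divide_le_eq mult.commute)
      qed
      moreover have "0 \<le> true_loss T k D \<alpha> \<beta>"
        unfolding true using bounds by (intro Bochner_Integration.integral_nonneg) auto
      moreover have "true_loss T k D \<alpha> \<beta> \<le> H"
      proof -
        have "true_loss T k D \<alpha> \<beta> \<le> (\<integral>\<omega>. H \<partial>?M)"
          unfolding true using bounds H clus_measurable[OF D k]
          by (intro integral_mono integrable_const_bound[of _ H]) auto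
        then show ?thesis by (simp add: prob_space)
      qed
      ultimately show "\<bar>emp_loss T m S \<alpha> \<beta> - true_loss T k D \<alpha> \<beta>\<bar> < \<epsilon>" using 2 by linarith
    qed auto
  next
    case 3
    let ?P = "\<Pi>\<^sub>M i\<in>{..<m}. ?M"
    have "\<exists>E\<in>sets ?P. measure ?P E \<ge> 1 - \<delta> \<and> (\<forall>S\<in>E. \<forall>\<theta>\<in>A \<times> {1..\<infinity>}.
      \<bar>(\<Sum>i<m. clus T (fst \<theta>) (snd \<theta>) (fst (S i)) (snd (S i))) / real m -
        (\<integral>\<omega>. clus T (fst \<theta>) (snd \<theta>) (fst \<omega>) (snd \<omega>) \<partial>?M)\<bar> < \<epsilon>)"
      by (rule uniform_convergence_of_covers[where H=H and N=N])
        (use 3 \<delta> \<epsilon> N m cover bounds clus_measurable[OF D k] prob_space_axioms in \<open>auto intro: less_le_trans\<close>)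
    then show ?thesis unfolding uniformly_close_def sample_measure_def emp_loss_def true by fastforce
  qed
qed

text \<open>Common core of both parameter ranges, which differ only in \<open>ell\<close> and in the
  grid. The grid contributes two powers of \<open>1 / s\<close>, each strip one power of
  \<open>1 / p\<close>; both \<open>s\<close> and \<open>p\<close> are proportional to
  \<open>(1/4) ^ j\<close>, and three powers of \<open>4 ^ j\<close> make the \<open>64 ^ j\<close>
  of the chaining theorem.\<close>

lemma uniformly_close_of_exponent_grids:
  fixes ell :: real
  assumes D: "inst_distribution n k H D" and n: "2 \<le> n" and k: "1 \<le> k" and T: "1 \<le> T"
    and \<delta>: "0 < \<delta>" and \<epsilon>: "0 < \<epsilon>" and ell: "1 \<le> ell"
    and grid: "\<And>s. 0 < s \<Longrightarrow> s \<le> 1 \<Longrightarrow> \<exists>\<A>. finite \<A> \<and> real (card \<A>) \<le> 6 * ell / s\<^sup>2 \<and>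
      (\<Union>(a, b)\<in>\<A>. {a..b}) = A \<and> (\<forall>(a, b)\<in>\<A>. a \<le> b \<and> (AE I in D. power_variation_le I a b s))"
    and m: "688128 * (H / \<epsilon>)\<^sup>2 * (real (min T k) * ln (real n) + ln (real k) + ln (1 / \<delta>) + ln ell) \<le> real m"
  shows "uniformly_close T k D m A \<epsilon> \<delta>"
proof -
  let ?M = "D \<Otimes>\<^sub>M unit_cube k"
  define N\<^sub>\<beta> where "N\<^sub>\<beta> = real (n ^ (7 * min T k))"
  \<comment> \<open>The constant is \<open>6 * 16 * 6\<close>: from the grid size, from the bound on
    \<open>(1 / s)\<^sup>2\<close>, and from the number of cells in a strip.\<close>
  define N where "N = 576 * ell * (real k)\<^sup>2 * real n ^ 4 * N\<^sub>\<beta>"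
  have N\<^sub>\<beta>: "1 \<le> N\<^sub>\<beta>" using n by (simp add: N\<^sub>\<beta>_def)
  have k1: "1 \<le> real k" and n2: "2 \<le> real n" using k n by auto
  have "576 * 1 * 1 * 1 * 1 \<le> N" unfolding N_def
    using k1 n2 N\<^sub>\<beta> ell by (intro mult_mono) (auto intro!: one_le_power)
  then have N3: "3 \<le> N" by simp
  \<comment> \<open>Here 21 is \<open>10 + 4 + 7\<close>: \<open>ln 576 \<le> 10 * ln n\<close>,
    then the factor \<open>n ^ 4\<close>, then the breakpoints; the first two are absorbed by
    \<open>min T k \<ge> 1\<close>. Times the 32768 of the chaining theorem this is 688128.\<close>
  have lnN: "ln N \<le> 21 * (real (min T k) * ln (real n) + ln (real k) + ln ell)"
  proof -
    have "ln N = ln 576 + ln ell + 2 * ln (real k) + 4 * ln (real n) + 7 * (real (min T k) * ln (real n))"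
      using k1 n2 ell unfolding N_def N\<^sub>\<beta>_def
      by (simp add: ln_mult ln_realpow)
    also have "ln 576 \<le> ln (2 ^ 10 :: real)" by (intro ln_mono) auto
    also have "ln (2 ^ 10 :: real) = 10 * ln 2" using ln_realpow[of 2 10] by simp
    also have "ln 2 \<le> ln (real n)" using n2 by (intro ln_mono) auto
    finally have "ln N \<le> 14 * ln (real n) + ln ell + 2 * ln (real k) + 7 * (real (min T k) * ln (real n))" by simp
    moreover have "1 * ln (real n) \<le> real (min T k) * ln (real n)"
      using n2 T k by (intro mult_right_mono) auto
    moreover have "0 \<le> ln ell" "0 \<le> ln (real k)" using ell k1 by auto
    ultimately show ?thesis by (simp add: algebra_simps)
  qed
  show ?thesis
  proof (rule uniformly_close_of_covers[OF D k N3 \<delta> \<epsilon>])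
    assume "\<delta> \<le> 1"
    then have "0 \<le> ln (1 / \<delta>)" using \<delta> by (intro ln_ge_zero) auto
    then have "ln N + ln (1 / \<delta>) \<le> 21 * (real (min T k) * ln (real n) + ln (real k) + ln (1 / \<delta>) + ln ell)"
      using lnN by simp
    then have le: "32768 * (H / \<epsilon>)\<^sup>2 * (ln N + ln (1 / \<delta>)) \<le>
      32768 * (H / \<epsilon>)\<^sup>2 * (21 * (real (min T k) * ln (real n) + ln (real k) + ln (1 / \<delta>) + ln ell))"
      by (intro mult_left_mono) auto
    have "32768 * h * (21 * q) = 688128 * h * q" for h q :: real by simp
    with le m show "32768 * (H / \<epsilon>)\<^sup>2 * (ln N + ln (1 / \<delta>)) \<le> real m"
      by (simp only:)
  next
    fix j
    define K where "K = real k * (real (n + 1) * real n)"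
    define p where "p = (1/4) ^ j / (2::real)"
    \<comment> \<open>Seeds change within a strip with probability at most \<open>K * s\<close>.
      This choice makes it \<open>p\<close>, half of \<open>(1/4) ^ j\<close>; the other half goes
      to the breakpoints in \<beta>.\<close>
    define s where "s = p / K"
    have K1: "1 \<le> K" unfolding K_def using k1 n2 by (simp add: mult_ge1_I)
    have K2: "K \<le> 2 * real k * (real n)\<^sup>2"
    proof -
      have "real (n + 1) * real n \<le> (2 * real n) * real n" using n2 by (intro mult_right_mono) auto
      then have "real k * (real (n + 1) * real n) \<le> real k * ((2 * real n) * real n)"
        by (intro mult_left_mono) auto
      then show ?thesis by (simp add: K_def power2_eq_square)
    qed
    have "(1/4) ^ j \<le> (1::real)" by (intro power_le_one) auto
    then have p: "0 < p" "p \<le> 1" by (auto simp: p_def)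
    have s: "0 < s" "s \<le> 1" using p K1 by (auto simp: s_def divide_le_eq)
    obtain \<A> where \<A>: "finite \<A>" "real (card \<A>) \<le> 6 * ell / s\<^sup>2" "(\<Union>(a, b)\<in>\<A>. {a..b}) = A"
      "\<And>a b. (a, b) \<in> \<A> \<Longrightarrow> a \<le> b \<and> (AE I in D. power_variation_le I a b s)"
      using grid[OF s] by blast
    let ?cov = "\<lambda>c \<U>. finite \<U> \<and> real (card \<U>) \<le> 2 * N\<^sub>\<beta> / p + 2 \<and> \<Union>\<U> = {fst c..snd c} \<times> {1..\<infinity>} \<and>
      (\<forall>U\<in>\<U>. \<exists>F\<in>sets ?M. measure ?M F \<le> 2 * p \<and>
      (\<forall>\<omega>\<in>space ?M - F. \<forall>\<theta>\<in>U. \<forall>\<theta>'\<in>U.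
         clus T (fst \<theta>) (snd \<theta>) (fst \<omega>) (snd \<omega>) = clus T (fst \<theta>') (snd \<theta>') (fst \<omega>) (snd \<omega>)))"
    have "\<exists>\<U>. ?cov c \<U>" if c: "c \<in> \<A>" for c
    proof -
      obtain a b where ab: "c = (a, b)" by force
      have 1: "a \<le> b" "AE I in D. power_variation_le I a b s" using \<A>(4)[of a b] c by (auto simp: ab)
      obtain E where E: "E \<in> sets ?M" "measure ?M E \<le> real k * (real (n + 1) * (real n * s))"
        "\<forall>\<omega>\<in>space ?M - E. \<forall>\<alpha>\<in>{a..b}. seeds (fst \<omega>) \<alpha> (snd \<omega>) k = seeds (fst \<omega>) a (snd \<omega>) k"
        using seeds_const_event[OF D 1(1) less_imp_le[OF s(1)] 1(2)] by blast
      have "real k * (real (n + 1) * (real n * s)) = K * s" by (simp add: K_def)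
      also have "\<dots> = p" using K1 by (simp add: s_def)
      finally have "measure ?M E \<le> p" using E(2) by simp
      from strip_cover[OF D n k p(1) E(1) this E(3)[rule_format], where T=T]
      show ?thesis by (simp add: ab N\<^sub>\<beta>_def)
    qed
    then have "\<forall>c\<in>\<A>. \<exists>\<U>. ?cov c \<U>" by blast
    from bchoice[OF this] obtain \<V> where \<V>: "\<forall>c\<in>\<A>. ?cov c (\<V> c)" ..
    let ?U = "\<Union>c\<in>\<A>. \<V> c"
    show "\<exists>\<U>. finite \<U> \<and> real (card \<U>) \<le> N * 64 ^ j \<and> \<Union>\<U> = A \<times> {1..\<infinity>} \<and>
      (\<forall>U\<in>\<U>. \<exists>F\<in>sets ?M. measure ?M F \<le> (1/4) ^ j \<and>
      (\<forall>\<omega>\<in>space ?M - F. \<forall>\<theta>\<in>U. \<forall>\<theta>'\<in>U.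
         clus T (fst \<theta>) (snd \<theta>) (fst \<omega>) (snd \<omega>) = clus T (fst \<theta>') (snd \<theta>') (fst \<omega>) (snd \<omega>)))"
    proof (intro exI[of _ ?U] conjI ballI)
      show "finite ?U" using \<A>(1) \<V> by (intro finite_UN_I) blast+
      have "real (card ?U) \<le> real (\<Sum>c\<in>\<A>. card (\<V> c))"
        by (intro of_nat_mono card_UN_le \<A>(1))
      also have "\<dots> \<le> real (card \<A>) * (2 * N\<^sub>\<beta> / p + 2)"
        unfolding of_nat_sum by (rule sum_bounded_above) (use \<V> in blast)
      also have "\<dots> \<le> (6 * ell / s\<^sup>2) * (6 * N\<^sub>\<beta> * 4 ^ j)"
      proof (rule mult_mono)
        have "2 * N\<^sub>\<beta> / p = 4 * (N\<^sub>\<beta> * 4 ^ j)" by (simp add: p_def power_one_over field_simps)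
        moreover have "1 * 1 \<le> N\<^sub>\<beta> * 4 ^ j" using N\<^sub>\<beta> by (intro mult_mono) auto
        ultimately show "2 * N\<^sub>\<beta> / p + 2 \<le> 6 * N\<^sub>\<beta> * 4 ^ j" by simp
      qed (use \<A>(2) N\<^sub>\<beta> p ell in auto)
      also have "\<dots> \<le> (6 * ell * (16 * (real k)\<^sup>2 * real n ^ 4 * 16 ^ j)) * (6 * N\<^sub>\<beta> * 4 ^ j)"
      proof (rule mult_right_mono)
        have "1 / s = 2 * K * 4 ^ j" by (simp add: s_def p_def power_one_over field_simps)
        also have "\<dots> \<le> 2 * (2 * real k * (real n)\<^sup>2) * 4 ^ j" using K1 K2 by (intro mult_mono) auto
        finally have "(1 / s)\<^sup>2 \<le> (2 * (2 * real k * (real n)\<^sup>2) * 4 ^ j)\<^sup>2" using s by (intro power_mono) auto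
        also have "\<dots> = 16 * (real k)\<^sup>2 * real n ^ 4 * 16 ^ j"
        proof -
          have "(2 * (2 * u * v\<^sup>2) * w)\<^sup>2 = 16 * u\<^sup>2 * v ^ 4 * (w * w)" for u v w :: real
            by (simp add: power2_eq_square power4_eq_xxxx)
          moreover have "(4::real) ^ j * 4 ^ j = 16 ^ j" by (simp flip: power_mult_distrib)
          ultimately show ?thesis by simp
        qed
        finally have "6 * ell * (1 / s)\<^sup>2 \<le> 6 * ell * (16 * (real k)\<^sup>2 * real n ^ 4 * 16 ^ j)"
          using ell by (intro mult_left_mono) auto
        then show "6 * ell / s\<^sup>2 \<le> 6 * ell * (16 * (real k)\<^sup>2 * real n ^ 4 * 16 ^ j)"
          by (simp add: power_inverse divide_inverse)
      qed (use N\<^sub>\<beta> in auto)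
      also have "\<dots> = N * (16 ^ j * 4 ^ j)" by (simp add: N_def)
      also have "(16::real) ^ j * 4 ^ j = 64 ^ j" by (simp flip: power_mult_distrib)
      finally show "real (card ?U) \<le> N * 64 ^ j" .
      have "\<Union>?U = (\<Union>c\<in>\<A>. \<Union>(\<V> c))" by blast
      also have "\<dots> = (\<Union>c\<in>\<A>. {fst c..snd c} \<times> {1..\<infinity>})" using \<V> by (intro SUP_cong) blast+
      also have "\<dots> = A \<times> {1..\<infinity>}" unfolding \<A>(3)[symmetric] by (auto simp: case_prod_beta)
      finally show "\<Union>?U = A \<times> {1..\<infinity>}" .
      fix U assume "U \<in> ?U"
      then obtain c where c: "c \<in> \<A>" "U \<in> \<V> c" by blast
      have p2: "(1/4) ^ j = 2 * p" by (simp add: p_def)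
      show "\<exists>F\<in>sets ?M. measure ?M F \<le> (1/4) ^ j \<and>
        (\<forall>\<omega>\<in>space ?M - F. \<forall>\<theta>\<in>U. \<forall>\<theta>'\<in>U.
         clus T (fst \<theta>) (snd \<theta>) (fst \<omega>) (snd \<omega>) = clus T (fst \<theta>') (snd \<theta>') (fst \<omega>) (snd \<omega>))"
        unfolding p2 by (rule \<V>[rule_format, OF c(1), THEN conjunct2, THEN conjunct2, THEN conjunct2, rule_format, OF c(2)])
    qed
  qed
qed

section \<open>Grids for the two parameter ranges\<close>

text \<open>The factor of the grid cardinality whose logarithm is \<open>loglog\<close>. Truncation
  at 1 makes it a valid \<open>ell\<close> for short intervals as well.\<close>

definition grid_size :: "real \<Rightarrow> real" where
  "grid_size x = max 1 (ln (max 1 x))"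

lemma loglog_eq: "loglog x = ln (grid_size x)"
  by (simp add: loglog_def grid_size_def)

lemma grid_size_ge_1: "1 \<le> grid_size x"
  by (simp add: grid_size_def)

lemma ln_le_grid_size: "0 < x \<Longrightarrow> ln x \<le> grid_size x"
proof -
  assume "0 < x"
  then have "ln x \<le> ln (max 1 x)" by (intro ln_mono) auto
  then show ?thesis by (simp add: grid_size_def)
qed

lemma power_variation_mono: "power_variation_le I a b s \<Longrightarrow> s \<le> s' \<Longrightarrow> power_variation_le I a b s'"
  unfolding power_variation_le_def by (meson order_trans)

text \<open>Order \<open>1 / s\<close> cells suffice here; \<open>1 / s\<^sup>2\<close> is the
  format shared with the range that reaches down to exponent 0.\<close>

lemma positive_exponent_grid:
  assumes \<alpha>: "0 < \<alpha>l" "\<alpha>l \<le> \<alpha>h" and s: "0 < s" "s \<le> 1"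
  shows "\<exists>\<A>. finite \<A> \<and> real (card \<A>) \<le> 6 * grid_size (\<alpha>h / \<alpha>l) / s\<^sup>2 \<and>
    (\<Union>(a, b)\<in>\<A>. {a..b}) = {\<alpha>l..\<alpha>h} \<and>
    (\<forall>(a, b)\<in>\<A>. a \<le> b \<and> (AE I in D. power_variation_le I a b s))"
proof -
  let ?l = "grid_size (\<alpha>h / \<alpha>l)"
  obtain \<A> where \<A>: "finite \<A>" "real (card \<A>) \<le> 1 + 2 * ln (\<alpha>h / \<alpha>l) / s"
    "(\<Union>(a, b)\<in>\<A>. {a..b}) = {\<alpha>l..\<alpha>h}" "\<forall>(a, b)\<in>\<A>. 0 < a \<and> a \<le> b \<and> (b - a) / a \<le> s"
    using geometric_grid[OF \<alpha> s] by blast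
  have l: "ln (\<alpha>h / \<alpha>l) \<le> ?l" using \<alpha> by (intro ln_le_grid_size) auto
  have ss: "s\<^sup>2 \<le> s" using s by (simp add: power2_eq_square mult_left_le)
  have "1 + 2 * ln (\<alpha>h / \<alpha>l) / s \<le> ?l / s\<^sup>2 + 2 * ?l / s\<^sup>2"
  proof (rule add_mono)
    have "1 * s\<^sup>2 \<le> ?l" using grid_size_ge_1[of "\<alpha>h / \<alpha>l"] ss s by simp
    then show "1 \<le> ?l / s\<^sup>2" using s by (simp add: pos_le_divide_eq)
    have "2 * ln (\<alpha>h / \<alpha>l) / s \<le> 2 * ?l / s" using l s by (intro divide_right_mono) auto
    also have "\<dots> \<le> 2 * ?l / s\<^sup>2" using ss s grid_size_ge_1[of "\<alpha>h / \<alpha>l"] by (intro divide_left_mono) auto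
    finally show "2 * ln (\<alpha>h / \<alpha>l) / s \<le> 2 * ?l / s\<^sup>2" .
  qed
  also have "\<dots> \<le> 6 * ?l / s\<^sup>2"
    using grid_size_ge_1[of "\<alpha>h / \<alpha>l"] by (simp flip: add_divide_distrib) (intro divide_right_mono, auto)
  finally have "real (card \<A>) \<le> 6 * ?l / s\<^sup>2" using \<A>(2) by linarith
  moreover have "\<forall>(a, b)\<in>\<A>. a \<le> b \<and> (AE I in D. power_variation_le I a b s)"
    using \<A>(4) power_variation_mono[OF power_variation_geometric] by fastforce
  ultimately show ?thesis using \<A>(1,3) by blast
qed

text \<open>
  Below \<open>s / ln R\<close> a single cell suffices, so the geometric grid starts there.
\<close>
lemma bounded_ratio_exponent_grid:
  assumes \<alpha>: "0 < \<alpha>h" and R: "AE I in D. distance_ratio_bounded R I" and s: "0 < s" "s \<le> 1"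
  shows "\<exists>\<A>. finite \<A> \<and> real (card \<A>) \<le> 6 * grid_size (\<alpha>h * ln R) / s\<^sup>2 \<and>
    (\<Union>(a, b)\<in>\<A>. {a..b}) = {0..\<alpha>h} \<and>
    (\<forall>(a, b)\<in>\<A>. a \<le> b \<and> (AE I in D. power_variation_le I a b s))"
proof -
  let ?l = "grid_size (\<alpha>h * ln R)"
  define \<Lambda> where "\<Lambda> = (if 1 \<le> R then ln R else 0)"
  have ss: "s\<^sup>2 \<le> s" "0 < s\<^sup>2" using s by (auto simp: power2_eq_square mult_left_le)
  have l1: "1 \<le> ?l" by (rule grid_size_ge_1)
  have first: "AE I in D. power_variation_le I 0 b s" if "0 \<le> b" "b * \<Lambda> \<le> s" for b
    using R by eventually_elim (use power_variation_ratio[OF _ order_refl that(1) \<Lambda>_def] that power_variation_mono in fastforce)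
  show ?thesis
  \<comment> \<open>In the first case, which includes a zero \<Lambda>, the whole range is a single
    cell.\<close>
  proof (cases "\<alpha>h * \<Lambda> \<le> s")
    case True
    have "1 * s\<^sup>2 \<le> 6 * ?l" using ss s l1 by linarith
    then have "1 \<le> 6 * ?l / s\<^sup>2" using ss by (simp only: pos_le_divide_eq)
    then show ?thesis using first[OF _ True] \<alpha> by (intro exI[of _ "{(0, \<alpha>h)}"]) auto
  next
    case False
    then have \<Lambda>0: "0 < \<Lambda>" using \<alpha> s by (smt (verit) mult_nonneg_nonpos)
    then have \<Lambda>R: "\<Lambda> = ln R" by (auto simp: \<Lambda>_def split: if_splits)
    define x where "x = s / \<Lambda>"
    have x: "0 < x" "x \<le> \<alpha>h" using s \<Lambda>0 False by (auto simp: x_def pos_divide_le_eq)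
    obtain \<A> where \<A>: "finite \<A>" "real (card \<A>) \<le> 1 + 2 * ln (\<alpha>h / x) / s"
      "(\<Union>(a, b)\<in>\<A>. {a..b}) = {x..\<alpha>h}" "\<forall>(a, b)\<in>\<A>. 0 < a \<and> a \<le> b \<and> (b - a) / a \<le> s"
      using geometric_grid[OF x s] by blast
    have ls: "1 \<le> ?l / s" "1 / s \<le> ?l / s" "?l \<le> ?l / s"
      using l1 s by (auto simp: pos_le_divide_eq mult_left_le divide_right_mono)
    \<comment> \<open>The start \<open>s / \<Lambda>\<close> of the geometric grid depends on
      \<open>s\<close>; its contribution \<open>ln (1 / s)\<close> is bounded by
      \<open>1 / s\<close>, which is where the second power of \<open>1 / s\<close> comes
      from.\<close>
    have "ln (\<alpha>h / x) = ln (\<alpha>h * \<Lambda>) + ln (1 / s)" using \<alpha> \<Lambda>0 s by (simp add: x_def ln_mult ln_div)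
    also have "\<dots> \<le> ?l + 1 / s"
    proof (rule add_mono)
      show "ln (\<alpha>h * \<Lambda>) \<le> ?l" unfolding \<Lambda>R using \<alpha> \<Lambda>0 \<Lambda>R by (intro ln_le_grid_size) auto
      show "ln (1 / s) \<le> 1 / s" using s ln_le_minus_one[of "1 / s"] by simp
    qed
    also have "\<dots> \<le> 2 * (?l / s)" using ls by linarith
    finally have "2 * ln (\<alpha>h / x) / s \<le> 2 * (2 * (?l / s)) / s" using s by (intro divide_right_mono) auto
    also have "\<dots> = 4 * (?l / s\<^sup>2)" by (simp add: power2_eq_square)
    finally have "1 + real (card \<A>) \<le> 2 + 4 * (?l / s\<^sup>2)" using \<A>(2) by linarith
    moreover have "1 * s\<^sup>2 \<le> ?l" using ss s l1 by linarith
    then have "1 \<le> ?l / s\<^sup>2" using ss by (simp only: pos_le_divide_eq)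
    moreover have "card (insert (0, x) \<A>) \<le> 1 + card \<A>" using card_insert_le_m1[of "1 + card \<A>" \<A> "(0, x)"] by simp
    ultimately have "real (card (insert (0, x) \<A>)) \<le> 6 * ?l / s\<^sup>2" by linarith
    moreover have "(\<Union>(a, b)\<in>insert (0, x) \<A>. {a..b}) = {0..\<alpha>h}" using \<A>(3) x by auto
    moreover have "AE I in D. power_variation_le I 0 x s" using x \<Lambda>0 by (intro first) (auto simp: x_def)
    then have "\<forall>(a, b)\<in>insert (0, x) \<A>. a \<le> b \<and> (AE I in D. power_variation_le I a b s)"
      using \<A>(4) power_variation_mono[OF power_variation_geometric] x by fastforce
    ultimately show ?thesis using \<A>(1) by (intro exI[of _ "insert (0, x) \<A>"]) blast
  qed
qed

theorem theorem6:
  "(\<exists>c>0. \<forall>(n::nat) (k::nat) (T::nat) (H::real) D (\<epsilon>::real) (\<delta>::real) (\<alpha>l::real) (\<alpha>h::real) (m::nat).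
      2 \<le> n \<longrightarrow> 1 \<le> k \<longrightarrow> 1 \<le> T \<longrightarrow> inst_distribution n k H D \<longrightarrow>
      0 < \<epsilon> \<longrightarrow> 0 < \<delta> \<longrightarrow> 0 < \<alpha>l \<longrightarrow> \<alpha>l \<le> \<alpha>h \<longrightarrow>
      real m \<ge> c * (H / \<epsilon>)\<^sup>2 *
        (real (min T k) * ln (real n) + ln (real k) + ln (1 / \<delta>) + loglog (\<alpha>h / \<alpha>l)) \<longrightarrow>
      uniformly_close T k D m {\<alpha>l..\<alpha>h} \<epsilon> \<delta>) \<and>
   (\<exists>c>0. \<forall>(n::nat) (k::nat) (T::nat) (H::real) D (\<epsilon>::real) (\<delta>::real) (\<alpha>h::real) (R::real) (m::nat).
      2 \<le> n \<longrightarrow> 1 \<le> k \<longrightarrow> 1 \<le> T \<longrightarrow> inst_distribution n k H D \<longrightarrow>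
      (AE I in D. distance_ratio_bounded R I) \<longrightarrow>
      0 < \<epsilon> \<longrightarrow> 0 < \<delta> \<longrightarrow> 0 < \<alpha>h \<longrightarrow>
      real m \<ge> c * (H / \<epsilon>)\<^sup>2 *
        (real (min T k) * ln (real n) + ln (real k) + ln (1 / \<delta>) + loglog (\<alpha>h * ln R)) \<longrightarrow>
      uniformly_close T k D m {0..\<alpha>h} \<epsilon> \<delta>)"
proof (intro conjI exI[of _ "688128::real"] allI impI)
  fix n k T :: nat and H :: real and D and \<epsilon> \<delta> \<alpha>l \<alpha>h :: real and m :: nat
  assume n: "2 \<le> n" and k: "1 \<le> k" and T: "1 \<le> T" and D: "inst_distribution n k H D"
    and \<epsilon>: "0 < \<epsilon>" and \<delta>: "0 < \<delta>" and \<alpha>: "0 < \<alpha>l" "\<alpha>l \<le> \<alpha>h"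
    and m: "688128 * (H / \<epsilon>)\<^sup>2 *
      (real (min T k) * ln (real n) + ln (real k) + ln (1 / \<delta>) + loglog (\<alpha>h / \<alpha>l)) \<le> real m"
  show "uniformly_close T k D m {\<alpha>l..\<alpha>h} \<epsilon> \<delta>"
    by (rule uniformly_close_of_exponent_grids[OF D n k T \<delta> \<epsilon> grid_size_ge_1
          positive_exponent_grid[OF \<alpha>] m[unfolded loglog_eq]])
next
  fix n k T :: nat and H :: real and D and \<epsilon> \<delta> \<alpha>h R :: real and m :: nat
  assume n: "2 \<le> n" and k: "1 \<le> k" and T: "1 \<le> T" and D: "inst_distribution n k H D"
    and R: "AE I in D. distance_ratio_bounded R I" and \<epsilon>: "0 < \<epsilon>" and \<delta>: "0 < \<delta>" and \<alpha>: "0 < \<alpha>h"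
    and m: "688128 * (H / \<epsilon>)\<^sup>2 *
      (real (min T k) * ln (real n) + ln (real k) + ln (1 / \<delta>) + loglog (\<alpha>h * ln R)) \<le> real m"
  show "uniformly_close T k D m {0..\<alpha>h} \<epsilon> \<delta>"
    by (rule uniformly_close_of_exponent_grids[OF D n k T \<delta> \<epsilon> grid_size_ge_1
          bounded_ratio_exponent_grid[OF \<alpha> R] m[unfolded loglog_eq]])
qed simp_all

end
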